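(* For a bijection $f:\mathbb{Z}\to\mathbb{Z}$, the following conditions are quantitatively equivalent: (1) $f$ is $\eta$-quasisymmetric for some homeomorphism $\eta:[0,+\infty)\to[0,+\infty)$. (2) The sequence $\{a_n:=f(n)\}_{n\in\mathbb{Z}}$ satisfies the $\lambda$-three point condition for some $\lambda\ge1$. (3) $f$ admits a $K$-quasiconformal extension $F:\mathbb{C}\to\mathbb{C}$ for some $K\ge1$ (i.e. $F(n)=f(n)$ for all $n\in\mathbb{Z}$).
   Context: "Quantitatively equivalent" means that the conditions are equivalent and, for each implication, the data ($\eta$, $\lambda$, or $K$) of the conclusion can be chosen depending only on the data of the hypothesis (and not on $f$). Let $\eta:[0,+\infty)\to[0,+\infty)$ be a homeomorphism and $X\subset\mathbb{C}$. An injection $f:X\to\mathbb{C}$ is $\eta$-quasisymmetric if $\left|\frac{f(x)-f(y)}{f(x)-f(z)}\right|\le\eta\left(\left|\frac{x-y}{x-z}\right|\right)$ for all $x,y,z\in X$ with $x\ne z$. A sequence $\{a_n\}_{n\in\mathbb{Z}}$ satisfies the $\lambda$-three point condition ($\lambda\ge1$) if $\left|\frac{a_n-a_m}{a_n-a_k}\right|\le\lambda$ for all integers $n<m<k$. For $K\ge1$ and a domain $\Omega\subset\mathbb{C}$, an orientation preserving homeomorphism $F$ of $\Omega$ into $\mathbb{C}$ is $K$-quasiconformal if its distributional derivatives $F_z,F_{\bar z}$ are locally integrable and $\operatorname{ess\,sup}_{z\in\Omega}\frac{|F_z(z)|+|F_{\bar z}(z)|}{|F_z(z)|-|F_{\bar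 z}(z)|}\le K$. *)

theory Defs
  imports "HOL-Complex_Analysis.Winding_Numbers" "HOL-Probability.Essential_Supremum"
begin

subsection \<open>Quasisymmetric maps and the three point condition\<close>

text \<open>Only the values of \<open>\<eta>\<close> on \<open>{0..}\<close> and of \<open>f\<close> on \<open>X\<close> matter.\<close>

definition quasisymmetric_on ::
    "(real \<Rightarrow> real) \<Rightarrow> complex set \<Rightarrow> (complex \<Rightarrow> complex) \<Rightarrow> bool" where
  "quasisymmetric_on \<eta> X f \<longleftrightarrow>
     (\<exists>\<theta>. homeomorphism {0..} {0..} \<eta> \<theta>) \<and> inj_on f X \<and>
     (\<forall>x\<in>X. \<forall>y\<in>X. \<forall>z\<in>X. x \<noteq> z \<longrightarrow>
        norm ((f x - f y) / (f x - f z)) \<le> \<eta> (norm ((x - y) / (x - z))))"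

text \<open>The quotient is meaningful for sequences without repeated terms, which is the only case in
  which the condition is used.\<close>

definition three_point_condition :: "real \<Rightarrow> (int \<Rightarrow> complex) \<Rightarrow> bool" where
  "three_point_condition lam a \<longleftrightarrow>
     lam \<ge> 1 \<and> (\<forall>n m k. n < m \<and> m < k \<longrightarrow> norm ((a n - a m) / (a n - a k)) \<le> lam)"

subsection \<open>Distributional derivatives in the plane\<close>

text \<open>The derivatives below are real Frechet derivatives on the plane. A function is \<open>C\<^sup>\<infinity>\<close> iff
  all its iterated directional derivatives exist and are again differentiable.\<close>

primrec times_differentiable :: "nat \<Rightarrow> (complex \<Rightarrow> complex) \<Rightarrow> bool" where
  "times_differentiable 0 \<phi> \<longleftrightarrow> continuous_on UNIV \<phi>"
| "times_differentiable (Suc k) \<phi> \<longleftrightarrow>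
     (\<forall>z. \<phi> differentiable (at z)) \<and>
     (\<forall>v. times_differentiable k (\<lambda>z. frechet_derivative \<phi> (at z) v))"

definition test_function :: "complex set \<Rightarrow> (complex \<Rightarrow> complex) \<Rightarrow> bool" where
  "test_function \<Omega> \<phi> \<longleftrightarrow>
     (\<forall>k. times_differentiable k \<phi>) \<and>
     compact (closure {z. \<phi> z \<noteq> 0}) \<and> closure {z. \<phi> z \<noteq> 0} \<subseteq> \<Omega>"

definition wirtinger :: "(complex \<Rightarrow> complex) \<Rightarrow> complex \<Rightarrow> complex" where
  "wirtinger \<phi> z =
     (frechet_derivative \<phi> (at z) 1 - \<i> * frechet_derivative \<phi> (at z) \<i>) / 2"

definition wirtinger_bar :: "(complex \<Rightarrow> complex) \<Rightarrow> complex \<Rightarrow> complex" where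
  "wirtinger_bar \<phi> z =
     (frechet_derivative \<phi> (at z) 1 + \<i> * frechet_derivative \<phi> (at z) \<i>) / 2"

definition locally_integrable_on :: "complex set \<Rightarrow> (complex \<Rightarrow> complex) \<Rightarrow> bool" where
  "locally_integrable_on \<Omega> g \<longleftrightarrow> (\<forall>K. compact K \<and> K \<subseteq> \<Omega> \<longrightarrow> set_integrable lebesgue K g)"

text \<open>\<open>g\<close> is the distributional derivative \<open>D F\<close> on \<open>\<Omega>\<close>, where \<open>D\<close> is one of the two
  operators above, acting classically on test functions.\<close>

definition distributional_derivative ::
    "((complex \<Rightarrow> complex) \<Rightarrow> complex \<Rightarrow> complex) \<Rightarrow> complex set \<Rightarrow>
     (complex \<Rightarrow> complex) \<Rightarrow> (complex \<Rightarrow> complex) \<Rightarrow> bool" where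
  "distributional_derivative D \<Omega> F g \<longleftrightarrow>
     (\<forall>\<phi>. test_function \<Omega> \<phi> \<longrightarrow>
        (LINT z:\<Omega>|lebesgue. F z * D \<phi> z) = - (LINT z:\<Omega>|lebesgue. g z * \<phi> z))"

subsection \<open>Quasiconformal maps\<close>

definition homeomorphic_embedding :: "complex set \<Rightarrow> (complex \<Rightarrow> complex) \<Rightarrow> bool" where
  "homeomorphic_embedding \<Omega> F \<longleftrightarrow> (\<exists>G. homeomorphism \<Omega> (F ` \<Omega>) F G)"

text \<open>Orientation preserving means local degree \<open>1\<close>: the image of a positively oriented circle
  bounding a disc in \<open>\<Omega>\<close> winds once, positively, around the image of the centre.\<close>

definition orientation_preserving :: "complex set \<Rightarrow> (complex \<Rightarrow> complex) \<Rightarrow> bool" where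
  "orientation_preserving \<Omega> F \<longleftrightarrow>
     (\<forall>z r. 0 < r \<and> cball z r \<subseteq> \<Omega> \<longrightarrow> winding_number (F \<circ> circlepath z r) (F z) = 1)"

text \<open>The quotient \<open>(p + q) / (p - q)\<close> for \<open>p = \<bar>F\<^sub>z\<bar>\<close> and \<open>q\<close> the modulus of the other
  derivative. Where both vanish it is \<open>1\<close>. At other points with \<open>p \<le> q\<close> it is \<open>\<infinity>\<close>; a plain real
  quotient would be \<open>0\<close> or negative there and would satisfy every upper bound.\<close>

definition dilatation :: "complex \<Rightarrow> complex \<Rightarrow> ereal" where
  "dilatation a b =
     (if a = 0 \<and> b = 0 then 1
      else if norm b < norm a then ereal ((norm a + norm b) / (norm a - norm b))
      else \<infinity>)"

definition quasiconformal_on :: "real \<Rightarrow> complex set \<Rightarrow> (complex \<Rightarrow> complex) \<Rightarrow> bool" where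
  "quasiconformal_on K \<Omega> F \<longleftrightarrow>
     K \<ge> 1 \<and> open \<Omega> \<and> connected \<Omega> \<and> \<Omega> \<noteq> {} \<and>
     homeomorphic_embedding \<Omega> F \<and> orientation_preserving \<Omega> F \<and>
     (\<exists>Fz Fzbar.
        locally_integrable_on \<Omega> Fz \<and> distributional_derivative wirtinger \<Omega> F Fz \<and>
        locally_integrable_on \<Omega> Fzbar \<and> distributional_derivative wirtinger_bar \<Omega> F Fzbar \<and>
        esssup (lebesgue_on \<Omega>) (\<lambda>z. dilatation (Fz z) (Fzbar z)) \<le> ereal K)"

definition has_quasiconformal_extension :: "real \<Rightarrow> (complex \<Rightarrow> complex) \<Rightarrow> bool" where
  "has_quasiconformal_extension K f \<longleftrightarrow>
     (\<exists>F. quasiconformal_on K UNIV F \<and> (\<forall>n\<in>\<int>. F n = f n))"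

subsection \<open>Quantitative equivalence\<close>

text \<open>\<open>P a f\<close> reads ``\<open>f\<close> satisfies \<open>P\<close> with data \<open>a\<close>''. The data \<open>b\<close> of the conclusion is chosen
  before \<open>f\<close>, so it depends on \<open>a\<close> only. The
  admissible range of the data is part of the predicates.\<close>

definition quantitatively_implies ::
    "'f set \<Rightarrow> ('a \<Rightarrow> 'f \<Rightarrow> bool) \<Rightarrow> ('b \<Rightarrow> 'f \<Rightarrow> bool) \<Rightarrow> bool" where
  "quantitatively_implies C P Q \<longleftrightarrow> (\<forall>a. \<exists>b. \<forall>f\<in>C. P a f \<longrightarrow> Q b f)"

definition quantitatively_equivalent ::
    "'f set \<Rightarrow> ('a \<Rightarrow> 'f \<Rightarrow> bool) \<Rightarrow> ('b \<Rightarrow> 'f \<Rightarrow> bool) \<Rightarrow> bool" where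
  "quantitatively_equivalent C P Q \<longleftrightarrow>
     quantitatively_implies C P Q \<and> quantitatively_implies C Q P"

lemma quantitatively_equivalent_imp_equivalent:
  assumes "quantitatively_equivalent C P Q" "f \<in> C"
  shows "(\<exists>a. P a f) \<longleftrightarrow> (\<exists>b. Q b f)"
  using assms unfolding quantitatively_equivalent_def quantitatively_implies_def by blast

text \<open>Bijections of the integers, as a subset of the plane; values off \<open>\<int>\<close> are irrelevant.\<close>

definition integer_bijections :: "(complex \<Rightarrow> complex) set" where
  "integer_bijections = {f. bij_betw f \<int> \<int>}"

end

theory Submission
  imports Defs
begin

text \<open>
  A bijection \<open>f\<close> of the integers satisfying the three point condition is bi-Lipschitz, with a constant
  depending on \<open>\<lambda>\<close> only. Indeed the indices between those of two neighbouring values have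
  values close to these, which bounds the steps of \<open>f\<close>'s inverse, and a large step of \<open>f\<close> would make
  two branches of the inverse run side by side. Bi-Lipschitz maps are quasisymmetric with linear
  \<open>\<eta>\<close>, and if \<open>A\<close> and \<open>B\<close> are \<open>C\<^sup>1\<close> interpolations of \<open>f\<close> and its inverse with bounded
  derivatives, then \<open>(x, y) \<mapsto> (y + A x, B (y + A x) - x)\<close> is an area preserving diffeomorphism with
  bounded derivative that extends \<open>f\<close>.

  Conversely let \<open>F\<close> be a quasiconformal extension. Mollification gives smooth maps converging to \<open>F\<close>
  locally uniformly whose derivatives converge in \<open>L\<^sup>1\<close>. By a one-dimensional maximal inequality
  the plane is, up to a null set, a union of sets on each of which \<open>F\<close> is differentiable relative to
  the set, with the distributional derivative; change of variables bounds the integral of the Jacobian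
  over a set by the area of its image. If \<open>\<bar>F z1 - F z0\<bar>\<close> is much larger than \<open>\<bar>F z2 - F z0\<bar>\<close> although
  \<open>z1\<close> is closer to \<open>z0\<close> than \<open>z2\<close>, then the image of the boundary of each square around \<open>z0\<close> of
  intermediate size crosses many disjoint rings around \<open>F z0\<close>, and a length-area argument bounds
  the number of rings in terms of \<open>K\<close>.
\<close>

subsection \<open>The three point condition on the integers\<close>

text \<open>Since f need not be monotone, in general no homeomorphism of the real line extends it.
  The planar map avoids this by storing the index: (n, 0) goes to (f n, -n), and the second factor
  uses the inverse of f to erase -n. Both factors are invertible whatever A and B are, so the only
  thing to extract from the three point condition is a bi-Lipschitz bound.

  In the other direction, squares with sides parallel to the axes serve in place of circles because
  Fubini turns their side integrals into area integrals. The count of rings rests on this estimate: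
  if E is the part of a square of size s that is mapped into a ring of radius t, then t s is at most
  a constant times the integral of |DF| over E, hence at most a constant times (|E| K t^2)^(1/2), so
  |E| is at least a constant times s^2 / K. Disjoint rings have disjoint preimages in the square, so
  their number is at most a multiple of K.\<close>

lemma inverse_step_bound:
  fixes a p :: "int \<Rightarrow> int" and l :: int
  assumes ap: "\<And>v. a (p v) = v" and pa: "\<And>n. p (a n) = n" and l: "l \<ge> 1"
    and tp: "\<And>n m k. n < m \<Longrightarrow> m < k \<Longrightarrow> \<bar>a n - a m\<bar> \<le> l * \<bar>a n - a k\<bar>"
  shows "\<bar>p (v + 1) - p v\<bar> \<le> 2 * l"
proof -
  define n k where "n = min (p v) (p (v + 1))" and "k = max (p v) (p (v + 1))"
  have ne: "p v \<noteq> p (v + 1)" using ap by (metis add_cancel_right_right zero_neq_one)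
  have nk: "n < k" "\<bar>a n - a k\<bar> = 1" using ne ap[of v] ap[of "v + 1"]
    unfolding n_def k_def min_def max_def by auto
  \<comment> \<open>Pigeonhole: the \<open>k - n + 1\<close> indices from n to k have distinct
    values, all among the \<open>2 * l + 1\<close> integers within l of \<open>a n\<close>.\<close>
  have "a ` {n..k} \<subseteq> {a n - l .. a n + l}"
  proof
    fix y assume "y \<in> a ` {n..k}"
    then obtain m where m: "y = a m" "n \<le> m" "m \<le> k" by auto
    have "\<bar>a n - a m\<bar> \<le> l"
      using tp[of n m k] nk l m by (cases "m = n \<or> m = k") auto
    then show "y \<in> {a n - l .. a n + l}" using m by auto
  qed
  moreover have "inj_on a {n..k}" by (metis inj_onI pa)
  ultimately have "card {n..k} \<le> card {a n - l .. a n + l}"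
    by (metis card_image card_mono finite_atLeastAtMost_int)
  then have "k - n \<le> 2 * l" using l nk by auto
  then show ?thesis by (simp add: n_def k_def)
qed

lemma lipschitz_of_steps:
  fixes p :: "int \<Rightarrow> int"
  assumes step: "\<And>v. \<bar>p (v + 1) - p v\<bar> \<le> L"
  shows "\<bar>p u - p v\<bar> \<le> L * \<bar>u - v\<bar>"
proof -
  have *: "\<bar>p (v + int j) - p v\<bar> \<le> L * int j" for v j
  proof (induction j)
    case (Suc j)
    then show ?case using step[of "v + int j"] by (simp add: algebra_simps)
  qed simp
  show ?thesis
  proof (cases "v \<le> u")
    case True then show ?thesis using *[of v "nat (u - v)"] by simp
  next
    case False then show ?thesis using *[of u "nat (v - u)"] by (simp add: abs_minus_commute)
  qed
qed

text \<open>If \<open>\<bar>a (n + 1) - a n\<bar>\<close> were large, all indices of values near \<open>a n\<close> would be at most \<open>n\<close>. Both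
  \<open>p (a n - i)\<close> and \<open>p (a n + i)\<close> would then run down from \<open>n\<close> in steps of bounded size, so that an
  index of the second branch lies between two indices of the first branch whose values are close.\<close>

lemma forward_step_bound:
  fixes a p :: "int \<Rightarrow> int" and l :: int
  assumes ap: "\<And>v. a (p v) = v" and pa: "\<And>n. p (a n) = n" and l: "l \<ge> 1"
    and tp: "\<And>n m k. n < m \<Longrightarrow> m < k \<Longrightarrow> \<bar>a n - a m\<bar> \<le> l * \<bar>a n - a k\<bar>"
  defines "L \<equiv> 2 * l"
  defines "s \<equiv> l * (2 * L) + 1"
  defines "r \<equiv> L * (s + 2 * L)"
  shows "\<bar>a (n + 1) - a n\<bar> \<le> l * r"
proof (rule ccontr)
  assume neg: "\<not> \<bar>a (n + 1) - a n\<bar> \<le> l * r"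
  \<comment> \<open>The constants are chosen backwards from the final contradiction. Two indices
    \<open>lo\<close> and \<open>hi\<close> on the lower branch will have values at most
    \<open>2 * L\<close> apart, so an index between them has a value at distance at most
    \<open>l * (2 * L) < s\<close> from \<open>a lo\<close>; values on the upper branch are at
    distance at least s. The radius r is large enough for the Lipschitz bound to keep
    \<open>lo\<close> at or above \<open>n - r\<close>.\<close>
  define v where "v = a n"
  have L: "L \<ge> 2" and s: "s \<ge> 1" using l by (auto simp: L_def s_def)
  have r: "r \<ge> s + 2 * L" using L s unfolding r_def by (auto simp: mult_le_cancel_right1)
  have lip: "\<bar>p x - p y\<bar> \<le> L * \<bar>x - y\<bar>" for x y
    unfolding L_def using inverse_step_bound[OF ap pa l tp] by (intro lipschitz_of_steps) auto
  have inj: "p x = p y \<longleftrightarrow> x = y" for x y by (metis ap)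
  have near: "p u \<le> n" if "\<bar>u - v\<bar> \<le> r" for u
  proof (rule ccontr)
    assume c: "\<not> p u \<le> n"
    have "l * r < l * \<bar>v - u\<bar>"
    proof (cases "p u = n + 1")
      case True
      then have "u = a (n + 1)" using ap by metis
      then have "l * r < \<bar>v - u\<bar>" using neg by (simp add: v_def abs_minus_commute)
      also have "\<dots> \<le> l * \<bar>v - u\<bar>" using l by (simp add: mult_le_cancel_right1)
      finally show ?thesis .
    next
      case False
      then have "\<bar>a n - a (n + 1)\<bar> \<le> l * \<bar>a n - a (p u)\<bar>" using c by (intro tp) auto
      then show ?thesis using neg by (simp add: v_def ap abs_minus_commute)
    qed
    then have "r < \<bar>v - u\<bar>" using l by (simp add: mult_less_cancel_left_pos)
    then show False using that by simp
  qed
  define q where "q = p (v - s)"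
  \<comment> \<open>The \<open>2 * L\<close> values \<open>v - s - t\<close> with t from 0 to
    \<open>2 * L - 1\<close> have distinct indices, too many for the \<open>2 * L - 1\<close>
    integers closer than L to q. The choice t = 0 is impossible because it gives q itself.\<close>
  obtain t where t: "1 \<le> t" "t \<le> 2 * L" "\<bar>p (v - s - t) - q\<bar> \<ge> L"
  proof -
    have "\<not> (\<lambda>t. p (v - s - t)) ` {0..2 * L - 1} \<subseteq> {q - L + 1 .. q + L - 1}"
    proof
      assume "(\<lambda>t. p (v - s - t)) ` {0..2 * L - 1} \<subseteq> {q - L + 1 .. q + L - 1}"
      moreover have "inj_on (\<lambda>t. p (v - s - t)) {0..2 * L - 1}" by (auto simp: inj_on_def inj)
      ultimately have "card {0..2 * L - 1} \<le> card {q - L + 1 .. q + L - 1}"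
        by (metis card_image card_mono finite_atLeastAtMost_int)
      then show False using L by auto
    qed
    then obtain t where "t \<in> {0..2 * L - 1}" "p (v - s - t) \<notin> {q - L + 1 .. q + L - 1}" by blast
    then have "t \<in> {0..2 * L - 1}" "\<not> \<bar>p (v - s - t) - q\<bar> < L" by auto
    moreover from this have "t \<noteq> 0" using L by (auto simp: q_def)
    ultimately show ?thesis using that[of t] by auto
  qed
  define lo hi where "lo = min q (p (v - s - t))" and "hi = max q (p (v - s - t))"
  have lohi: "lo + L \<le> hi" using t(3) by (auto simp: lo_def hi_def)
  have n: "p v = n" by (simp add: v_def pa)
  have hi_n: "hi < n"
  proof -
    have "p (v - s) \<le> n" "p (v - s - t) \<le> n" using near r t s L by auto
    moreover have "p (v - s) \<noteq> n" "p (v - s - t) \<noteq> n"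
      using inj[of "v - s" v] inj[of "v - s - t" v] n s t by auto
    ultimately show ?thesis by (auto simp: hi_def q_def)
  qed
  have lo_r: "n - r \<le> lo"
  proof -
    have "\<bar>p (v - s) - p v\<bar> \<le> L * s" using lip[of "v - s" v] s by simp
    moreover have "\<bar>p (v - s - t) - p v\<bar> \<le> L * (s + t)" using lip[of "v - s - t" v] s t
      by (simp add: abs_if algebra_simps split: if_splits)
    moreover have "L * s \<le> r" "L * (s + t) \<le> r" using s t L unfolding r_def by auto
    ultimately show ?thesis unfolding lo_def q_def n by auto
  qed
  \<comment> \<open>These are \<open>r + 1\<close> distinct indices, none above n, while only r
    integers lie above \<open>n - r\<close> and up to n. So the upper branch reaches
    \<open>lo\<close> or passes below it.\<close>
  have "\<exists>i\<in>{0..r}. p (v + i) \<le> n - r"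
  proof (rule ccontr)
    assume "\<not> ?thesis"
    then have "(\<lambda>i. p (v + i)) ` {0..r} \<subseteq> {n - r + 1 .. n}" using near by force
    moreover have "inj_on (\<lambda>i. p (v + i)) {0..r}" by (auto simp: inj_on_def inj)
    ultimately have "card {0..r} \<le> card {n - r + 1 .. n}"
      by (metis card_image card_mono finite_atLeastAtMost_int)
    then show False using r s L by auto
  qed
  then obtain i0 where i0: "i0 \<ge> 0" "p (v + i0) \<le> n - r" by auto
  define P where "P j \<longleftrightarrow> p (v + int j) < hi" for j
  have "P (nat i0)" using i0 lo_r lohi L by (simp add: P_def)
  \<comment> \<open>At the first j whose index is below \<open>hi\<close>, the step from the
    preceding index is at most L, the guaranteed gap between \<open>lo\<close> and
    \<open>hi\<close>; the branch therefore cannot jump past \<open>lo\<close>.\<close>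
  define j where "j = (LEAST j. P j)"
  have Pj: "P j" unfolding j_def using \<open>P (nat i0)\<close> by (rule LeastI)
  have "j \<noteq> 0" using Pj hi_n n unfolding P_def by (cases "j = 0") auto
  then obtain j' where j': "j = Suc j'" by (cases j) auto
  then have "\<not> P j'" using not_less_Least[of j' P] by (simp add: j_def)
  then have "p (v + int j) \<ge> hi - L"
    using lip[of "v + int j" "v + int j'"] j' by (auto simp: P_def)
  then have "p (v + int j) \<ge> lo" using lohi by simp
  moreover have "p (v + int j) \<noteq> lo" using j' s t inj by (auto simp: lo_def q_def min_def)
  ultimately have "lo < p (v + int j)" by simp
  moreover have "p (v + int j) < hi" using Pj by (simp add: P_def)
  ultimately have "\<bar>a lo - (v + int j)\<bar> \<le> l * \<bar>a lo - a hi\<bar>" using tp[of lo "p (v + int j)" hi] by (simp add: ap)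
  moreover have "a lo \<le> v - s" "\<bar>a lo - a hi\<bar> = t" using t lohi L
    by (auto simp: lo_def hi_def q_def ap min_def max_def)
  ultimately have "s \<le> l * t" by auto
  also have "\<dots> \<le> l * (2 * L)" using l t by auto
  finally show False by (simp add: s_def)
qed

lemma integer_bijection_inverse:
  assumes "f \<in> integer_bijections"
  obtains a p :: "int \<Rightarrow> int"
  where "\<And>n. f (of_int n) = of_int (a n)" "\<And>v. a (p v) = v" "\<And>n. p (a n) = n"
proof -
  have bij: "bij_betw f \<int> \<int>" using assms by (simp add: integer_bijections_def)
  have "\<forall>n. \<exists>m. f (of_int n) = of_int m" using bij_betw_apply[OF bij] by (meson Ints_cases Ints_of_int)
  then obtain a where a: "\<And>n. f (of_int n) = of_int (a n)" by metis
  have "\<exists>n. a n = v" for v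
  proof -
    have "of_int v \<in> f ` \<int>" using bij by (simp add: bij_betw_def)
    then obtain n where "f (of_int n) = of_int v" by (auto elim!: Ints_cases)
    then show ?thesis using a by auto
  qed
  moreover have "inj a"
  proof (rule injI)
    fix x y assume "a x = a y"
    then have "f (of_int x) = f (of_int y)" using a by simp
    then show "x = y" using bij_betw_imp_inj_on[OF bij] by (auto dest: inj_onD)
  qed
  ultimately have "bij a" by (metis bijI surjI)
  then show ?thesis using that[of a "inv a"] a by (metis bij_inv_eq_iff)
qed

lemma three_point_condition_imp_bilipschitz:
  obtains C :: int where "C \<ge> 1"
    "\<And>a p. (\<And>v. a (p v) = v) \<Longrightarrow> (\<And>n. p (a n) = n) \<Longrightarrow>
       three_point_condition lam (\<lambda>n. of_int (a n)) \<Longrightarrow>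
       (\<forall>n m. \<bar>a n - a m\<bar> \<le> C * \<bar>n - m\<bar>) \<and> (\<forall>n m. \<bar>p n - p m\<bar> \<le> C * \<bar>n - m\<bar>)"
proof (cases "lam \<ge> 1")
  case False
  then show ?thesis using that[of 1] by (simp add: three_point_condition_def)
next
  case True
  define l where "l = \<lceil>lam\<rceil>"
  have l: "l \<ge> 1" "lam \<le> of_int l" using True unfolding l_def by linarith+
  \<comment> \<open>The bound \<open>l * r\<close> of \<open>forward_step_bound\<close> with its
    abbreviations expressed through l, so that C is fixed before the sequence.\<close>
  define D where "D = l * (2 * l * (l * (2 * (2 * l)) + 1 + 2 * (2 * l)))"
  define C where "C = max D (2 * l)"
  have "C \<ge> 1" using l by (simp add: C_def)
  moreover have "(\<forall>n m. \<bar>a n - a m\<bar> \<le> C * \<bar>n - m\<bar>) \<and> (\<forall>n m. \<bar>p n - p m\<bar> \<le> C * \<bar>n - m\<bar>)"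
    if ap: "\<And>v. a (p v) = v" and pa: "\<And>n. p (a n) = n"
      and tpc: "three_point_condition lam (\<lambda>n. of_int (a n))" for a p :: "int \<Rightarrow> int"
  proof -
    have tp: "\<bar>a n - a m\<bar> \<le> l * \<bar>a n - a k\<bar>" if "n < m" "m < k" for n m k
    proof -
      have ne: "a n \<noteq> a k" using that pa by (metis less_irrefl less_trans)
      have "norm ((of_int (a n) - of_int (a m)) / (of_int (a n) - of_int (a k)) :: complex) \<le> lam"
        using tpc that by (auto simp: three_point_condition_def)
      then have "real_of_int \<bar>a n - a m\<bar> / real_of_int \<bar>a n - a k\<bar> \<le> lam"
        by (simp only: norm_divide of_int_diff[symmetric] norm_of_int)
      then have "real_of_int \<bar>a n - a m\<bar> \<le> lam * real_of_int \<bar>a n - a k\<bar>"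
        using ne by (simp add: divide_le_eq)
      also have "\<dots> \<le> of_int l * real_of_int \<bar>a n - a k\<bar>" by (intro mult_right_mono l) auto
      finally show ?thesis by (metis of_int_le_iff of_int_mult)
    qed
    have "\<bar>p (v + 1) - p v\<bar> \<le> C" for v
      using inverse_step_bound[OF ap pa l(1) tp, of v] by (simp add: C_def)
    moreover have "\<bar>a (v + 1) - a v\<bar> \<le> C" for v
      using forward_step_bound[OF ap pa l(1) tp, of v] by (simp add: C_def D_def)
    ultimately show ?thesis by (blast intro: lipschitz_of_steps)
  qed
  ultimately show ?thesis using that by blast
qed

section \<open>Quasisymmetry and the three point condition\<close>

lemma quasisymmetric_implies_three_point:
  "quantitatively_implies integer_bijections
     (\<lambda>\<eta> f. quasisymmetric_on \<eta> \<int> f)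
     (\<lambda>lam f. three_point_condition lam (\<lambda>n. f (of_int n)))"
  unfolding quantitatively_implies_def
proof
  fix \<eta> :: "real \<Rightarrow> real"
  show "\<exists>lam. \<forall>f\<in>integer_bijections. quasisymmetric_on \<eta> \<int> f \<longrightarrow> three_point_condition lam (\<lambda>n. f (of_int n))"
  proof (cases "\<exists>\<theta>. homeomorphism {0..} {0..} \<eta> \<theta>")
    case False
    then show ?thesis by (simp add: quasisymmetric_on_def)
  next
    case True
    \<comment> \<open>For n < m < k the ratio of |n - m| to |n - k| lies in the unit interval, so a
      bound for \<open>\<eta>\<close> on this compact interval serves as the constant.\<close>
    then have "continuous_on {0..1} \<eta>"
      by (auto simp: homeomorphism_def intro: continuous_on_subset)
    then have "bounded (\<eta> ` {0..1})" by (simp add: compact_continuous_image compact_imp_bounded)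
    then obtain B where B: "\<And>t. t \<in> {0..1} \<Longrightarrow> \<eta> t \<le> B"
      by (auto simp: bounded_iff) (metis abs_le_D1 atLeastAtMost_iff)
    have "three_point_condition (max 1 B) (\<lambda>n. f (of_int n))" if "quasisymmetric_on \<eta> \<int> f" for f
      unfolding three_point_condition_def
    proof (intro conjI allI impI)
      fix n m k :: int assume nmk: "n < m \<and> m < k"
      define t where "t = norm ((of_int n - of_int m) / (of_int n - of_int k) :: complex)"
      have "t = real_of_int \<bar>n - m\<bar> / real_of_int \<bar>n - k\<bar>" unfolding t_def
        by (simp only: norm_divide of_int_diff[symmetric] norm_of_int) simp
      then have "t \<in> {0..1}" using nmk by (auto simp: divide_le_eq)
      moreover have "norm ((f (of_int n) - f (of_int m)) / (f (of_int n) - f (of_int k))) \<le> \<eta> t"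
        using that nmk unfolding quasisymmetric_on_def t_def by auto
      ultimately show "norm ((f (of_int n) - f (of_int m)) / (f (of_int n) - f (of_int k))) \<le> max 1 B"
        using B by force
    qed simp
    then show ?thesis by blast
  qed
qed

lemma three_point_implies_quasisymmetric:
  "quantitatively_implies integer_bijections
     (\<lambda>lam f. three_point_condition lam (\<lambda>n. f (of_int n)))
     (\<lambda>\<eta> f. quasisymmetric_on \<eta> \<int> f)"
  unfolding quantitatively_implies_def
proof
  fix lam
  obtain C :: int where C: "C \<ge> 1"
    "\<And>a p. (\<And>v. a (p v) = v) \<Longrightarrow> (\<And>n. p (a n) = n) \<Longrightarrow>
       three_point_condition lam (\<lambda>n. of_int (a n)) \<Longrightarrow>
       (\<forall>n m. \<bar>a n - a m\<bar> \<le> C * \<bar>n - m\<bar>) \<and> (\<forall>n m. \<bar>p n - p m\<bar> \<le> C * \<bar>n - m\<bar>)"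
    using three_point_condition_imp_bilipschitz[of lam] by blast
  \<comment> \<open>One factor C bounds the numerator from above; the other, from the Lipschitz
    bound for the inverse, bounds the denominator from below.\<close>
  define \<eta> where "\<eta> t = real_of_int C * real_of_int C * t" for t
  have "homeomorphism {0..} {0..} \<eta> (\<lambda>t. t / (real_of_int C * real_of_int C))"
    using C(1) by (intro homeomorphismI) (auto intro!: continuous_intros simp: \<eta>_def)
  moreover have "norm ((f x - f y) / (f x - f z)) \<le> \<eta> (norm ((x - y) / (x - z)))"
    if f: "f \<in> integer_bijections" "three_point_condition lam (\<lambda>n. f (of_int n))"
      and xyz: "x \<in> \<int>" "y \<in> \<int>" "z \<in> \<int>" "x \<noteq> z" for f x y z
  proof -
    obtain a p where a: "\<And>n. f (of_int n) = of_int (a n)" and ap: "\<And>v. a (p v) = v" and pa: "\<And>n. p (a n) = n"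
      using integer_bijection_inverse[OF f(1)] by metis
    have lip: "(\<forall>n m. \<bar>a n - a m\<bar> \<le> C * \<bar>n - m\<bar>) \<and> (\<forall>n m. \<bar>p n - p m\<bar> \<le> C * \<bar>n - m\<bar>)"
      using f(2) by (intro C(2) ap pa) (simp add: a)
    obtain n m k where nmk: "x = of_int n" "y = of_int m" "z = of_int k" "n \<noteq> k"
      using xyz by (metis Ints_cases)
    have ne: "a n \<noteq> a k" using nmk pa by metis
    have 1: "real_of_int \<bar>a n - a m\<bar> \<le> C * real_of_int \<bar>n - m\<bar>"
      using lip by (metis of_int_le_iff of_int_mult)
    have 2: "real_of_int \<bar>n - k\<bar> \<le> C * real_of_int \<bar>a n - a k\<bar>"
      using lip pa by (metis of_int_le_iff of_int_mult)
    have "norm ((f x - f y) / (f x - f z)) = real_of_int \<bar>a n - a m\<bar> / real_of_int \<bar>a n - a k\<bar>"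
      unfolding nmk a
      by (simp only: norm_divide of_int_diff[symmetric] norm_of_int) simp
    also have "\<dots> \<le> (C * real_of_int \<bar>n - m\<bar>) / (real_of_int \<bar>n - k\<bar> / C)"
      using 1 2 ne nmk C(1) by (intro frac_le) (auto simp: divide_le_eq mult.commute)
    also have "\<dots> = \<eta> (real_of_int \<bar>n - m\<bar> / real_of_int \<bar>n - k\<bar>)"
      by (simp add: \<eta>_def)
    also have "real_of_int \<bar>n - m\<bar> / real_of_int \<bar>n - k\<bar> = norm ((x - y) / (x - z))"
      unfolding nmk
      by (simp only: norm_divide of_int_diff[symmetric] norm_of_int) simp
    finally show ?thesis .
  qed
  moreover have "inj_on f \<int>" if "f \<in> integer_bijections" for f
    using that by (auto simp: integer_bijections_def bij_betw_def)
  ultimately show "\<exists>\<eta>. \<forall>f\<in>integer_bijections. three_point_condition lam (\<lambda>n. f (of_int n)) \<longrightarrow> quasisymmetric_on \<eta> \<int> f"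
    unfolding quasisymmetric_on_def by blast
qed

subsection \<open>Classical derivatives are distributional derivatives\<close>

lemma continuous_compact_support_integrable:
  fixes f :: "complex \<Rightarrow> complex"
  assumes "continuous_on UNIV f" "\<And>z. z \<notin> K \<Longrightarrow> f z = 0" "compact K"
  shows "integrable lborel f"
proof -
  have "integrable lborel (\<lambda>x. indicator K x *\<^sub>R f x)"
    by (rule borel_integrable_compact[OF assms(3)]) (meson assms(1) continuous_on_subset subset_UNIV)
  moreover have "(\<lambda>x. indicator K x *\<^sub>R f x) = f" using assms(2) by (auto simp: indicator_def)
  ultimately show ?thesis by simp
qed

lemma lborel_integral_eq_integral_cbox:
  fixes f :: "complex \<Rightarrow> complex"
  assumes "continuous_on UNIV f" "\<And>z. z \<notin> cbox l u \<Longrightarrow> f z = 0"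
  shows "(\<integral>z. f z \<partial>lborel) = integral (cbox l u) f"
proof -
  have "integrable lborel f"
    by (rule continuous_compact_support_integrable[where K = "cbox l u"]) (use assms in auto)
  then have "(\<integral>z. f z \<partial>lborel) = integral UNIV f"
    using has_integral_integral_lborel by (metis integral_unique)
  also have "\<dots> = integral UNIV (\<lambda>z. if z \<in> cbox l u then f z else 0)"
    using assms(2) by (intro integral_cong) auto
  also have "\<dots> = integral (cbox l u) f" by (rule integral_restrict_UNIV)
  finally show ?thesis .
qed

lemma lborel_integral_shift:
  fixes f :: "complex \<Rightarrow> complex"
  assumes [measurable]: "f \<in> borel_measurable borel"
  shows "(\<integral>z. f (w + z) \<partial>lborel) = (\<integral>z. f z \<partial>lborel)"
proof -
  have "(\<integral>z. f z \<partial>lborel) = (\<integral>z. f z \<partial>(distr lborel borel (\<lambda>z. w + z)))"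
    using lborel_affine[of 1 w] by (simp add: density_1)
  also have "\<dots> = (\<integral>z. f (w + z) \<partial>lborel)"
    by (rule integral_distr) measurable
  finally show ?thesis by simp
qed

text \<open>By translation invariance the integral of \<open>\<psi> (z + t v)\<close> does not depend on \<open>t\<close>.\<close>

lemma integral_directional_derivative_eq_0:
  fixes \<psi> :: "complex \<Rightarrow> complex"
  assumes D: "\<And>z. (\<psi> has_derivative D z) (at z)"
    and cont: "continuous_on UNIV (\<lambda>z. D z v)"
    and supp: "\<And>z. z \<notin> K \<Longrightarrow> \<psi> z = 0" "compact K"
  shows "(\<integral>z. D z v \<partial>lborel) = 0"
proof -
  have c\<psi>: "continuous_on UNIV \<psi>" using D by (meson differentiableI differentiable_imp_continuous_on differentiable_on_def differentiable_at_withinI)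
  \<comment> \<open>The translates of K swept out for t in [-1, 1]. One box containing them all
    serves for every t, so the integral can be differentiated in t over a fixed domain.\<close>
  define K' where "K' = (\<lambda>(t, z). z - of_real t * v) ` ({-1..1} \<times> K)"
  have "compact K'" unfolding K'_def split_beta using supp(2)
    by (intro compact_continuous_image compact_Times continuous_intros) auto
  then obtain l u where lu: "K' \<subseteq> cbox l u" using bounded_subset_cbox_symmetric compact_imp_bounded by metis
  have out: "\<psi> (z + of_real t * v) = 0" if "t \<in> {-1..1}" "z \<notin> cbox l u" for t z
  proof (rule supp(1))
    show "z + of_real t * v \<notin> K"
    proof
      assume "z + of_real t * v \<in> K"
      then have "z \<in> K'" unfolding K'_def using that by (force intro!: image_eqI[of _ _ "(t, z + of_real t * v)"])
      then show False using lu that by blast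
    qed
  qed
  have sub: "integral (cbox l u) (\<lambda>z. \<psi> (z + of_real t * v)) = (\<integral>z. \<psi> z \<partial>lborel)" if "t \<in> {-1..1}" for t
  proof -
    have "continuous_on UNIV (\<lambda>z. \<psi> (z + of_real t * v))"
      by (intro continuous_intros continuous_on_compose2[OF c\<psi>]) auto
    then have "integral (cbox l u) (\<lambda>z. \<psi> (z + of_real t * v)) = (\<integral>z. \<psi> (z + of_real t * v) \<partial>lborel)"
      using lborel_integral_eq_integral_cbox[OF _ out[OF that]] by simp
    also have "\<dots> = (\<integral>z. \<psi> z \<partial>lborel)"
      using lborel_integral_shift[of \<psi> "of_real t * v"] c\<psi> by (simp add: borel_measurable_continuous_onI add.commute)
    finally show ?thesis .
  qed
  have "((\<lambda>t. integral (cbox l u) (\<lambda>z. \<psi> (z + of_real t * v))) has_vector_derivative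
      integral (cbox l u) (\<lambda>z. D (z + of_real 0 * v) v)) (at 0 within {-1..1})"
  proof (rule leibniz_rule_vector_derivative)
    show "((\<lambda>t. \<psi> (z + of_real t * v)) has_vector_derivative D (z + of_real t * v) v) (at t within {-1..1})" for t z
    proof -
      have "((\<lambda>t. z + of_real t * v) has_derivative (\<lambda>h. of_real h * v)) (at t within {-1..1})"
        by (auto intro!: derivative_eq_intros)
      from has_derivative_compose[OF this D]
      have "((\<lambda>t. \<psi> (z + of_real t * v)) has_derivative (\<lambda>h. D (z + of_real t * v) (of_real h * v))) (at t within {-1..1})" .
      moreover have "D (z + of_real t * v) (of_real h * v) = h *\<^sub>R D (z + of_real t * v) v" for h
        using linear_scale[OF has_derivative_linear[OF D]] by (simp add: scaleR_conv_of_real)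
      ultimately show ?thesis by (simp add: has_vector_derivative_def)
    qed
    show "(\<lambda>z. \<psi> (z + of_real t * v)) integrable_on cbox l u" for t
      by (intro integrable_continuous continuous_intros continuous_on_compose2[OF c\<psi>]) auto
    show "continuous_on ({-1..1} \<times> cbox l u) (\<lambda>(t, z). D (z + of_real t * v) v)"
      unfolding split_beta by (intro continuous_intros continuous_on_compose2[OF cont]) auto
  qed auto
  then have "((\<lambda>t. integral (cbox l u) (\<lambda>z. \<psi> (z + of_real t * v))) has_vector_derivative
      integral (cbox l u) (\<lambda>z. D z v)) (at 0 within {-1..1})"
    by simp
  then have "((\<lambda>t. \<integral>z. \<psi> z \<partial>lborel) has_vector_derivative integral (cbox l u) (\<lambda>z. D z v)) (at (0::real) within {-1..1})"
    by (rule has_vector_derivative_transform[rotated 2]) (simp_all add: sub)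
  then have "((\<lambda>t. \<integral>z. \<psi> z \<partial>lborel) has_vector_derivative integral (cbox l u) (\<lambda>z. D z v)) (at (0::real))"
    by (simp add: at_within_Icc_at)
  then have zero: "integral (cbox l u) (\<lambda>z. D z v) = 0"
    using vector_derivative_unique_at[OF _ has_vector_derivative_const] by blast
  have out': "D z v = 0" if "z \<notin> cbox l u" for z
  proof -
    have "(\<psi> has_derivative (\<lambda>h. 0)) (at z)"
    proof (rule has_derivative_transform_within_open[OF has_derivative_const])
      show "open (- cbox l u)" by (simp add: open_Compl closed_cbox)
      show "0 = \<psi> x" if "x \<in> - cbox l u" for x using out[of 0 x] that by simp
    qed (use that in auto)
    then show ?thesis using has_derivative_unique[OF D] by metis
  qed
  show ?thesis using lborel_integral_eq_integral_cbox[OF cont out'] zero by simp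
qed

lemma test_functionD:
  assumes "test_function \<Omega> \<phi>"
  shows "(\<phi> has_derivative frechet_derivative \<phi> (at z)) (at z)"
    and "continuous_on UNIV (\<lambda>z. frechet_derivative \<phi> (at z) v)"
    and "continuous_on UNIV \<phi>"
    and "compact (closure {z. \<phi> z \<noteq> 0})"
    and "z \<notin> closure {z. \<phi> z \<noteq> 0} \<Longrightarrow> \<phi> z = 0"
    and "z \<notin> closure {z. \<phi> z \<noteq> 0} \<Longrightarrow> frechet_derivative \<phi> (at z) = (\<lambda>h. 0)"
proof -
  have "times_differentiable (Suc 0) \<phi>" "times_differentiable 0 \<phi>" using assms unfolding test_function_def by blast+
  then have d: "(\<phi> has_derivative frechet_derivative \<phi> (at z)) (at z)"
    and c: "continuous_on UNIV (\<lambda>z. frechet_derivative \<phi> (at z) v)" "continuous_on UNIV \<phi>" for z v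
    by (auto simp: frechet_derivative_works)
  show "(\<phi> has_derivative frechet_derivative \<phi> (at z)) (at z)" by (rule d)
  show "continuous_on UNIV (\<lambda>z. frechet_derivative \<phi> (at z) v)" "continuous_on UNIV \<phi>" by (rule c)+
  show "compact (closure {z. \<phi> z \<noteq> 0})" using assms by (simp add: test_function_def)
  have *: "z \<notin> closure {z. \<phi> z \<noteq> 0} \<Longrightarrow> \<phi> z = 0" for z using closure_subset[of "{z. \<phi> z \<noteq> 0}"] by blast
  then show "z \<notin> closure {z. \<phi> z \<noteq> 0} \<Longrightarrow> \<phi> z = 0" .
  assume z: "z \<notin> closure {z. \<phi> z \<noteq> 0}"
  have "(\<phi> has_derivative (\<lambda>h. 0)) (at z)"
  proof (rule has_derivative_transform_within_open[OF has_derivative_const])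
    show "open (- closure {z. \<phi> z \<noteq> 0})" by (simp add: open_Compl)
    show "0 = \<phi> x" if "x \<in> - closure {z. \<phi> z \<noteq> 0}" for x using *[OF ComplD[OF that], symmetric] .
  qed (use z in blast)
  then show "frechet_derivative \<phi> (at z) = (\<lambda>h. 0)" using has_derivative_unique[OF d] by metis
qed

text \<open>The product of F and \<open>\<phi>\<close> has compact support, so the integral of its
  directional derivative vanishes; the product rule splits that integral into the two sides.\<close>

lemma integral_by_parts_test_function:
  fixes F :: "complex \<Rightarrow> complex"
  assumes D: "\<And>z. (F has_derivative D z) (at z)"
    and cont: "continuous_on UNIV (\<lambda>z. D z v)" and \<phi>: "test_function \<Omega> \<phi>"
  shows "(\<integral>z. F z * frechet_derivative \<phi> (at z) v \<partial>lborel) = - (\<integral>z. D z v * \<phi> z \<partial>lborel)"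
    and "integrable lborel (\<lambda>z. F z * frechet_derivative \<phi> (at z) v)"
    and "integrable lborel (\<lambda>z. D z v * \<phi> z)"
proof -
  define K where "K = closure {z. \<phi> z \<noteq> 0}"
  note t = test_functionD[OF \<phi>, folded K_def]
  have cF: "continuous_on UNIV F" using D by (meson differentiableI differentiable_imp_continuous_on differentiable_on_def differentiable_at_withinI)
  have "((\<lambda>z. F z * \<phi> z) has_derivative (\<lambda>h. F z * frechet_derivative \<phi> (at z) h + D z h * \<phi> z)) (at z)" for z
    by (rule has_derivative_mult[OF D t(1)])
  note d = this
  have c1: "continuous_on UNIV (\<lambda>z. F z * frechet_derivative \<phi> (at z) v)"
    by (intro continuous_on_mult cF t(2))
  have c2: "continuous_on UNIV (\<lambda>z. D z v * \<phi> z)"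
    by (intro continuous_on_mult cont t(3))
  have "(\<integral>z. F z * frechet_derivative \<phi> (at z) v + D z v * \<phi> z \<partial>lborel) = 0"
    by (rule integral_directional_derivative_eq_0[where \<psi> = "\<lambda>z. F z * \<phi> z" and v = v
          and D = "\<lambda>z h. F z * frechet_derivative \<phi> (at z) h + D z h * \<phi> z",
          OF d continuous_on_add[OF c1 c2] _ t(4)]) (simp add: t(5))
  moreover show i1: "integrable lborel (\<lambda>z. F z * frechet_derivative \<phi> (at z) v)"
    by (rule continuous_compact_support_integrable[OF c1 _ t(4)]) (simp add: t(6))
  moreover show i2: "integrable lborel (\<lambda>z. D z v * \<phi> z)"
    by (rule continuous_compact_support_integrable[OF c2 _ t(4)]) (simp add: t(5))
  ultimately show "(\<integral>z. F z * frechet_derivative \<phi> (at z) v \<partial>lborel) = - (\<integral>z. D z v * \<phi> z \<partial>lborel)"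
    by (simp add: add_eq_0_iff2)
qed

lemma locally_integrable_continuous:
  assumes "continuous_on UNIV g"
  shows "locally_integrable_on \<Omega> g"
  unfolding locally_integrable_on_def set_integrable_def
proof (intro allI impI)
  fix K assume "compact K \<and> K \<subseteq> \<Omega>"
  then have "integrable lborel (\<lambda>x. indicator K x *\<^sub>R g x)"
    by (intro borel_integrable_compact) (meson assms continuous_on_subset subset_UNIV)+
  then show "integrable lebesgue (\<lambda>x. indicator K x *\<^sub>R g x)" by (subst integrable_completion) (simp_all only: borel_measurable_integrable)
qed

lemma distributional_derivative_classical:
  fixes F :: "complex \<Rightarrow> complex"
  assumes D: "\<And>z. (F has_derivative D z) (at z)"
    and cont: "\<And>v. continuous_on UNIV (\<lambda>z. D z v)"
  shows "distributional_derivative wirtinger UNIV F (\<lambda>z. (D z 1 - \<i> * D z \<i>) / 2)"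
    and "distributional_derivative wirtinger_bar UNIV F (\<lambda>z. (D z 1 + \<i> * D z \<i>) / 2)"
proof -
  have leb: "(LINT z:UNIV|lebesgue. h z) = (\<integral>z. h z \<partial>lborel)" if "integrable lborel h" for h :: "complex \<Rightarrow> complex"
    unfolding set_lebesgue_integral_def using that by (simp add: integral_completion)
  \<comment> \<open>The two Wirtinger operators differ only in the sign c = -\<i> or c = \<i>, so
    one computation with general c covers both.\<close>
  have "(LINT z:UNIV|lebesgue. F z * ((frechet_derivative \<phi> (at z) 1 + c * frechet_derivative \<phi> (at z) \<i>) / 2))
      = - (LINT z:UNIV|lebesgue. ((D z 1 + c * D z \<i>) / 2) * \<phi> z)" if \<phi>: "test_function UNIV \<phi>" for \<phi> c
  proof -
    note i = integral_by_parts_test_function[OF D cont \<phi>]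
    have e: "F z * ((frechet_derivative \<phi> (at z) 1 + c * frechet_derivative \<phi> (at z) \<i>) / 2)
        = (F z * frechet_derivative \<phi> (at z) 1 + c * (F z * frechet_derivative \<phi> (at z) \<i>)) / 2"
      "((D z 1 + c * D z \<i>) / 2) * \<phi> z = (D z 1 * \<phi> z + c * (D z \<i> * \<phi> z)) / 2" for z
      by (simp_all add: algebra_simps)
    show ?thesis unfolding e using i by (subst (1 2) leb) (simp_all add: algebra_simps)
  qed
  from this[of _ "- \<i>"] this[of _ \<i>]
  show "distributional_derivative wirtinger UNIV F (\<lambda>z. (D z 1 - \<i> * D z \<i>) / 2)"
    and "distributional_derivative wirtinger_bar UNIV F (\<lambda>z. (D z 1 + \<i> * D z \<i>) / 2)"
    unfolding distributional_derivative_def wirtinger_def wirtinger_bar_def by simp_all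
qed

lemma esssup_dilatation_le:
  assumes "continuous_on UNIV p" "continuous_on UNIV q"
    and lt: "\<And>z. norm (q z) < norm (p z)"
    and K: "\<And>z. (norm (p z) + norm (q z)) / (norm (p z) - norm (q z)) \<le> K"
  shows "esssup (lebesgue_on UNIV) (\<lambda>z. dilatation (p z) (q z)) \<le> ereal K"
proof -
  have ne: "p z \<noteq> 0" "norm (p z) - norm (q z) \<noteq> 0" for z using lt[of z] by auto
  have e: "dilatation (p z) (q z) = ereal ((norm (p z) + norm (q z)) / (norm (p z) - norm (q z)))" for z
    using lt[of z] ne(1)[of z] by (simp add: dilatation_def)
  have "continuous_on UNIV (\<lambda>z. (norm (p z) + norm (q z)) / (norm (p z) - norm (q z)))"
    by (intro continuous_on_divide continuous_on_add continuous_on_diff continuous_on_norm assms ballI ne)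
  then have m: "(\<lambda>z. (norm (p z) + norm (q z)) / (norm (p z) - norm (q z))) \<in> borel_measurable lebesgue"
    by (intro measurable_completion) (simp add: borel_measurable_continuous_onI)
  show ?thesis unfolding e
  proof (rule esssup_I)
    show "(\<lambda>z. ereal ((norm (p z) + norm (q z)) / (norm (p z) - norm (q z)))) \<in> borel_measurable (lebesgue_on UNIV)"
      using m by (simp add: lebesgue_on_UNIV_eq borel_measurable_ereal)
    show "AE z in lebesgue_on UNIV. ereal ((norm (p z) + norm (q z)) / (norm (p z) - norm (q z))) \<le> ereal K"
      by (rule AE_I2) (simp only: ereal_less_eq K)
  qed
qed

subsection \<open>Quasiconformal extension\<close>

text \<open>The cubic \<open>3 * x^2 - 2 * x^3\<close> rises from 0 to 1 on the unit interval with
  slope zero at both ends. Hence the pieces between consecutive integers fit together continuously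
  differentiably, whatever the sequence.\<close>

definition smoothstep :: "(int \<Rightarrow> int) \<Rightarrow> real \<Rightarrow> real" where
  "smoothstep a x =
     of_int (a \<lfloor>x\<rfloor>) + of_int (a (\<lfloor>x\<rfloor> + 1) - a \<lfloor>x\<rfloor>) * (3 * (frac x)^2 - 2 * (frac x)^3)"

definition smoothstep' :: "(int \<Rightarrow> int) \<Rightarrow> real \<Rightarrow> real" where
  "smoothstep' a x = of_int (a (\<lfloor>x\<rfloor> + 1) - a \<lfloor>x\<rfloor>) * (6 * frac x - 6 * (frac x)^2)"

lemma smoothstep_of_int [simp]: "smoothstep a (of_int n) = of_int (a n)"
  by (simp add: smoothstep_def)

text \<open>At the right end \<open>n + 1\<close> the floor has already moved on, yet the polynomial
  of the interval starting at n gives the same value and slope there. This makes both one-sided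
  derivatives at an integer accessible.\<close>

lemma smoothstep_eq:
  assumes "of_int n \<le> x" "x \<le> of_int n + 1"
  shows "smoothstep a x = of_int (a n) + of_int (a (n + 1) - a n) * (3 * (x - of_int n)^2 - 2 * (x - of_int n)^3) \<and>
    smoothstep' a x = of_int (a (n + 1) - a n) * (6 * (x - of_int n) - 6 * (x - of_int n)^2)"
proof -
  consider "x = of_int n + 1" | "\<lfloor>x\<rfloor> = n" using assms by (metis floor_unique le_less)
  then show ?thesis
  proof cases
    case 1
    then have "\<lfloor>x\<rfloor> = n + 1" "frac x = 0" by (simp_all add: frac_def)
    then show ?thesis using 1 by (simp add: smoothstep_def smoothstep'_def)
  qed (simp add: smoothstep_def smoothstep'_def frac_def)
qed

lemma smoothstep_deriv_within:
  assumes "x \<in> {of_int n .. of_int n + 1}"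
  shows "(smoothstep a has_real_derivative smoothstep' a x) (at x within {of_int n .. of_int n + 1})"
proof (rule has_field_derivative_transform_within[OF _ zero_less_one assms])
  show "((\<lambda>x. of_int (a n) + of_int (a (n + 1) - a n) * (3 * (x - of_int n)^2 - 2 * (x - of_int n)^3))
        has_real_derivative smoothstep' a x) (at x within {of_int n .. of_int n + 1})"
    using assms by (auto intro!: derivative_eq_intros simp: smoothstep_eq algebra_simps power2_eq_square)
qed (auto simp: smoothstep_eq)

lemma smoothstep'_cont_within:
  "continuous_on {of_int n .. of_int n + 1} (smoothstep' a)"
proof (subst continuous_on_cong[OF refl])
  show "\<And>x. x \<in> {of_int n .. of_int n + 1} \<Longrightarrow> smoothstep' a x = of_int (a (n + 1) - a n) * (6 * (x - of_int n) - 6 * (x - of_int n)^2)"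
    using smoothstep_eq by auto
  show "continuous_on {of_int n .. of_int n + 1}
     (\<lambda>x::real. of_int (a (n + 1) - a n) * (6 * (x - of_int n) - 6 * (x - of_int n)^2))"
    by (intro continuous_intros)
qed

text \<open>For non-integral x the two intervals coincide; for integral x they meet at x. Either way
  one-sided statements can be glued without a case distinction.\<close>

lemma nbhd_unit_intervals:
  fixes x :: real
  defines "S \<equiv> {of_int (\<lceil>x\<rceil> - 1) .. of_int (\<lceil>x\<rceil> - 1) + 1} \<union> {of_int \<lfloor>x\<rfloor> .. of_int \<lfloor>x\<rfloor> + 1}"
  shows "x \<in> interior S" "x \<in> {of_int (\<lceil>x\<rceil> - 1) .. of_int (\<lceil>x\<rceil> - 1) + 1}" "x \<in> {of_int \<lfloor>x\<rfloor> .. of_int \<lfloor>x\<rfloor> + 1}"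
proof -
  have "real_of_int \<lceil>x\<rceil> - 1 < x" "x \<le> \<lceil>x\<rceil>" "\<lfloor>x\<rfloor> \<le> x" "x < real_of_int \<lfloor>x\<rfloor> + 1" by linarith+
  moreover have "real_of_int \<lfloor>x\<rfloor> \<le> \<lceil>x\<rceil>" by linarith
  moreover have "{real_of_int \<lceil>x\<rceil> - 1 <..< of_int \<lfloor>x\<rfloor> + 1} \<subseteq> S"
  proof
    fix y assume "y \<in> {real_of_int \<lceil>x\<rceil> - 1 <..< of_int \<lfloor>x\<rfloor> + 1}"
    then show "y \<in> S" unfolding S_def Un_iff atLeastAtMost_iff greaterThanLessThan_iff of_int_diff of_int_1
      using \<open>real_of_int \<lfloor>x\<rfloor> \<le> \<lceil>x\<rceil>\<close> by linarith
  qed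
  ultimately show "x \<in> interior S" "x \<in> {of_int (\<lceil>x\<rceil> - 1) .. of_int (\<lceil>x\<rceil> - 1) + 1}" "x \<in> {of_int \<lfloor>x\<rfloor> .. of_int \<lfloor>x\<rfloor> + 1}"
    by (auto intro!: interiorI[OF open_greaterThanLessThan])
qed

lemma smoothstep_deriv: "(smoothstep a has_real_derivative smoothstep' a x) (at x)"
proof -
  have "(smoothstep a has_real_derivative smoothstep' a x)
      (at x within {of_int (\<lceil>x\<rceil> - 1) .. of_int (\<lceil>x\<rceil> - 1) + 1} \<union> {of_int \<lfloor>x\<rfloor> .. of_int \<lfloor>x\<rfloor> + 1})"
    using smoothstep_deriv_within[of x "\<lceil>x\<rceil> - 1" a] smoothstep_deriv_within[of x "\<lfloor>x\<rfloor>" a] nbhd_unit_intervals[of x]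
    unfolding has_field_derivative_iff by (auto intro: Lim_Un)
  then show ?thesis using nbhd_unit_intervals(1)[of x] by (simp only: at_within_interior)
qed

lemma smoothstep'_cont: "continuous_on UNIV (smoothstep' a)"
  unfolding continuous_on_eq_continuous_at[OF open_UNIV]
proof
  fix x :: real
  have "continuous (at x within {of_int (\<lceil>x\<rceil> - 1) .. of_int (\<lceil>x\<rceil> - 1) + 1} \<union> {of_int \<lfloor>x\<rfloor> .. of_int \<lfloor>x\<rfloor> + 1}) (smoothstep' a)"
    using smoothstep'_cont_within[of "\<lceil>x\<rceil> - 1" a] smoothstep'_cont_within[of "\<lfloor>x\<rfloor>" a] nbhd_unit_intervals[of x]
    unfolding continuous_on_def continuous_within by (auto intro: Lim_Un)
  then show "isCont (smoothstep' a) x" using nbhd_unit_intervals(1)[of x] by (simp only: at_within_interior)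
qed

lemma smoothstep'_bound:
  assumes "\<And>n m. \<bar>a n - a m\<bar> \<le> C * \<bar>n - m\<bar>"
  shows "\<bar>smoothstep' a x\<bar> \<le> 6 * of_int C"
proof -
  have "\<bar>a (\<lfloor>x\<rfloor> + 1) - a \<lfloor>x\<rfloor>\<bar> \<le> C" using assms[of "\<lfloor>x\<rfloor> + 1" "\<lfloor>x\<rfloor>"] by simp
  then have 1: "real_of_int \<bar>a (\<lfloor>x\<rfloor> + 1) - a \<lfloor>x\<rfloor>\<bar> \<le> of_int C" by (simp only: of_int_le_iff)
  have f: "0 \<le> frac x" "frac x \<le> 1" by (simp_all add: frac_lt_1 less_imp_le)
  have e: "6 * frac x - 6 * (frac x)^2 = 6 * (frac x * (1 - frac x))" by (simp add: algebra_simps power2_eq_square)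
  have "frac x * (1 - frac x) \<le> 1 * 1" by (rule mult_mono) (use f in auto)
  then have 2: "\<bar>6 * frac x - 6 * (frac x)^2\<bar> \<le> 6" unfolding e using f by (simp add: abs_mult)
  have "\<bar>smoothstep' a x\<bar> = real_of_int \<bar>a (\<lfloor>x\<rfloor> + 1) - a \<lfloor>x\<rfloor>\<bar> * \<bar>6 * frac x - 6 * (frac x)^2\<bar>"
    unfolding smoothstep'_def by (simp add: abs_mult)
  also have "\<dots> \<le> of_int C * 6"
    by (rule mult_mono[OF 1 2]) (use order_trans[OF abs_ge_zero 1[unfolded of_int_abs]] in simp_all)
  finally show ?thesis by simp
qed

text \<open>A composition of two Henon-type maps \<open>(x, y) \<mapsto> (y + A x, - x)\<close> and \<open>(X, Y) \<mapsto> (X, Y + B X)\<close>. If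
  \<open>A\<close> interpolates \<open>f\<close> and \<open>B\<close> interpolates its inverse then \<open>(n, 0) \<mapsto> (f n, -n) \<mapsto> (f n, 0)\<close>.\<close>

definition henon :: "(real \<Rightarrow> real) \<Rightarrow> (real \<Rightarrow> real) \<Rightarrow> complex \<Rightarrow> complex" where
  "henon A B z = Complex (Im z + A (Re z)) (B (Im z + A (Re z)) - Re z)"

definition henon_inv :: "(real \<Rightarrow> real) \<Rightarrow> (real \<Rightarrow> real) \<Rightarrow> complex \<Rightarrow> complex" where
  "henon_inv A B w = Complex (B (Re w) - Im w) (Re w - A (B (Re w) - Im w))"

lemma henon_inv: "henon_inv A B (henon A B z) = z" "henon A B (henon_inv A B z) = z"
  by (simp_all add: henon_def henon_inv_def complex_eq_iff)

lemma inj_henon: "henon A B z = henon A B w \<longleftrightarrow> z = w"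
  by (metis henon_inv(1))

lemma henon_embedding:
  assumes A: "continuous_on UNIV A" and B: "continuous_on UNIV B"
  shows "homeomorphic_embedding UNIV (henon A B)"
proof -
  have "continuous_on UNIV (henon A B)" unfolding henon_def
    by (intro continuous_intros continuous_on_compose2[OF A] continuous_on_compose2[OF B]) auto
  moreover have "continuous_on UNIV (henon_inv A B)" unfolding henon_inv_def
    by (intro continuous_intros continuous_on_compose2[OF A] continuous_on_compose2[OF B]) auto
  ultimately show ?thesis
    unfolding homeomorphic_embedding_def
    by (intro exI[of _ "henon_inv A B"] homeomorphismI) (auto intro: continuous_on_subset simp: henon_inv)
qed

text \<open>The maps \<open>henon (t A) (t B)\<close> join \<open>henon A B\<close> to a rotation by a right angle.\<close>

lemma henon_orientation:
  assumes A: "continuous_on UNIV A" and B: "continuous_on UNIV B"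
  shows "orientation_preserving UNIV (henon A B)"
  unfolding orientation_preserving_def
proof (intro allI impI)
  fix z :: complex and r :: real assume r: "0 < r \<and> cball z r \<subseteq> UNIV"
  \<comment> \<open>At t = 0 the map is multiplication by -\<i>, which the exponential factor, then
    equal to \<i>, undoes, so the loop is the translated circle itself; at t = 1 the factor is 1.
    Injectivity of all intermediate maps keeps the loops away from 0.\<close>
  define h where "h t s = exp (\<i> * of_real (pi / 2 * (1 - t))) *
     (henon (\<lambda>x. t * A x) (\<lambda>x. t * B x) (circlepath z r s) - henon (\<lambda>x. t * A x) (\<lambda>x. t * B x) z)" for t s :: real
  have nz: "h t s \<noteq> 0" for t s
  proof -
    have "norm (circlepath z r s - z) = r" using r by (simp add: circlepath norm_mult)
    then show ?thesis using r by (auto simp: h_def inj_henon)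
  qed
  have cont: "continuous_on ({0..1} \<times> {0..1}) (\<lambda>(t, s). h t s)"
    unfolding h_def henon_def circlepath split_beta
    by (intro continuous_intros continuous_on_compose2[OF A] continuous_on_compose2[OF B]) auto
  have "homotopic_loops (- {0}) (h 0) (h 1)"
    unfolding homotopic_loops
  proof (intro exI[of _ "\<lambda>(t, s). h t s"] conjI ballI)
    show "pathfinish ((\<lambda>(t, s). h t s) \<circ> Pair t) = pathstart ((\<lambda>(t, s). h t s) \<circ> Pair t)" for t
      by (simp add: pathfinish_def pathstart_def h_def circlepath)
  qed (use nz cont in auto)
  then have "winding_number (h 0) 0 = winding_number (h 1) 0" by (rule winding_number_homotopic_loops)
  moreover have "h 1 = (\<lambda>s. (henon A B \<circ> circlepath z r) s - henon A B z)" by (auto simp: h_def)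
  moreover have "h 0 = (\<lambda>s. circlepath z r s - z)"
    by (auto simp: h_def henon_def complex_eq_iff fun_eq_iff Re_exp Im_exp)
  ultimately show "winding_number (henon A B \<circ> circlepath z r) (henon A B z) = 1"
    using winding_number_circlepath_centre[of r z] r
    by (metis winding_number_offset)
qed

definition henon_deriv ::
  "(real \<Rightarrow> real) \<Rightarrow> (real \<Rightarrow> real) \<Rightarrow> (real \<Rightarrow> real) \<Rightarrow> complex \<Rightarrow> complex \<Rightarrow> complex" where
  "henon_deriv A A' B' z h =
     Complex (Im h + A' (Re z) * Re h) (B' (Im z + A (Re z)) * (Im h + A' (Re z) * Re h) - Re h)"

lemma henon_has_derivative:
  assumes A: "\<And>x. (A has_real_derivative A' x) (at x)" and B: "\<And>x. (B has_real_derivative B' x) (at x)"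
  shows "(henon A B has_derivative henon_deriv A A' B' z) (at z)"
proof -
  have 1: "((\<lambda>z. A (Re z)) has_derivative (\<lambda>h. A' (Re z) * Re h)) (at z)"
    using has_derivative_compose[OF bounded_linear.has_derivative[OF bounded_linear_Re has_derivative_ident]
       A[unfolded has_field_derivative_def]] by simp
  have 2: "((\<lambda>z. Im z + A (Re z)) has_derivative (\<lambda>h. Im h + A' (Re z) * Re h)) (at z)"
    by (intro derivative_eq_intros 1) (auto intro: 1 bounded_linear_imp_has_derivative bounded_linear_Im)
  have 3: "((\<lambda>z. B (Im z + A (Re z))) has_derivative (\<lambda>h. B' (Im z + A (Re z)) * (Im h + A' (Re z) * Re h))) (at z)"
    using has_derivative_compose[OF 2 B[unfolded has_field_derivative_def]] by simp
  have 4: "((\<lambda>z. of_real (Im z + A (Re z)) + \<i> * of_real (B (Im z + A (Re z)) - Re z)) has_derivative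
        (\<lambda>h. of_real (Im h + A' (Re z) * Re h) + \<i> * of_real (B' (Im z + A (Re z)) * (Im h + A' (Re z) * Re h) - Re h))) (at z)"
    by (intro has_derivative_add has_derivative_mult_right has_derivative_of_real has_derivative_diff 2 3
         bounded_linear_imp_has_derivative bounded_linear_Re)
  then show ?thesis unfolding henon_def[abs_def] henon_deriv_def[abs_def] Complex_eq .
qed

text \<open>With X and Y the values of a real linear map at 1 and \<i>, the right side is its
  Jacobian determinant and the norms on the left are those of its two Wirtinger derivatives.\<close>

lemma norm_wirtinger_diff:
  "(norm ((X - \<i> * Y) / 2))^2 - (norm ((X + \<i> * Y) / 2))^2 = Re X * Im Y - Im X * Re Y"
proof -
  have "(norm (X - \<i> * Y))^2 - (norm (X + \<i> * Y))^2 = 4 * (Re X * Im Y - Im X * Re Y)"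
    unfolding cmod_power2 by (simp add: power2_eq_square algebra_simps)
  then show ?thesis by (simp add: norm_divide power_divide diff_divide_distrib[symmetric])
qed

text \<open>The Jacobian is 1, so |p| - |q| is the reciprocal of |p| + |q| and the dilatation equals
  (|p| + |q|)^2. The sum |p| + |q| is at most the sum of the norms of the two partial derivatives,
  which are bounded by \<open>M + M^2 + 1\<close> and \<open>1 + M\<close>.\<close>

lemma henon_quasiconformal:
  assumes A: "\<And>x. (A has_real_derivative A' x) (at x)" and B: "\<And>x. (B has_real_derivative B' x) (at x)"
    and cA: "continuous_on UNIV A'" and cB: "continuous_on UNIV B'"
    and bA: "\<And>x. \<bar>A' x\<bar> \<le> M" and bB: "\<And>x. \<bar>B' x\<bar> \<le> M"
  shows "quasiconformal_on ((2 + 2 * M + M^2)^2) UNIV (henon A B)"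
proof -
  have M: "M \<ge> 0" using bA[of 0] by (metis abs_ge_zero order_trans)
  have cont: "continuous_on UNIV A" "continuous_on UNIV B"
    using A B by (meson DERIV_isCont continuous_at_imp_continuous_on)+
  define D where "D = henon_deriv A A' B'"
  have D: "(henon A B has_derivative D z) (at z)" for z
    unfolding D_def by (rule henon_has_derivative[OF A B])
  have cD: "continuous_on UNIV (\<lambda>z. D z v)" for v
    unfolding D_def henon_deriv_def
    by (intro continuous_intros continuous_on_compose2[OF cA] continuous_on_compose2[OF cB]
          continuous_on_compose2[OF cont(1)]) auto
  define p q where "p z = (D z 1 - \<i> * D z \<i>) / 2" and "q z = (D z 1 + \<i> * D z \<i>) / 2" for z
  have cpq: "continuous_on UNIV p" "continuous_on UNIV q" unfolding p_def q_def by (intro continuous_intros cD; simp)+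
  have jac: "(norm (p z))^2 - (norm (q z))^2 = 1" for z
    unfolding p_def q_def norm_wirtinger_diff by (simp add: D_def henon_deriv_def)
  then have jac': "(norm (p z) - norm (q z)) * (norm (p z) + norm (q z)) = 1" for z
    by (metis square_diff_square_factored power2_eq_square mult.commute)
  have lt: "norm (q z) < norm (p z)" for z
  proof (rule ccontr)
    assume "\<not> norm (q z) < norm (p z)"
    then have "(norm (p z))^2 \<le> (norm (q z))^2" by (intro power_mono) auto
    then show False using jac[of z] by linarith
  qed
  have bound: "norm (p z) + norm (q z) \<le> 2 + 2 * M + M^2" for z
  proof -
    have cm: "norm w \<le> \<bar>Re w\<bar> + \<bar>Im w\<bar>" for w by (rule cmod_le)
    have BA: "\<bar>B' x * A' y\<bar> \<le> M^2" for x y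
      unfolding power2_eq_square abs_mult by (intro mult_mono bA bB M) auto
    have "norm (D z 1) \<le> M + (M^2 + 1)"
      by (rule order_trans[OF cm], rule add_mono)
         (use bA BA[of "Im z + A (Re z)" "Re z"] in \<open>auto simp: D_def henon_deriv_def intro: order_trans[OF abs_triangle_ineq4]\<close>)
    moreover have "norm (D z \<i>) \<le> 1 + M"
      by (rule order_trans[OF cm], rule add_mono) (use bB in \<open>auto simp: D_def henon_deriv_def\<close>)
    moreover have "norm (p z) \<le> (norm (D z 1) + norm (D z \<i>)) / 2" "norm (q z) \<le> (norm (D z 1) + norm (D z \<i>)) / 2"
      using norm_triangle_ineq4[of "D z 1" "\<i> * D z \<i>"] norm_triangle_ineq[of "D z 1" "\<i> * D z \<i>"]
      by (simp_all add: p_def q_def norm_mult norm_divide)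
    ultimately have "norm (p z) + norm (q z) \<le> norm (D z 1) + norm (D z \<i>)" "norm (D z 1) + norm (D z \<i>) \<le> M + (M^2 + 1) + (1 + M)"
      by (simp_all add: add_mono)
    then show ?thesis by simp
  qed
  have "(norm (p z) + norm (q z)) / (norm (p z) - norm (q z)) \<le> (2 + 2 * M + M^2)^2" for z
  proof -
    have "1 / (norm (p z) - norm (q z)) = norm (p z) + norm (q z)"
      using jac'[of z] lt[of z] by (simp add: divide_eq_eq mult.commute)
    then have "(norm (p z) + norm (q z)) / (norm (p z) - norm (q z)) = (norm (p z) + norm (q z)) * (norm (p z) + norm (q z))"
      by (metis times_divide_eq_right mult_1_right)
    also have "\<dots> = (norm (p z) + norm (q z))^2" by (simp add: power2_eq_square)
    also have "\<dots> \<le> (2 + 2 * M + M^2)^2" by (rule power_mono[OF bound]) simp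
    finally show ?thesis .
  qed
  then have ess: "esssup (lebesgue_on UNIV) (\<lambda>z. dilatation (p z) (q z)) \<le> ereal ((2 + 2 * M + M^2)^2)"
    by (rule esssup_dilatation_le[OF cpq lt])
  have "distributional_derivative wirtinger UNIV (henon A B) p"
    "distributional_derivative wirtinger_bar UNIV (henon A B) q"
    using distributional_derivative_classical[OF D cD] unfolding p_def q_def by auto
  moreover have "(1::real)^2 \<le> (2 + 2 * M + M^2)^2" by (rule power_mono) (use M in auto)
  ultimately show ?thesis
    unfolding quasiconformal_on_def
    using ess henon_embedding[OF cont] henon_orientation[OF cont] locally_integrable_continuous[OF cpq(1)]
      locally_integrable_continuous[OF cpq(2)]
    by (intro conjI exI[of _ p] exI[of _ q]) (simp_all only: connected_UNIV open_UNIV UNIV_not_empty one_power2 not_False_eq_True)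
qed

lemma three_point_implies_quasiconformal_extension:
  "quantitatively_implies integer_bijections
     (\<lambda>lam f. three_point_condition lam (\<lambda>n. f (of_int n)))
     (\<lambda>K f. has_quasiconformal_extension K f)"
  unfolding quantitatively_implies_def
proof
  fix lam
  obtain C :: int where C: "C \<ge> 1"
    "\<And>a p. (\<And>v. a (p v) = v) \<Longrightarrow> (\<And>n. p (a n) = n) \<Longrightarrow>
       three_point_condition lam (\<lambda>n. of_int (a n)) \<Longrightarrow>
       (\<forall>n m. \<bar>a n - a m\<bar> \<le> C * \<bar>n - m\<bar>) \<and> (\<forall>n m. \<bar>p n - p m\<bar> \<le> C * \<bar>n - m\<bar>)"
    using three_point_condition_imp_bilipschitz[of lam] by blast
  define M where "M = 6 * real_of_int C"
  have "has_quasiconformal_extension ((2 + 2 * M + M^2)^2) f"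
    if f: "f \<in> integer_bijections" "three_point_condition lam (\<lambda>n. f (of_int n))" for f
  proof -
    obtain a p where a: "\<And>n. f (of_int n) = of_int (a n)" and ap: "\<And>v. a (p v) = v" and pa: "\<And>n. p (a n) = n"
      using integer_bijection_inverse[OF f(1)] by metis
    have lip: "(\<forall>n m. \<bar>a n - a m\<bar> \<le> C * \<bar>n - m\<bar>) \<and> (\<forall>n m. \<bar>p n - p m\<bar> \<le> C * \<bar>n - m\<bar>)"
      using f(2) by (intro C(2) ap pa) (simp add: a)
    have "quasiconformal_on ((2 + 2 * M + M^2)^2) UNIV (henon (smoothstep a) (smoothstep p))"
      using lip unfolding M_def
      by (intro henon_quasiconformal[OF smoothstep_deriv smoothstep_deriv smoothstep'_cont smoothstep'_cont]
            smoothstep'_bound) auto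
    moreover have "henon (smoothstep a) (smoothstep p) z = f z" if "z \<in> \<int>" for z
    proof -
      obtain n where "z = of_int n" using \<open>z \<in> \<int>\<close> by (rule Ints_cases)
      moreover have "henon (smoothstep a) (smoothstep p) (of_int n) = of_int (a n)"
        by (simp add: henon_def pa complex_eq_iff)
      ultimately show ?thesis using a by simp
    qed
    ultimately show ?thesis unfolding has_quasiconformal_extension_def by blast
  qed
  then show "\<exists>K. \<forall>f\<in>integer_bijections. three_point_condition lam (\<lambda>n. f (of_int n)) \<longrightarrow> has_quasiconformal_extension K f"
    by blast
qed

subsection \<open>Mollification\<close>

abbreviation L1_on :: "'a::euclidean_space set \<Rightarrow> ('a \<Rightarrow> complex) \<Rightarrow> ennreal" where
  "L1_on A h \<equiv> \<integral>\<^sup>+z. indicator A z * ennreal (norm (h z)) \<partial>lborel"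

section \<open>Smooth bump functions\<close>

definition flat :: "nat \<Rightarrow> real \<Rightarrow> real" where
  "flat n t = (if t > 0 then exp (- 1 / t) / t ^ n else 0)"

lemma flat_nonneg: "flat n t \<ge> 0"
  by (simp add: flat_def)

text \<open>A single term of the series of \<open>exp (1 / t)\<close> already outweighs the power in
  the denominator. The square on the right makes the difference quotient at 0 tend to 0.\<close>

lemma flat_le: "flat n t \<le> fact (n + 2) * t\<^sup>2"
proof (cases "t > 0")
  case True
  have "sum (\<lambda>n. (1 / t) ^ n /\<^sub>R fact n) {n + 2} \<le> (\<Sum>n. (1 / t) ^ n /\<^sub>R fact n)"
    by (rule sum_le_suminf[OF summable_exp_generic]) (use True in auto)
  then have "(1 / t) ^ (n + 2) / fact (n + 2) \<le> exp (1 / t)"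
    unfolding exp_def by (simp add: divide_inverse mult.commute)
  then have "1 \<le> exp (1 / t) * (fact (n + 2) * t ^ (n + 2))"
    using True by (simp add: divide_le_eq power_one_over power_divide mult_ac del: fact_Suc)
  then have "exp (- 1 / t) * 1 \<le> exp (- 1 / t) * (exp (1 / t) * (fact (n + 2) * t ^ (n + 2)))"
    by (rule mult_left_mono) simp
  also have "\<dots> = fact (n + 2) * t ^ (n + 2)"
    by (simp add: mult.assoc[symmetric] exp_add[symmetric] del: fact_Suc)
  finally have "exp (- 1 / t) / t ^ n \<le> fact (n + 2) * t\<^sup>2"
    using True by (simp add: divide_le_eq power_add power2_eq_square mult_ac del: fact_Suc)
  then show ?thesis using True by (simp add: flat_def del: fact_Suc)
qed (simp add: flat_def)

text \<open>The powers of t in the denominator are there for this formula: linear combinations of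
  the family are closed under differentiation.\<close>

lemma flat_deriv: "(flat n has_real_derivative flat (n + 2) t - of_nat n * flat (n + 1) t) (at t)"
proof -
  consider "t < 0" | "t = 0" | "t > 0" by linarith
  then show ?thesis
  proof cases
    case 1
    then have "(flat n has_real_derivative 0) (at t)"
      by (intro DERIV_cong_ev[THEN iffD1, OF refl _ refl DERIV_const[of 0]] eventually_mono[OF order_tendstoD(2)[OF tendsto_ident_at]]
          ) (auto simp: flat_def eventually_nhds intro!: exI[of _ "{..<0}"])
    then show ?thesis using 1 by (simp add: flat_def)
  next
    case 2
    have "((\<lambda>h. flat n h / h) \<longlongrightarrow> 0) (at 0)"
    proof (rule Lim_null_comparison)
      show "\<forall>\<^sub>F h in at 0. norm (flat n h / h) \<le> fact (n + 2) * \<bar>h\<bar>"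
      proof (rule always_eventually, rule allI)
        fix h :: real
        show "norm (flat n h / h) \<le> fact (n + 2) * \<bar>h\<bar>"
          using flat_le[of n h] flat_nonneg[of n h]
          by (cases "h = 0") (simp_all add: abs_mult_self_eq power2_eq_square divide_le_eq mult.assoc del: fact_Suc)
      qed
      show "((\<lambda>h::real. fact (n + 2) * \<bar>h\<bar>) \<longlongrightarrow> 0) (at 0)"
        by (intro tendsto_eq_intros) auto
    qed
    then have "(flat n has_real_derivative 0) (at 0)"
      by (simp add: DERIV_def flat_def)
    then show ?thesis using 2 by (simp add: flat_def)
  next
    case 3
    have "((\<lambda>t. exp (- 1 / t) / t ^ n) has_real_derivative
        (exp (- 1 / t) * (1 / (t * t)) * t ^ n - exp (- 1 / t) * (of_nat n * t ^ (n - Suc 0))) / (t ^ n * t ^ n)) (at t)"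
      using 3 by (auto intro!: derivative_eq_intros)
    moreover have "(exp (- 1 / t) * (1 / (t * t)) * t ^ n - exp (- 1 / t) * (of_nat n * t ^ (n - Suc 0))) / (t ^ n * t ^ n)
        = flat (n + 2) t - of_nat n * flat (n + 1) t"
      using 3 by (cases n) (simp_all add: flat_def field_simps)
    ultimately have "((\<lambda>t. exp (- 1 / t) / t ^ n) has_real_derivative flat (n + 2) t - of_nat n * flat (n + 1) t) (at t)"
      by simp
    then show ?thesis
      by (rule has_field_derivative_transform_within_open[of _ _ _ "{0<..}"]) (use 3 in \<open>auto simp: flat_def\<close>)
  qed
qed

text \<open>A class that contains the bump and is closed under directional derivatives. Smoothness
  then follows by induction on the order, with no formula for higher derivatives. The generators
  compose \<open>flat n\<close> with the real affine functions of the plane.\<close>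

inductive_set bump_algebra :: "(complex \<Rightarrow> complex) set" where
  flat: "(\<lambda>z. of_real (flat n (c + Re (u * z)))) \<in> bump_algebra"
| const: "(\<lambda>z. c) \<in> bump_algebra"
| add: "f \<in> bump_algebra \<Longrightarrow> g \<in> bump_algebra \<Longrightarrow> (\<lambda>z. f z + g z) \<in> bump_algebra"
| mult: "f \<in> bump_algebra \<Longrightarrow> g \<in> bump_algebra \<Longrightarrow> (\<lambda>z. f z * g z) \<in> bump_algebra"

lemma bump_algebra_derivative:
  assumes "f \<in> bump_algebra"
  shows "\<exists>f'. (\<forall>z. (f has_derivative f' z) (at z)) \<and> (\<forall>v. (\<lambda>z. f' z v) \<in> bump_algebra)"
  using assms
proof induction
  case (flat n c u)
  let ?f = "\<lambda>z. c + Re (u * z)"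
  have "((\<lambda>z. of_real (flat n (?f z))) has_derivative
      (\<lambda>h. of_real ((flat (n + 2) (?f z) - of_nat n * flat (n + 1) (?f z)) * Re (u * h)) :: complex)) (at z)" for z
  proof (rule has_derivative_of_real)
    have "(?f has_derivative (\<lambda>h. Re (u * h))) (at z)"
      by (auto intro!: derivative_eq_intros)
    from has_derivative_compose[OF this flat_deriv[unfolded has_field_derivative_def]]
    show "((\<lambda>z. flat n (?f z)) has_derivative
      (\<lambda>h. (flat (n + 2) (?f z) - of_nat n * flat (n + 1) (?f z)) * Re (u * h))) (at z)" .
  qed
  moreover have "(\<lambda>z. of_real ((flat (n + 2) (?f z) - of_nat n * flat (n + 1) (?f z)) * Re (u * h)) :: complex) \<in> bump_algebra" for h
  proof -
    have "(\<lambda>z. (of_real (flat (n + 2) (?f z)) + of_real (- of_nat n) * of_real (flat (n + 1) (?f z))) * of_real (Re (u * h)) :: complex) \<in> bump_algebra"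
      by (intro bump_algebra.intros)
    then show ?thesis by simp
  qed
  ultimately show ?case by (intro exI[of _ "\<lambda>z h. of_real ((flat (n + 2) (?f z) - of_nat n * flat (n + 1) (?f z)) * Re (u * h))"]) blast
next
  case (const c)
  then show ?case by (intro exI[of _ "\<lambda>z h. 0"]) (auto intro: bump_algebra.const)
next
  case (add f g)
  then obtain f' g' where "\<And>z. (f has_derivative f' z) (at z)" "\<And>v. (\<lambda>z. f' z v) \<in> bump_algebra"
    "\<And>z. (g has_derivative g' z) (at z)" "\<And>v. (\<lambda>z. g' z v) \<in> bump_algebra" by metis
  then show ?case
    by (intro exI[of _ "\<lambda>z v. f' z v + g' z v"]) (auto intro!: bump_algebra.add has_derivative_add)
next
  case (mult f g)
  then obtain f' g' where "\<And>z. (f has_derivative f' z) (at z)" "\<And>v. (\<lambda>z. f' z v) \<in> bump_algebra"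
    "\<And>z. (g has_derivative g' z) (at z)" "\<And>v. (\<lambda>z. g' z v) \<in> bump_algebra" by metis
  then show ?case using mult
    by (intro exI[of _ "\<lambda>z v. f z * g' z v + f' z v * g z"]) (auto intro!: bump_algebra.intros has_derivative_mult)
qed

lemma bump_algebra_has_derivative:
  assumes "f \<in> bump_algebra"
  shows "(f has_derivative frechet_derivative f (at z)) (at z)"
    and "(\<lambda>z. frechet_derivative f (at z) v) \<in> bump_algebra"
proof -
  obtain f' where f': "\<And>z. (f has_derivative f' z) (at z)" "\<And>v. (\<lambda>z. f' z v) \<in> bump_algebra"
    using bump_algebra_derivative[OF assms] by blast
  have eq: "frechet_derivative f (at z) = f' z" for z using frechet_derivative_at[OF f'(1)] by simp
  show "(f has_derivative frechet_derivative f (at z)) (at z)" using f'(1) by (simp add: eq)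
  show "(\<lambda>z. frechet_derivative f (at z) v) \<in> bump_algebra" using f'(2) by (simp add: eq)
qed

lemma bump_algebra_continuous: "f \<in> bump_algebra \<Longrightarrow> continuous_on UNIV f"
  by (meson bump_algebra_has_derivative(1) continuous_at_imp_continuous_on has_derivative_continuous)

lemma bump_algebra_times_differentiable: "f \<in> bump_algebra \<Longrightarrow> times_differentiable k f"
proof (induction k arbitrary: f)
  case (Suc k)
  then show ?case using bump_algebra_has_derivative by (auto simp: differentiable_def)
qed (simp add: bump_algebra_continuous)

text \<open>The four factors are all positive exactly where |Re z| < 1 and |Im z| < 1. They are
  written in the form of the generators of \<open>bump_algebra\<close>, with u running through 1,
  -1, \<i> and -\<i>.\<close>

definition bump :: "complex \<Rightarrow> real" where
  "bump z = flat 0 (1 + Re (1 * z)) * flat 0 (1 + Re (- 1 * z)) * flat 0 (1 + Re (\<i> * z)) * flat 0 (1 + Re (- \<i> * z))"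

lemma bump_nonneg: "bump z \<ge> 0"
  by (simp add: bump_def flat_nonneg)

lemma bump_support: "bump z \<noteq> 0 \<Longrightarrow> \<bar>Re z\<bar> \<le> 1 \<and> \<bar>Im z\<bar> \<le> 1"
  by (auto simp: bump_def flat_def split: if_splits)

lemma bump_affine: "(\<lambda>w. of_real (c * bump (of_real s * (z - w)))) \<in> bump_algebra"
proof -
  have "(\<lambda>w. of_real (flat 0 (1 + Re (u * (of_real s * (z - w))))) :: complex) \<in> bump_algebra" for u
    using bump_algebra.flat[of 0 "1 + Re (u * of_real s * z)" "- u * of_real s"]
    by (simp add: algebra_simps)
  then have "(\<lambda>w. of_real c * (of_real (flat 0 (1 + Re (1 * (of_real s * (z - w))))) *
      of_real (flat 0 (1 + Re (- 1 * (of_real s * (z - w))))) * of_real (flat 0 (1 + Re (\<i> * (of_real s * (z - w))))) *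
      of_real (flat 0 (1 + Re (- \<i> * (of_real s * (z - w)))))) :: complex) \<in> bump_algebra"
    by (intro bump_algebra.mult bump_algebra.const)
  then show ?thesis by (simp only: bump_def of_real_mult)
qed

lemma continuous_bump: "continuous_on UNIV bump"
proof -
  have "(\<lambda>w. of_real (bump (- w))) \<in> bump_algebra" using bump_affine[of 1 1 0] by simp
  then have "continuous_on UNIV (\<lambda>w. complex_of_real (bump (- w)))" by (rule bump_algebra_continuous)
  then have "continuous_on UNIV (\<lambda>w. Re (complex_of_real (bump (- (- w)))))"
    by (intro continuous_intros) (rule continuous_on_compose2[where f=uminus], auto intro!: continuous_intros)
  then show ?thesis by simp
qed

section \<open>Continuity of translations in the mean\<close>

lemma nn_integral_lborel_shift:
  fixes f :: "complex \<Rightarrow> ennreal"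
  assumes [measurable]: "f \<in> borel_measurable borel"
  shows "(\<integral>\<^sup>+z. f (z + h) \<partial>lborel) = (\<integral>\<^sup>+z. f z \<partial>lborel)"
proof -
  have "(\<integral>\<^sup>+z. f z \<partial>lborel) = (\<integral>\<^sup>+z. f z \<partial>(distr lborel borel (\<lambda>z. h + z)))"
    using lborel_affine[of 1 h] by (simp add: density_1)
  also have "\<dots> = (\<integral>\<^sup>+z. f (h + z) \<partial>lborel)"
    by (rule nn_integral_distr) measurable
  finally show ?thesis by (simp add: add.commute)
qed

text \<open>Inner regularity gives a closed set. Since A has finite measure, cutting this set off by
  a large ball loses little more and makes it compact.\<close>

lemma compact_inner_approximation:
  fixes A :: "complex set"
  assumes A: "A \<in> sets borel" "emeasure lborel A < \<infinity>" and e: "e > 0"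
  obtains K where "compact K" "K \<subseteq> A" "emeasure lborel (A - K) < ennreal e"
proof -
  have "A \<in> sets lebesgue" using A(1) by (intro sets_completionI_sets) simp
  then obtain T where T: "closed T" "T \<subseteq> A" "emeasure lebesgue (A - T) < ennreal (e/2)"
    using sets_lebesgue_inner_closed[of A "e/2"] half_gt_zero[OF e] by metis
  have T1: "emeasure lborel (A - T) < ennreal (e/2)" using T A(1) by (simp add: borel_closed emeasure_completion)
  have "(\<lambda>n. emeasure lborel (T - cball 0 (real n))) \<longlonglongrightarrow> emeasure lborel (\<Inter>n. T - cball 0 (real n))"
  proof (rule Lim_emeasure_decseq)
    show "range (\<lambda>n. T - cball 0 (real n)) \<subseteq> sets lborel" using T(1) by (auto simp: borel_closed)
    show "decseq (\<lambda>n. T - cball 0 (real n))" by (auto simp: decseq_def)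
    show "emeasure lborel (T - cball 0 (real n)) \<noteq> \<infinity>" for n
    proof -
      have "emeasure lborel (T - cball 0 (real n)) \<le> emeasure lborel A"
        using A(1) T(2) by (intro emeasure_mono) auto
      then show ?thesis using A(2) by (metis infinity_ennreal_def leD)
    qed
  qed
  moreover have "(\<Inter>n. T - cball 0 (real n)) = {}"
    by (auto simp: dist_norm) (meson real_arch_simple)
  ultimately have "(\<lambda>n. emeasure lborel (T - cball 0 (real n))) \<longlonglongrightarrow> 0"
    by (metis emeasure_empty)
  then have "\<forall>\<^sub>F n in sequentially. emeasure lborel (T - cball 0 (real n)) < ennreal (e/2)"
    using e by (intro order_tendstoD) auto
  then obtain n where n: "emeasure lborel (T - cball 0 (real n)) < ennreal (e/2)"
    by (auto simp: eventually_sequentially)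
  have "emeasure lborel (A - (T \<inter> cball 0 (real n))) \<le> emeasure lborel ((A - T) \<union> (T - cball 0 (real n)))"
    using T A by (intro emeasure_mono) (auto simp: borel_closed)
  also have "\<dots> \<le> emeasure lborel (A - T) + emeasure lborel (T - cball 0 (real n))"
    using T A by (intro emeasure_subadditive) (auto simp: borel_closed)
  also have "\<dots> < ennreal (e/2) + ennreal (e/2)" by (rule add_strict_mono[OF T1 n])
  also have "\<dots> = ennreal e" using e by (simp add: ennreal_plus[symmetric] del: ennreal_plus)
  finally show ?thesis using T by (intro that[of "T \<inter> cball 0 (real n)"]) (auto simp: closed_Int_compact)
qed

text \<open>A density argument, in the form of the induction principle for integrable functions. For
  an indicator, choose K compact and U open with A between them: a shift too small to lead from K
  out of U changes membership in A only if z or \<open>z + h\<close> lies in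
  \<open>U - K\<close>.\<close>

lemma L1_translation_continuous:
  fixes g :: "complex \<Rightarrow> complex"
  assumes "integrable lborel g" "e > 0"
  shows "\<exists>d>0. \<forall>h. norm h < d \<longrightarrow> (\<integral>\<^sup>+z. ennreal (norm (g (z + h) - g z)) \<partial>lborel) \<le> ennreal e"
  using assms
proof (induction arbitrary: e rule: integrable_induct)
  case (base A c)
  then have A: "A \<in> sets borel" "emeasure lborel A < \<infinity>" by auto
  \<comment> \<open>\<open>U - K\<close> has measure at most \<open>2 * r\<close> and is counted
    twice, once at z and once at \<open>z + h\<close>; the summand 1 covers c = 0.\<close>
  define r where "r = e / (4 * (norm c + 1))"
  have r: "r > 0" using base(3) by (simp add: r_def add_nonneg_pos)
  obtain K where K: "compact K" "K \<subseteq> A" "emeasure lborel (A - K) < ennreal r"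
    using compact_inner_approximation[OF A r] .
  have "A \<in> sets lebesgue" using A(1) by (intro sets_completionI_sets) simp
  then obtain U where U: "open U" "A \<subseteq> U" "emeasure lebesgue (U - A) < ennreal r"
    using sets_lebesgue_outer_open[OF _ r] by metis
  have U1: "emeasure lborel (U - A) < ennreal r" using U A(1) by (simp add: borel_open emeasure_completion)
  have Kb[measurable]: "K \<in> sets borel" "U \<in> sets borel" "A \<in> sets borel" using K U A by (auto simp: borel_compact)
  have UK: "emeasure lborel (U - K) \<le> ennreal (2 * r)"
  proof -
    have "emeasure lborel (U - K) \<le> emeasure lborel ((U - A) \<union> (A - K))" by (intro emeasure_mono) auto
    also have "\<dots> \<le> emeasure lborel (U - A) + emeasure lborel (A - K)" by (intro emeasure_subadditive) auto
    also have "\<dots> \<le> ennreal r + ennreal r" using K(3) U1 by (intro add_mono) auto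
    also have "\<dots> = ennreal (2 * r)" using r by (simp add: ennreal_plus[symmetric] del: ennreal_plus)
    finally show ?thesis .
  qed
  obtain d where d: "d > 0" "\<And>x y. x \<in> K \<Longrightarrow> norm (y - x) < d \<Longrightarrow> y \<in> U"
  proof -
    obtain d where "d > 0" "(\<Union>x\<in>K. ball x d) \<subseteq> U"
      using compact_subset_open_imp_ball_epsilon_subset[OF K(1) U(1)] K(2) U(2) by blast
    moreover from this have "y \<in> U" if "x \<in> K" "norm (y - x) < d" for x y
      using that by (metis UN_I dist_norm mem_ball norm_minus_commute subsetD)
    ultimately show ?thesis using that by blast
  qed
  have "(\<integral>\<^sup>+z. ennreal (norm (indicator A (z + h) *\<^sub>R c - indicator A z *\<^sub>R c)) \<partial>lborel) \<le> ennreal e" if h: "norm h < d" for h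
  proof -
    have pt: "norm (indicator A (z + h) *\<^sub>R c - indicator A z *\<^sub>R c)
        \<le> norm c * indicator (U - K) z + norm c * indicator (U - K) (z + h)" for z
    proof (cases "indicator A (z + h) = (indicator A z :: real)")
      case False
      have 1: "z \<in> K \<Longrightarrow> z + h \<in> U" using d(2)[of z "z + h"] h by simp
      have 2: "z + h \<in> K \<Longrightarrow> z \<in> U" using d(2)[of "z + h" z] h by simp
      have "z + h \<in> A \<longleftrightarrow> z \<notin> A" using False by (auto simp: indicator_def)
      then have "z \<in> U - K \<or> z + h \<in> U - K" using 1 2 K(2) U(2) by blast
      moreover have "norm (indicator A (z + h) *\<^sub>R c - indicator A z *\<^sub>R c) \<le> norm c" by (simp add: indicator_def)
      ultimately show ?thesis by (auto simp: indicator_def)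
    qed simp
    have "(\<integral>\<^sup>+z. ennreal (norm (indicator A (z + h) *\<^sub>R c - indicator A z *\<^sub>R c)) \<partial>lborel)
        \<le> (\<integral>\<^sup>+z. ennreal (norm c) * indicator (U - K) z + ennreal (norm c) * indicator (U - K) (z + h) \<partial>lborel)"
    proof (rule nn_integral_mono)
      fix z
      show "ennreal (norm (indicator A (z + h) *\<^sub>R c - indicator A z *\<^sub>R c)) \<le> ennreal (norm c) * indicator (U - K) z + ennreal (norm c) * indicator (U - K) (z + h)"
        using pt[of z] by (auto simp: indicator_def ennreal_plus[symmetric] simp del: ennreal_plus intro: ennreal_leI)
    qed
    also have "\<dots> = (\<integral>\<^sup>+z. ennreal (norm c) * indicator (U - K) z \<partial>lborel) + (\<integral>\<^sup>+z. ennreal (norm c) * indicator (U - K) (z + h) \<partial>lborel)"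
      by (rule nn_integral_add) measurable
    also have "(\<integral>\<^sup>+z. ennreal (norm c) * indicator (U - K) (z + h) \<partial>lborel) = (\<integral>\<^sup>+z. ennreal (norm c) * indicator (U - K) z \<partial>lborel)"
      by (rule nn_integral_lborel_shift[of "\<lambda>z. ennreal (norm c) * indicator (U - K) z"]) measurable
    also have "(\<integral>\<^sup>+z. ennreal (norm c) * indicator (U - K) z \<partial>lborel) = ennreal (norm c) * emeasure lborel (U - K)"
      by (rule nn_integral_cmult_indicator) measurable
    also have "ennreal (norm c) * emeasure lborel (U - K) + ennreal (norm c) * emeasure lborel (U - K)
        \<le> ennreal (norm c) * ennreal (2 * r) + ennreal (norm c) * ennreal (2 * r)"
      by (intro add_mono mult_left_mono UK) auto
    also have "\<dots> = ennreal (norm c * (4 * r))"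
      using r by (simp add: ennreal_mult[symmetric] ennreal_plus[symmetric] del: ennreal_plus)
    also have "\<dots> \<le> ennreal e"
    proof (rule ennreal_leI)
      have "norm c * (4 * r) = e * (norm c / (norm c + 1))" by (simp add: r_def add_nonneg_eq_0_iff field_simps)
      also have "\<dots> \<le> e * 1" using base(3) add_nonneg_pos[OF norm_ge_zero[of c] zero_less_one]
        by (intro mult_left_mono) (auto simp: divide_le_eq)
      finally show "norm c * (4 * r) \<le> e" by simp
    qed
    finally show ?thesis .
  qed
  then show ?case using d(1) by blast
next
  case (add f g)
  have [measurable]: "f \<in> borel_measurable borel" "g \<in> borel_measurable borel"
    using add.hyps by (auto dest: borel_measurable_integrable)
  obtain d1 where d1: "d1 > 0" "\<And>h. norm h < d1 \<Longrightarrow> (\<integral>\<^sup>+z. ennreal (norm (f (z + h) - f z)) \<partial>lborel) \<le> ennreal (e/2)"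
    using add.IH(1)[of "e/2"] add.prems by auto
  obtain d2 where d2: "d2 > 0" "\<And>h. norm h < d2 \<Longrightarrow> (\<integral>\<^sup>+z. ennreal (norm (g (z + h) - g z)) \<partial>lborel) \<le> ennreal (e/2)"
    using add.IH(2)[of "e/2"] add.prems by auto
  have "(\<integral>\<^sup>+z. ennreal (norm (f (z + h) + g (z + h) - (f z + g z))) \<partial>lborel) \<le> ennreal e" if "norm h < min d1 d2" for h
  proof -
    have "(\<integral>\<^sup>+z. ennreal (norm (f (z + h) + g (z + h) - (f z + g z))) \<partial>lborel)
      \<le> (\<integral>\<^sup>+z. ennreal (norm (f (z + h) - f z)) + ennreal (norm (g (z + h) - g z)) \<partial>lborel)"
      by (intro nn_integral_mono) (simp add: ennreal_plus[symmetric] norm_diff_triangle_ineq ennreal_leI del: ennreal_plus)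
    also have "\<dots> = (\<integral>\<^sup>+z. ennreal (norm (f (z + h) - f z)) \<partial>lborel) + (\<integral>\<^sup>+z. ennreal (norm (g (z + h) - g z)) \<partial>lborel)"
      by (rule nn_integral_add) measurable
    also have "\<dots> \<le> ennreal (e/2) + ennreal (e/2)" using that d1(2) d2(2) by (intro add_mono) auto
    also have "\<dots> = ennreal e" using add.prems by (simp add: ennreal_plus[symmetric] del: ennreal_plus)
    finally show ?thesis .
  qed
  then show ?case using d1(1) d2(1) by (intro exI[of _ "min d1 d2"]) auto
next
  case (lim f s)
  have [measurable]: "f \<in> borel_measurable borel" "\<And>i. s i \<in> borel_measurable borel"
    using lim.hyps(1,4) by (auto dest: borel_measurable_integrable)
  have "(\<lambda>i. \<integral>\<^sup>+z. ennreal (norm (s i z - f z)) \<partial>lborel) \<longlonglongrightarrow> (\<integral>\<^sup>+z. 0 \<partial>(lborel :: complex measure))"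
  proof (rule nn_integral_dominated_convergence)
    show "AE z in lborel. ennreal (norm (s i z - f z)) \<le> ennreal (3 * norm (f z))" for i
    proof (rule AE_I2, rule ennreal_leI)
      fix z
      show "norm (s i z - f z) \<le> 3 * norm (f z)"
        using norm_triangle_ineq4[of "s i z" "f z"] lim.hyps(3)[of z i] by simp
    qed
    show "(\<integral>\<^sup>+z. ennreal (3 * norm (f z)) \<partial>lborel) < \<infinity>"
      using lim.hyps(4) by (simp add: integrable_iff_bounded ennreal_mult nn_integral_cmult ennreal_mult_less_top)
    show "AE z in lborel. (\<lambda>i. ennreal (norm (s i z - f z))) \<longlonglongrightarrow> 0"
    proof (rule AE_I2)
      fix z
      have "(\<lambda>i. norm (s i z - f z)) \<longlonglongrightarrow> 0" using lim.hyps(2)[of z] by (simp add: LIM_zero tendsto_norm_zero)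
      then show "(\<lambda>i. ennreal (norm (s i z - f z))) \<longlonglongrightarrow> 0" using tendsto_ennrealI by fastforce
    qed
  qed measurable
  then have "\<forall>\<^sub>F i in sequentially. (\<integral>\<^sup>+z. ennreal (norm (s i z - f z)) \<partial>lborel) < ennreal (e/3)"
    using lim.prems by (intro order_tendstoD(2)) auto
  then obtain i where i: "(\<integral>\<^sup>+z. ennreal (norm (s i z - f z)) \<partial>lborel) < ennreal (e/3)"
    by (auto simp: eventually_sequentially)
  obtain d where d: "d > 0" "\<And>h. norm h < d \<Longrightarrow> (\<integral>\<^sup>+z. ennreal (norm (s i (z + h) - s i z)) \<partial>lborel) \<le> ennreal (e/3)"
    using lim.IH[of "e/3" i] lim.prems by auto
  have "(\<integral>\<^sup>+z. ennreal (norm (f (z + h) - f z)) \<partial>lborel) \<le> ennreal e" if h: "norm h < d" for h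
  proof -
    have tri: "norm (a - b) \<le> norm (c - a) + (norm (c - d) + norm (d - b))" for a b c d :: complex
      using norm_triangle_ineq[of "c - d" "d - b"] norm_triangle_ineq4[of "c - b" "c - a"] by simp
    have "(\<integral>\<^sup>+z. ennreal (norm (f (z + h) - f z)) \<partial>lborel)
      \<le> (\<integral>\<^sup>+z. ennreal (norm (s i (z + h) - f (z + h))) + (ennreal (norm (s i (z + h) - s i z)) + ennreal (norm (s i z - f z))) \<partial>lborel)"
      by (intro nn_integral_mono) (simp add: ennreal_plus[symmetric] tri ennreal_leI del: ennreal_plus)
    also have "\<dots> = (\<integral>\<^sup>+z. ennreal (norm (s i (z + h) - f (z + h))) \<partial>lborel) + ((\<integral>\<^sup>+z. ennreal (norm (s i (z + h) - s i z)) \<partial>lborel) + (\<integral>\<^sup>+z. ennreal (norm (s i z - f z)) \<partial>lborel))"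
      by (subst nn_integral_add; measurable?; subst nn_integral_add; measurable?)
    also have "(\<integral>\<^sup>+z. ennreal (norm (s i (z + h) - f (z + h))) \<partial>lborel) = (\<integral>\<^sup>+z. ennreal (norm (s i z - f z)) \<partial>lborel)"
      by (rule nn_integral_lborel_shift[of "\<lambda>z. ennreal (norm (s i z - f z))"]) measurable
    also have "(\<integral>\<^sup>+z. ennreal (norm (s i z - f z)) \<partial>lborel) + ((\<integral>\<^sup>+z. ennreal (norm (s i (z + h) - s i z)) \<partial>lborel) + (\<integral>\<^sup>+z. ennreal (norm (s i z - f z)) \<partial>lborel))
       \<le> ennreal (e/3) + (ennreal (e/3) + ennreal (e/3))"
      by (intro add_mono d(2) h less_imp_le[OF i])
    also have "\<dots> = ennreal e" using lim.prems by (simp add: ennreal_plus[symmetric] del: ennreal_plus)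
    finally show ?thesis .
  qed
  then show ?case using d(1) by blast
qed

text \<open>For z in the unit ball around \<open>z0\<close> all integrands vanish outside one box,
  so it suffices to differentiate under the integral over that box.\<close>

lemma convolution_has_derivative:
  fixes F \<kappa> :: "complex \<Rightarrow> complex"
  assumes F: "continuous_on UNIV F" and \<kappa>: "\<And>z. (\<kappa> has_derivative \<kappa>' z) (at z)" "\<And>v. continuous_on UNIV (\<lambda>z. \<kappa>' z v)"
    and supp: "\<And>z. norm z > R \<Longrightarrow> \<kappa> z = 0"
  shows "((\<lambda>z. \<integral>w. F w * \<kappa> (z - w) \<partial>lborel) has_derivative (\<lambda>v. \<integral>w. F w * \<kappa>' (z0 - w) v \<partial>lborel)) (at z0)"
    and "isCont (\<lambda>z. \<integral>w. F w * \<kappa>' (z - w) v \<partial>lborel) z0"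
proof -
  have c\<kappa>: "continuous_on UNIV \<kappa>" using \<kappa>(1) by (meson continuous_at_imp_continuous_on has_derivative_continuous)
  have supp': "\<kappa>' z v = 0" if "norm z > R" for z v
  proof -
    have "(\<kappa> has_derivative (\<lambda>h. 0)) (at z)"
    proof (rule has_derivative_transform_within_open[OF has_derivative_const])
      show "open (- cball 0 R)" by (simp add: open_Compl)
      show "0 = \<kappa> x" if "x \<in> - cball 0 R" for x using supp that by simp
    qed (use that in simp)
    then show ?thesis using has_derivative_unique[OF \<kappa>(1)] by metis
  qed
  obtain l u where lu: "cball z0 (R + 1) \<subseteq> cbox l u"
    using bounded_subset_cbox_symmetric bounded_cball by metis
  have far: "norm (z - w) > R" if "z \<in> ball z0 1" "w \<notin> cbox l u" for z w
  proof -
    have "norm (z0 - w) > R + 1" using lu that(2) by (force simp: dist_norm)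
    then show ?thesis using that(1) norm_triangle_ineq[of "z0 - z" "z - w"] by (simp add: dist_norm)
  qed
  have c1: "continuous_on S (\<lambda>x. F (g x) * \<kappa> (h x - g x))"
    if "continuous_on S g" "continuous_on S h" for S :: "'b::topological_space set" and g h
    by (intro continuous_on_mult continuous_on_compose2[OF F] continuous_on_compose2[OF c\<kappa>] continuous_on_diff that) auto
  have c2: "continuous_on S (\<lambda>x. F (g x) * \<kappa>' (h x - g x) v)"
    if "continuous_on S g" "continuous_on S h" for S :: "'b::topological_space set" and g h v
    by (intro continuous_on_mult continuous_on_compose2[OF F] continuous_on_compose2[OF \<kappa>(2)] continuous_on_diff that) auto
  have e1: "(\<integral>w. F w * \<kappa> (z - w) \<partial>lborel) = integral (cbox l u) (\<lambda>w. F w * \<kappa> (z - w))" if "z \<in> ball z0 1" for z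
    proof (rule lborel_integral_eq_integral_cbox)
    show "continuous_on UNIV (\<lambda>w. F w * \<kappa> (z - w))" by (rule c1; intro continuous_intros)
  qed (use supp far that in simp)
  have e2: "(\<integral>w. F w * \<kappa>' (z - w) v \<partial>lborel) = integral (cbox l u) (\<lambda>w. F w * \<kappa>' (z - w) v)" if "z \<in> ball z0 1" for z v
    proof (rule lborel_integral_eq_integral_cbox)
    show "continuous_on UNIV (\<lambda>w. F w * \<kappa>' (z - w) v)" by (rule c2; intro continuous_intros)
  qed (use supp' far that in simp)
  \<comment> \<open>The Leibniz rule takes the derivative as a continuous function into the bounded
    linear maps, hence the passage through \<open>Blinfun\<close>.\<close>
  define fx where "fx z w = Blinfun (\<lambda>v. F w * \<kappa>' (z - w) v)" for z w
  have bl: "bounded_linear (\<lambda>v. F w * \<kappa>' (z - w) v)" for z w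
    using bounded_linear_compose[OF bounded_linear_mult_right has_derivative_bounded_linear[OF \<kappa>(1)]] .
  have fx: "blinfun_apply (fx z w) = (\<lambda>v. F w * \<kappa>' (z - w) v)" for z w
    unfolding fx_def by (rule bounded_linear_Blinfun_apply[OF bl])
  have cfx: "continuous_on S (\<lambda>(z, w). fx z w)" for S
    unfolding split_beta by (rule continuous_on_blinfun_componentwise) (simp only: fx, rule c2; intro continuous_intros)
  have "((\<lambda>z. integral (cbox l u) (\<lambda>w. F w * \<kappa> (z - w))) has_derivative integral (cbox l u) (fx z0)) (at z0 within ball z0 1)"
  proof (rule leibniz_rule[OF _ _ cfx])
    show "((\<lambda>z. F w * \<kappa> (z - w)) has_derivative blinfun_apply (fx z w)) (at z within ball z0 1)" for z w
    proof -
      have "((\<lambda>z. z - w) has_derivative (\<lambda>h. h)) (at z within ball z0 1)" by (auto intro!: derivative_eq_intros)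
      from has_derivative_mult_right[OF has_derivative_compose[OF this \<kappa>(1)], of "F w"]
      show ?thesis by (simp add: fx)
    qed
    show "(\<lambda>w. F w * \<kappa> (z - w)) integrable_on cbox l u" for z
      by (intro integrable_continuous, rule c1; intro continuous_intros)
  qed auto
  then have "((\<lambda>z. \<integral>w. F w * \<kappa> (z - w) \<partial>lborel) has_derivative integral (cbox l u) (fx z0)) (at z0 within ball z0 1)"
    by (rule has_derivative_transform[rotated 2]) (auto simp: e1)
  then have "((\<lambda>z. \<integral>w. F w * \<kappa> (z - w) \<partial>lborel) has_derivative integral (cbox l u) (fx z0)) (at z0)"
    by (simp add: at_within_open[of z0 "ball z0 1"])
  moreover have "blinfun_apply (integral (cbox l u) (fx z0)) = (\<lambda>v. \<integral>w. F w * \<kappa>' (z0 - w) v \<partial>lborel)"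
  proof
    fix v
    have "continuous_on (cbox l u) (\<lambda>w. (\<lambda>(z, w). fx z w) (z0, w))"
      by (rule continuous_on_compose2[OF cfx[of UNIV]]) (auto intro!: continuous_intros)
    then have "fx z0 integrable_on cbox l u"
      by (intro integrable_continuous) simp
    then show "blinfun_apply (integral (cbox l u) (fx z0)) v = (\<integral>w. F w * \<kappa>' (z0 - w) v \<partial>lborel)"
      by (simp add: blinfun_apply_integral fx e2)
  qed
  ultimately show "((\<lambda>z. \<integral>w. F w * \<kappa> (z - w) \<partial>lborel) has_derivative (\<lambda>v. \<integral>w. F w * \<kappa>' (z0 - w) v \<partial>lborel)) (at z0)"
    by simp
  have "continuous_on (ball z0 1 \<times> cbox l u) (\<lambda>(z, w). F w * \<kappa>' (z - w) v)"
    unfolding split_beta by (rule c2; intro continuous_intros)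
  then have "continuous_on (ball z0 1) (\<lambda>z. integral (cbox l u) (\<lambda>w. F w * \<kappa>' (z - w) v))"
    by (rule integral_continuous_on_param)
  then have "continuous_on (ball z0 1) (\<lambda>z. \<integral>w. F w * \<kappa>' (z - w) v \<partial>lborel)"
    by (rule continuous_on_eq) (simp add: e2)
  then show "isCont (\<lambda>z. \<integral>w. F w * \<kappa>' (z - w) v \<partial>lborel) z0"
    by (simp add: continuous_on_eq_continuous_at)
qed

section \<open>Mollification by a scaled bump\<close>

lemma lborel_substitution:
  fixes h :: "complex \<Rightarrow> complex"
  assumes [measurable]: "h \<in> borel_measurable borel" and s: "s > 0"
  shows "(\<integral>w. h w \<partial>lborel) = of_real (1 / s\<^sup>2) * (\<integral>x. h (z - x /\<^sub>R s) \<partial>lborel)"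
proof -
  have "(\<integral>w. h w \<partial>lborel) = (\<integral>w. h w \<partial>(density (distr lborel borel (\<lambda>x. z + (- 1 / s) *\<^sub>R x)) (\<lambda>_. ennreal (\<bar>- 1 / s\<bar> ^ DIM(complex)))))"
    using lborel_affine[of "- 1 / s" z] s by simp
  also have "\<dots> = (\<integral>w. (1 / s\<^sup>2) *\<^sub>R h w \<partial>(distr lborel borel (\<lambda>x. z + (- 1 / s) *\<^sub>R x)))"
    by (subst integral_density) (simp_all add: power_divide)
  also have "\<dots> = (\<integral>x. (1 / s\<^sup>2) *\<^sub>R h (z + (- 1 / s) *\<^sub>R x) \<partial>lborel)"
    by (subst integral_distr) measurable
  also have "\<dots> = of_real (1 / s\<^sup>2) * (\<integral>x. h (z - x /\<^sub>R s) \<partial>lborel)"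
    by (simp add: scaleR_conv_of_real divide_inverse)
  finally show ?thesis .
qed

definition bump_mass :: real where
  "bump_mass = (\<integral>x. bump x \<partial>lborel)"

lemma bump_measurable [measurable]: "bump \<in> borel_measurable borel"
  using continuous_bump by (rule borel_measurable_continuous_onI)

lemma integrable_bump: "integrable lborel bump"
proof -
  have "integrable lborel (\<lambda>x. complex_of_real (bump x))"
  proof (rule continuous_compact_support_integrable)
    show "continuous_on UNIV (\<lambda>x. complex_of_real (bump x))" by (intro continuous_intros continuous_bump)
    show "complex_of_real (bump z) = 0" if "z \<notin> cbox (Complex (-1) (-1)) (Complex 1 1)" for z
      using bump_support[of z] that by (auto simp: in_cbox_complex_iff abs_le_iff)
  qed auto
  then show ?thesis by (simp only: complex_of_real_integrable_eq)
qed

text \<open>If the integral vanished, the closed zero set of the bump would have full measure and so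
  be the whole plane, but the bump is positive at 0.\<close>

lemma bump_mass_pos: "bump_mass > 0"
proof (rule ccontr)
  assume "\<not> bump_mass > 0"
  moreover have "bump_mass \<ge> 0" unfolding bump_mass_def by (rule integral_nonneg_AE) (simp add: bump_nonneg)
  ultimately have "(\<integral>x. bump x \<partial>lborel) = 0" by (simp add: bump_mass_def)
  then have "AE x in lborel. bump x = 0"
    by (subst (asm) integral_nonneg_eq_0_iff_AE) (auto simp: integrable_bump bump_nonneg)
  then have "AE x in lebesgue. x \<in> {x. bump x = 0}" by (simp add: AE_completion)
  moreover have "closed {x. bump x = 0}" by (intro closed_Collect_eq continuous_bump continuous_intros)
  ultimately have "0 \<in> {x. bump x = 0}" by (rule mem_closed_if_AE_lebesgue[rotated])
  then show False by (simp add: bump_def flat_def)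
qed

text \<open>Convolution with the normalised bump shrunk by the factor s: large s means a small
  kernel, and \<open>s\<^sup>2\<close> restores total mass 1.\<close>

definition mollify :: "real \<Rightarrow> (complex \<Rightarrow> complex) \<Rightarrow> complex \<Rightarrow> complex" where
  "mollify s h z = (\<integral>w. h w * of_real (s\<^sup>2 / bump_mass * bump (of_real s * (z - w))) \<partial>lborel)"

text \<open>The substitution w = z - x / s moves s from the kernel to the argument of h: the result
  is an average of translates of h with a weight independent of s.\<close>

lemma mollify_eq:
  assumes [measurable]: "h \<in> borel_measurable borel" and s: "s > 0"
  shows "mollify s h z = (\<integral>x. h (z - x /\<^sub>R s) * of_real (bump x / bump_mass) \<partial>lborel)"
proof -
  have sx: "complex_of_real s * (z - (z - x /\<^sub>R s)) = x" for x using s by (simp add: scaleR_conv_of_real)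
  have "mollify s h z = of_real (1 / s\<^sup>2) * (\<integral>x. h (z - x /\<^sub>R s) * of_real (s\<^sup>2 / bump_mass * bump (of_real s * (z - (z - x /\<^sub>R s)))) \<partial>lborel)"
    unfolding mollify_def by (rule lborel_substitution[OF _ s]) measurable
  also have "(\<lambda>x. h (z - x /\<^sub>R s) * of_real (s\<^sup>2 / bump_mass * bump (of_real s * (z - (z - x /\<^sub>R s)))))
      = (\<lambda>x. of_real (s\<^sup>2) * (h (z - x /\<^sub>R s) * of_real (bump x / bump_mass)))"
    by (simp only: sx) (simp add: mult_ac)
  also have "of_real (1 / s\<^sup>2) * (\<integral>x. of_real (s\<^sup>2) * (h (z - x /\<^sub>R s) * of_real (bump x / bump_mass)) \<partial>lborel)
      = (\<integral>x. h (z - x /\<^sub>R s) * of_real (bump x / bump_mass) \<partial>lborel)"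
    using s by (subst integral_mult_right_zero) simp
  finally show ?thesis .
qed

lemma bump_integral_1:
  "(\<integral>x. complex_of_real (bump x / bump_mass) \<partial>lborel) = 1" "(\<integral>x. bump x / bump_mass \<partial>lborel) = 1"
  "(\<integral>\<^sup>+x. ennreal (bump x / bump_mass) \<partial>lborel) = 1"
proof -
  show *: "(\<integral>x. bump x / bump_mass \<partial>lborel) = 1"
    using bump_mass_pos by (simp add: bump_mass_def[symmetric])
  then show "(\<integral>x. complex_of_real (bump x / bump_mass) \<partial>lborel) = 1"
    by (simp only: integral_complex_of_real) simp
  show "(\<integral>\<^sup>+x. ennreal (bump x / bump_mass) \<partial>lborel) = 1"
    using * bump_mass_pos by (subst nn_integral_eq_integral) (auto simp: integrable_bump bump_nonneg)
qed

definition square :: "real \<Rightarrow> complex set" where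
  "square M = cbox (Complex (- M) (- M)) (Complex M M)"

lemma mem_square: "z \<in> square M \<longleftrightarrow> \<bar>Re z\<bar> \<le> M \<and> \<bar>Im z\<bar> \<le> M"
  by (auto simp: square_def in_cbox_complex_iff abs_le_iff)

lemma compact_square [simp]: "compact (square M)"
  by (simp add: square_def)

lemma square_borel [measurable]: "square M \<in> sets borel"
  by (simp add: square_def)

lemma shift_mem_square:
  assumes "z \<in> square M" "bump x \<noteq> 0" "s \<ge> 1"
  shows "z - x /\<^sub>R s \<in> square (M + 1)" "norm (x /\<^sub>R s) \<le> 2 / s"
proof -
  have "\<bar>Re x\<bar> \<le> 1" "\<bar>Im x\<bar> \<le> 1" using bump_support assms(2) by auto
  then have x: "\<bar>Re x\<bar> / s \<le> 1" "\<bar>Im x\<bar> / s \<le> 1" "norm x \<le> 2"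
    using assms(3) cmod_le[of x] by (auto simp: divide_le_eq)
  then have "\<bar>Re (x /\<^sub>R s)\<bar> \<le> 1" "\<bar>Im (x /\<^sub>R s)\<bar> \<le> 1"
    using assms(3) by (auto simp: abs_mult divide_inverse mult.commute)
  then show "z - x /\<^sub>R s \<in> square (M + 1)" using assms(1) by (auto simp: mem_square)
  show "norm (x /\<^sub>R s) \<le> 2 / s" using x(3) assms(3) by (simp add: divide_inverse mult.commute)
qed

text \<open>For z in \<open>square M\<close> and s at least 1 only values of g in
  \<open>square (M + 1)\<close> enter, so g may be cut off to an integrable h. The error is then at
  most an average of mean distances between h and its translates, and Fubini reduces the claim to
  continuity of translations.\<close>

lemma mollify_L1:
  assumes gm [measurable]: "g \<in> borel_measurable borel"
    and g: "integrable lborel (\<lambda>z. indicator (square (M + 1)) z *\<^sub>R g z)" and e: "e > 0"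
  shows "\<exists>s0\<ge>1. \<forall>s\<ge>s0. L1_on (square M) (\<lambda>z. mollify s g z - g z) \<le> ennreal e"
proof -
  define h where "h z = indicator (square (M + 1)) z *\<^sub>R g z" for z
  have hi: "integrable lborel h" using g by (simp add: h_def[abs_def])
  have [measurable]: "h \<in> borel_measurable borel" unfolding h_def[abs_def] by measurable
  define \<eta> where "\<eta> x = bump x / bump_mass" for x
  have \<eta>0: "\<eta> x \<ge> 0" for x using bump_nonneg bump_mass_pos by (simp add: \<eta>_def)
  have [measurable]: "\<eta> \<in> borel_measurable borel" unfolding \<eta>_def[abs_def] by measurable
  have \<eta>1: "(\<integral>x. \<eta> x \<partial>lborel) = 1" unfolding \<eta>_def by (rule bump_integral_1(2))
  obtain d where d: "d > 0" "\<And>v. norm v < d \<Longrightarrow> (\<integral>\<^sup>+z. ennreal (norm (h (z + v) - h z)) \<partial>lborel) \<le> ennreal e"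
    using L1_translation_continuous[OF hi e] by blast
  \<comment> \<open>On the support of the bump the shift \<open>x /\<^sub>R s\<close> has norm at
    most \<open>2 / s\<close>; the bound \<open>3 / d\<close> makes this strictly less than
    d.\<close>
  define s0 where "s0 = max 1 (3 / d)"
  have "L1_on (square M) (\<lambda>z. mollify s g z - g z) \<le> ennreal e" if s: "s \<ge> s0" for s
  proof -
    have s1: "s \<ge> 1" "2 / s < d"
    proof -
      show "s \<ge> 1" using s by (simp add: s0_def)
      moreover have "3 / d \<le> s" using s by (simp add: s0_def)
      ultimately show "2 / s < d" using d(1) by (simp add: field_simps)
    qed
    have "indicator (square M) z * ennreal (norm (mollify s g z - g z)) \<le> (\<integral>\<^sup>+x. ennreal (norm (h (z - x /\<^sub>R s) - h z) * \<eta> x) \<partial>lborel)" for z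
    proof (cases "z \<in> square M")
      case True
      have z1: "z \<in> square (M + 1)" using True by (auto simp: mem_square)
      have hsub: "h (z - x /\<^sub>R s) * of_real (\<eta> x) = g (z - x /\<^sub>R s) * of_real (\<eta> x)" for x
        using shift_mem_square(1)[OF True, of x s] s1 by (cases "bump x = 0") (auto simp: h_def \<eta>_def)
      have int1: "integrable lborel (\<lambda>x. h (z - x /\<^sub>R s) * of_real (\<eta> x))"
      proof -
        have "integrable lborel (\<lambda>x. h (z + (- 1 / s) *\<^sub>R x))"
        proof -
          have "integrable (density (distr lborel borel (\<lambda>x. z + (- 1 / s) *\<^sub>R x)) (\<lambda>_. ennreal (\<bar>- 1 / s\<bar> ^ DIM(complex)))) h"
            using hi lborel_affine[of "- 1 / s" z] s1 by simp
          then have "integrable lborel (\<lambda>x. (1 / s)\<^sup>2 *\<^sub>R h (z - (1 / s) *\<^sub>R x))"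
            using s1 by (subst (asm) integrable_density) (simp_all add: integrable_distr_eq)
          then have "integrable lborel (\<lambda>x. s\<^sup>2 *\<^sub>R ((1 / s)\<^sup>2 *\<^sub>R h (z - (1 / s) *\<^sub>R x)))"
            by (rule integrable_scaleR_right)
          then show ?thesis using s1 by (simp add: power_divide)
        qed
        then have "integrable lborel (\<lambda>x. h (z - x /\<^sub>R s))" by (simp add: divide_inverse)
        moreover obtain B where B: "\<And>x. bump x \<le> B"
        proof -
          have "bounded (bump ` square 1)" by (intro compact_imp_bounded compact_continuous_image continuous_on_subset[OF continuous_bump]) auto
          then obtain B where B: "\<And>x. x \<in> square 1 \<Longrightarrow> \<bar>bump x\<bar> \<le> B" by (auto simp: bounded_iff)
          have "bump x \<le> max B 0" for x using bump_support[of x] B[of x] by (cases "bump x = 0") (auto simp: mem_square)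
          then show ?thesis using that by blast
        qed
        moreover have "norm (h (z - x /\<^sub>R s) * of_real (\<eta> x)) \<le> norm (of_real (B / bump_mass) * h (z - x /\<^sub>R s))" for x
        proof -
          have "B / bump_mass \<ge> 0" using B[of x] bump_nonneg[of x] bump_mass_pos by simp
          then have 1: "norm (of_real (B / bump_mass) * h (z - x /\<^sub>R s)) = norm (h (z - x /\<^sub>R s)) * (B / bump_mass)"
            unfolding norm_mult norm_of_real by (simp only: abs_of_nonneg mult.commute)
          have 2: "norm (h (z - x /\<^sub>R s) * of_real (\<eta> x)) = norm (h (z - x /\<^sub>R s)) * \<eta> x"
            unfolding norm_mult norm_of_real by (simp only: abs_of_nonneg \<eta>0)
          have "\<eta> x \<le> B / bump_mass" unfolding \<eta>_def using B bump_mass_pos by (intro divide_right_mono) auto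
          then have "norm (h (z - x /\<^sub>R s)) * \<eta> x \<le> norm (h (z - x /\<^sub>R s)) * (B / bump_mass)"
            by (intro mult_left_mono) auto
          then show ?thesis unfolding 1 2 .
        qed
        moreover have "(\<lambda>x. h (z - x /\<^sub>R s) * of_real (\<eta> x)) \<in> borel_measurable lborel" by measurable
        ultimately show ?thesis
          by (blast intro: Bochner_Integration.integrable_bound integrable_mult_right AE_I2)
      qed
      have int2: "integrable lborel (\<lambda>x. h z * of_real (\<eta> x))"
        by (intro integrable_mult_right) (auto simp: \<eta>_def integrable_bump)
      have "mollify s g z - g z = (\<integral>x. h (z - x /\<^sub>R s) * of_real (\<eta> x) \<partial>lborel) - (\<integral>x. h z * of_real (\<eta> x) \<partial>lborel)"
        using s1 z1 by (simp add: mollify_eq \<eta>_def[symmetric] hsub) (simp add: \<eta>1 h_def)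
      also have "\<dots> = (\<integral>x. (h (z - x /\<^sub>R s) - h z) * of_real (\<eta> x) \<partial>lborel)"
        using int1 int2 by (simp add: left_diff_distrib)
      finally have "ennreal (norm (mollify s g z - g z)) \<le> (\<integral>\<^sup>+x. norm ((h (z - x /\<^sub>R s) - h z) * of_real (\<eta> x)) \<partial>lborel)"
        using integral_norm_bound_ennreal[of lborel "\<lambda>x. (h (z - x /\<^sub>R s) - h z) * of_real (\<eta> x)"] int1 int2
        by (simp add: left_diff_distrib)
      then show ?thesis using \<eta>0 by (simp add: norm_mult True)
    qed simp
    then have "L1_on (square M) (\<lambda>z. mollify s g z - g z)
        \<le> (\<integral>\<^sup>+z. \<integral>\<^sup>+x. ennreal (norm (h (z - x /\<^sub>R s) - h z) * \<eta> x) \<partial>lborel \<partial>lborel)"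
      by (intro nn_integral_mono) 
    also have "\<dots> = (\<integral>\<^sup>+x. \<integral>\<^sup>+z. ennreal (norm (h (z - x /\<^sub>R s) - h z) * \<eta> x) \<partial>lborel \<partial>lborel)"
      by (rule lborel_pair.Fubini') (measurable; simp add: split_beta)
    also have "\<dots> \<le> (\<integral>\<^sup>+x. ennreal e * ennreal (\<eta> x) \<partial>lborel)"
    proof (rule nn_integral_mono)
      fix x :: complex
      have "(\<integral>\<^sup>+z. ennreal (norm (h (z - x /\<^sub>R s) - h z) * \<eta> x) \<partial>lborel)
          = (\<integral>\<^sup>+z. ennreal (norm (h (z - x /\<^sub>R s) - h z)) * ennreal (\<eta> x) \<partial>lborel)"
        using \<eta>0 by (simp add: ennreal_mult)
      also have "\<dots> = (\<integral>\<^sup>+z. ennreal (norm (h (z + (- (x /\<^sub>R s))) - h z)) \<partial>lborel) * ennreal (\<eta> x)"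
        by (subst nn_integral_multc) simp_all
      also have "\<dots> \<le> ennreal e * ennreal (\<eta> x)"
      proof (cases "bump x = 0")
        case False
        have "norm (- (x /\<^sub>R s)) < d"
          using shift_mem_square(2)[of 0 0 x s] False s1 by (simp add: mem_square)
        then show ?thesis by (intro mult_right_mono d(2)) auto
      qed (simp add: \<eta>_def)
      finally show "(\<integral>\<^sup>+z. ennreal (norm (h (z - x /\<^sub>R s) - h z) * \<eta> x) \<partial>lborel) \<le> ennreal e * ennreal (\<eta> x)" .
    qed
    also have "\<dots> = ennreal e"
      using bump_integral_1(3) by (subst nn_integral_cmult) (auto simp: \<eta>_def)
    finally show ?thesis .
  qed
  then show ?thesis by (intro exI[of _ s0]) (auto simp: s0_def)
qed

lemma mollify_uniform:
  assumes F: "continuous_on UNIV F" and e: "e > 0"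
  shows "\<exists>s0\<ge>1. \<forall>s\<ge>s0. \<forall>z\<in>square M. norm (mollify s F z - F z) \<le> e"
proof -
  have [measurable]: "F \<in> borel_measurable borel" using F by (rule borel_measurable_continuous_onI)
  have "uniformly_continuous_on (square (M + 1)) F"
    by (intro compact_uniformly_continuous continuous_on_subset[OF F]) auto
  then obtain d where d: "d > 0" "\<And>x y. x \<in> square (M + 1) \<Longrightarrow> y \<in> square (M + 1) \<Longrightarrow> dist y x < d \<Longrightarrow> dist (F y) (F x) < e"
    using e unfolding uniformly_continuous_on_def by metis
  define s0 where "s0 = max 1 (3 / d)"
  have "norm (mollify s F z - F z) \<le> e" if s: "s \<ge> s0" and z: "z \<in> square M" for s z
  proof -
    have s1: "s \<ge> 1" "2 / s < d"
    proof -
      show "s \<ge> 1" using s by (simp add: s0_def)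
      moreover have "3 / d \<le> s" using s by (simp add: s0_def)
      ultimately show "2 / s < d" using d(1) by (simp add: field_simps)
    qed
    define \<eta> where "\<eta> x = bump x / bump_mass" for x
    have \<eta>0: "\<eta> x \<ge> 0" for x using bump_nonneg bump_mass_pos by (simp add: \<eta>_def)
    have i\<eta>: "integrable lborel \<eta>" by (simp add: \<eta>_def[abs_def] integrable_bump)
    have c\<eta>: "continuous_on UNIV \<eta>" unfolding \<eta>_def[abs_def] using bump_mass_pos by (intro continuous_intros continuous_bump) auto
    have supp: "\<eta> x = 0" if "x \<notin> square 1" for x using bump_support[of x] that by (auto simp: \<eta>_def mem_square)
    have int1: "integrable lborel (\<lambda>x. F (z - x /\<^sub>R s) * of_real (\<eta> x))"
      by (rule continuous_compact_support_integrable[where K = "square 1"])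
         (auto simp: supp intro!: continuous_intros c\<eta> continuous_on_compose2[OF F])
    have int2: "integrable lborel (\<lambda>x. F z * of_real (\<eta> x))" using i\<eta> by simp
    have "(\<integral>x. F z * of_real (\<eta> x) \<partial>lborel) = F z * (\<integral>x. of_real (\<eta> x) \<partial>lborel)" by simp
    also have "\<dots> = F z" using bump_integral_1(1) by (simp only: \<eta>_def mult_1_right)
    finally have Fz: "(\<integral>x. F z * of_real (\<eta> x) \<partial>lborel) = F z" .
    have "mollify s F z = (\<integral>x. F (z - x /\<^sub>R s) * of_real (\<eta> x) \<partial>lborel)"
      unfolding \<eta>_def using s1 by (intro mollify_eq) auto
    then have "mollify s F z - F z = (\<integral>x. F (z - x /\<^sub>R s) * of_real (\<eta> x) - F z * of_real (\<eta> x) \<partial>lborel)"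
      using Bochner_Integration.integral_diff[OF int1 int2] Fz by simp
    also have "norm \<dots> \<le> (\<integral>x. norm (F (z - x /\<^sub>R s) * of_real (\<eta> x) - F z * of_real (\<eta> x)) \<partial>lborel)"
      by (rule integral_norm_bound)
    also have "\<dots> \<le> (\<integral>x. e * \<eta> x \<partial>lborel)"
    proof (rule Bochner_Integration.integral_mono)
      show "norm (F (z - x /\<^sub>R s) * of_real (\<eta> x) - F z * of_real (\<eta> x)) \<le> e * \<eta> x" for x
      proof (cases "bump x = 0")
        case False
        have "z \<in> square (M + 1)" using z by (auto simp: mem_square)
        moreover have "dist (z - x /\<^sub>R s) z < d" using shift_mem_square(2)[OF z False s1(1)] s1(2) by (simp add: dist_norm)
        ultimately have "norm (F (z - x /\<^sub>R s) - F z) \<le> e"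
          using d(2)[of z "z - x /\<^sub>R s"] shift_mem_square(1)[OF z False s1(1)] by (simp add: dist_norm)
        then show ?thesis using \<eta>0[of x]
          by (simp add: left_diff_distrib[symmetric] norm_mult mult_right_mono)
      qed (simp add: \<eta>_def)
    qed (use int1 int2 i\<eta> in auto)
    also have "\<dots> = e" using bump_integral_1(2) by (simp only: integral_mult_right_zero \<eta>_def)
    finally show ?thesis by simp
  qed
  then show ?thesis by (intro exI[of _ s0]) (auto simp: s0_def)
qed

text \<open>Directional rather than Wirtinger derivatives, because the maximal inequality and the
  length estimates work along lines, and integrals over \<open>lborel\<close>, where Fubini is
  applied.\<close>

definition weak_derivative :: "(complex \<Rightarrow> complex) \<Rightarrow> complex \<Rightarrow> (complex \<Rightarrow> complex) \<Rightarrow> bool" where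
  "weak_derivative F v g \<longleftrightarrow> (\<forall>\<phi>. test_function UNIV \<phi> \<longrightarrow>
     (\<integral>z. F z * frechet_derivative \<phi> (at z) v \<partial>lborel) = - (\<integral>z. g z * \<phi> z \<partial>lborel))"

text \<open>Differentiation falls on the kernel. As a function of w the kernel is itself a test
  function, so a weak derivative of F takes over the differentiation; the sign from
  \<open>z - w\<close> cancels the sign in the definition of weak derivatives.\<close>

lemma mollify_has_derivative:
  assumes F: "continuous_on UNIV F" and s: "s > 0"
  obtains D where "\<And>z. (mollify s F has_derivative D z) (at z)" "\<And>v. continuous_on UNIV (\<lambda>z. D z v)"
    "\<And>v g z. weak_derivative F v g \<Longrightarrow> D z v = mollify s g z"
proof -
  define \<kappa> where "\<kappa> u = complex_of_real (s\<^sup>2 / bump_mass * bump (of_real s * u))" for u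
  have "\<kappa> \<in> bump_algebra" using bump_affine[of "s\<^sup>2 / bump_mass" "- s" 0] by (simp add: \<kappa>_def[abs_def])
  note b = bump_algebra_has_derivative[OF this]
  define \<kappa>' where "\<kappa>' z = frechet_derivative \<kappa> (at z)" for z
  have k1: "(\<kappa> has_derivative \<kappa>' z) (at z)" for z using b(1) by (simp add: \<kappa>'_def)
  have k2: "continuous_on UNIV (\<lambda>z. \<kappa>' z v)" for v unfolding \<kappa>'_def by (rule bump_algebra_continuous[OF b(2)])
  have k3: "\<kappa> z = 0" if "norm z > 2 / s" for z
  proof -
    have "norm (of_real s * z) > 2" using that s by (simp add: norm_mult field_simps)
    then show ?thesis using bump_support[of "of_real s * z"] cmod_le[of "of_real s * z"] by (fastforce simp: \<kappa>_def)
  qed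
  define D where "D z v = (\<integral>w. F w * \<kappa>' (z - w) v \<partial>lborel)" for z v
  have m: "mollify s h z = (\<integral>w. h w * \<kappa> (z - w) \<partial>lborel)" for h z by (simp add: mollify_def \<kappa>_def)
  have "(mollify s F has_derivative D z) (at z)" for z
    unfolding m[abs_def] D_def[abs_def] by (rule convolution_has_derivative(1)[OF F k1 k2 k3])
  moreover have "continuous_on UNIV (\<lambda>z. D z v)" for v
    unfolding D_def[abs_def] by (intro continuous_at_imp_continuous_on ballI convolution_has_derivative(2)[OF F k1 k2 k3])
  moreover have "D z v = mollify s g z" if w: "weak_derivative F v g" for v g z
  proof -
    define \<phi> where "\<phi> w = \<kappa> (z - w)" for w
    have "\<phi> \<in> bump_algebra" using bump_affine[of "s\<^sup>2 / bump_mass" s z] by (simp add: \<phi>_def[abs_def] \<kappa>_def)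
    then have "times_differentiable k \<phi>" for k by (rule bump_algebra_times_differentiable)
    moreover have "compact (closure {w. \<phi> w \<noteq> 0})"
    proof -
      have "{w. \<phi> w \<noteq> 0} \<subseteq> cball z (2 / s)" using k3 by (force simp: \<phi>_def dist_norm)
      then show ?thesis by (meson bounded_cball bounded_subset compact_closure)
    qed
    ultimately have "test_function UNIV \<phi>" by (simp add: test_function_def)
    then have e: "(\<integral>w. F w * frechet_derivative \<phi> (at w) v \<partial>lborel) = - (\<integral>w. g w * \<phi> w \<partial>lborel)"
      using w by (simp add: weak_derivative_def)
    have "frechet_derivative \<phi> (at w) v = - \<kappa>' (z - w) v" for w
    proof -
      have "((\<lambda>w. z - w) has_derivative (\<lambda>h. - h)) (at w)" by (auto intro!: derivative_eq_intros)
      from has_derivative_compose[OF this k1] have "(\<phi> has_derivative (\<lambda>h. \<kappa>' (z - w) (- h))) (at w)"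
        by (simp add: \<phi>_def[abs_def])
      then have "frechet_derivative \<phi> (at w) = (\<lambda>h. \<kappa>' (z - w) (- h))" by (metis frechet_derivative_at)
      then show ?thesis using linear_neg[OF has_derivative_linear[OF k1[of "z - w"]]] by simp
    qed
    then show ?thesis using e by (simp add: D_def m \<phi>_def)
  qed
  ultimately show ?thesis using that by blast
qed

subsection \<open>A maximal inequality\<close>

lemma norm_diff_le_nn_integral:
  fixes v v' :: "real \<Rightarrow> complex"
  assumes "p \<le> q" and v: "\<And>x. x \<in> {p..q} \<Longrightarrow> (v has_vector_derivative v' x) (at x)" and c: "continuous_on {p..q} v'"
  shows "ennreal (norm (v q - v p)) \<le> L1_on {p..q} v'"
proof -
  have "(\<integral>x. indicator {p..q} x *\<^sub>R v' x \<partial>lborel) = v q - v p"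
    by (rule integral_FTC_Icc[OF assms(1) _ c]) (meson v has_vector_derivative_at_within atLeastAtMost_iff)
  moreover have "integrable lborel (\<lambda>x. indicator {p..q} x *\<^sub>R v' x)"
    by (rule borel_integrable_compact) (auto intro: c)
  ultimately have "ennreal (norm (v q - v p)) \<le> (\<integral>\<^sup>+x. ennreal (norm (indicator {p..q} x *\<^sub>R v' x)) \<partial>lborel)"
    using integral_norm_bound_ennreal by metis
  also have "\<dots> = L1_on {p..q} v'"
    by (intro nn_integral_cong) (auto simp: indicator_def)
  finally show ?thesis .
qed

text \<open>Between a point x of B and its partner y the increment of v exceeds t times the length,
  hence so does the integral of the norm of \<open>v'\<close> over that interval. The Vitali lemma
  picks disjoint intervals among these whose fivefold enlargements still cover B, whence the factor
  5.\<close>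

lemma maximal_inequality_interval:
  fixes v v' :: "real \<Rightarrow> complex"
  assumes v: "\<And>x. (v has_vector_derivative v' x) (at x)" and c: "continuous_on UNIV v'" and t: "t > 0"
    and B: "B \<in> sets borel" "B \<subseteq> {x \<in> {a..b}. \<exists>y\<in>{a..b}. norm (v y - v x) > t * \<bar>y - x\<bar>}"
  shows "ennreal t * emeasure lborel B \<le> 5 * L1_on {a..b} v'"
proof -
  define K where "K = {(c, r). r > 0 \<and> a \<le> c - r \<and> c + r \<le> b \<and> norm (v (c + r) - v (c - r)) > t * (2 * r)}"
  have [measurable]: "v' \<in> borel_measurable borel" using c by (rule borel_measurable_continuous_onI)
  have "B \<subseteq> (\<Union>i\<in>K. cball (fst i) (snd i))"
  proof
    fix x assume "x \<in> B"
    then obtain y where y: "x \<in> {a..b}" "y \<in> {a..b}" "norm (v y - v x) > t * \<bar>y - x\<bar>" using B(2) by auto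
    define c r where "c = (x + y) / 2" and "r = \<bar>y - x\<bar> / 2"
    have "y \<noteq> x" using y(3) by auto
    then have "r > 0" by (simp add: r_def)
    have cr: "c + r = max x y" "c - r = min x y" unfolding c_def r_def by (auto simp: abs_if max_def min_def field_simps)
    have "norm (v (c + r) - v (c - r)) > t * (2 * r)"
      using y(3) unfolding cr by (auto simp: r_def max_def min_def norm_minus_commute)
    then have "(c, r) \<in> K" using y(1,2) \<open>r > 0\<close> by (simp add: K_def cr)
    moreover have "x \<in> cball c r" by (auto simp: dist_real_def c_def r_def abs_if field_simps)
    ultimately show "x \<in> (\<Union>i\<in>K. cball (fst i) (snd i))" by (intro UN_I[of "(c, r)"]) auto
  qed
  moreover have "0 < snd i \<and> snd i \<le> \<bar>b - a\<bar>" if "i \<in> K" for i using that by (auto simp: K_def)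
  ultimately obtain C where C: "countable C" "C \<subseteq> K"
    "pairwise (\<lambda>i j. disjnt (cball (fst i) (snd i)) (cball (fst j) (snd j))) C"
    "B \<subseteq> (\<Union>i\<in>C. cball (fst i) (5 * snd i))"
    by (rule Vitali_covering_lemma_cballs)
  \<comment> \<open>The selected family is reindexed by natural numbers, with empty sets outside N,
    so that countable additivity over the naturals applies.\<close>
  define N where "N = to_nat_on C ` C"
  define c r where "c n = fst (from_nat_into C n)" and "r n = snd (from_nat_into C n)" for n
  have NC: "from_nat_into C n \<in> C" if "n \<in> N" for n using that C(1) by (auto simp: N_def)
  define X Y where "X n = (if n \<in> N then cball (c n) (r n) else {})" and "Y n = (if n \<in> N then cball (c n) (5 * r n) else {})" for n
  have [measurable]: "X n \<in> sets borel" "Y n \<in> sets borel" for n by (auto simp: X_def Y_def)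
  have disj: "disjoint_family X"
    unfolding disjoint_family_on_def
  proof (intro ballI impI)
    fix m n :: nat assume mn: "m \<noteq> n"
    show "X m \<inter> X n = {}"
    proof (cases "m \<in> N \<and> n \<in> N")
      case True
      then have "from_nat_into C m \<noteq> from_nat_into C n" using mn C(1) by (auto simp: N_def)
      then show ?thesis using C(3) NC True unfolding X_def c_def r_def pairwise_def disjnt_def by auto
    qed (auto simp: X_def)
  qed
  have YB: "B \<subseteq> (\<Union>n. Y n)"
  proof
    fix x assume "x \<in> B"
    then obtain i where i: "i \<in> C" "x \<in> cball (fst i) (5 * snd i)" using C(4) by blast
    then have "x \<in> Y (to_nat_on C i)" using C(1) by (auto simp: Y_def N_def c_def r_def)
    then show "x \<in> (\<Union>n. Y n)" by blast
  qed
  define w where "w x = indicator {a..b} x * ennreal (norm (v' x))" for x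
  have [measurable]: "w \<in> borel_measurable borel" unfolding w_def[abs_def] by measurable
  have Yn: "ennreal t * emeasure lborel (Y n) \<le> 5 * (\<integral>\<^sup>+x\<in>X n. w x \<partial>lborel)" for n
  proof (cases "n \<in> N")
    case True
    then have K: "r n > 0" "a \<le> c n - r n" "c n + r n \<le> b" "norm (v (c n + r n) - v (c n - r n)) > t * (2 * r n)"
      using NC[OF True] C(2) by (auto simp: K_def c_def r_def)
    have "emeasure lborel (Y n) = ennreal (10 * r n)"
      using True K(1) by (simp add: Y_def cball_eq_atLeastAtMost)
    then have "ennreal t * emeasure lborel (Y n) = 5 * ennreal (t * (2 * r n))"
      using t K(1) by (simp add: ennreal_mult[symmetric] ennreal_numeral[symmetric] mult_ac del: ennreal_numeral)
    also have "\<dots> \<le> 5 * ennreal (norm (v (c n + r n) - v (c n - r n)))"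
      using K(4) by (intro mult_left_mono ennreal_leI) auto
    also have "\<dots> \<le> 5 * L1_on {c n - r n..c n + r n} v'"
      using K(1) by (intro mult_left_mono norm_diff_le_nn_integral v continuous_on_subset[OF c]) auto
    also have "L1_on {c n - r n..c n + r n} v' = (\<integral>\<^sup>+x\<in>X n. w x \<partial>lborel)"
      using True K by (intro nn_integral_cong) (auto simp: X_def w_def cball_eq_atLeastAtMost indicator_def)
    finally show ?thesis .
  qed (simp add: Y_def)
  have "emeasure lborel B \<le> emeasure lborel (\<Union>n. Y n)" by (rule emeasure_mono[OF YB]) measurable
  also have "\<dots> \<le> (\<Sum>n. emeasure lborel (Y n))" by (rule emeasure_subadditive_countably) auto
  finally have "ennreal t * emeasure lborel B \<le> ennreal t * (\<Sum>n. emeasure lborel (Y n))" by (rule mult_left_mono) simp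
  also have "\<dots> = (\<Sum>n. ennreal t * emeasure lborel (Y n))" by (rule ennreal_suminf_cmult[symmetric])
  also have "\<dots> \<le> (\<Sum>n. 5 * (\<integral>\<^sup>+x\<in>X n. w x \<partial>lborel))" by (rule suminf_le[OF Yn]) auto
  also have "\<dots> = 5 * (\<Sum>n. (\<integral>\<^sup>+x\<in>X n. w x \<partial>lborel))" by (rule ennreal_suminf_cmult)
  also have "(\<Sum>n. (\<integral>\<^sup>+x\<in>X n. w x \<partial>lborel)) = (\<integral>\<^sup>+x\<in>(\<Union>n. X n). w x \<partial>lborel)"
    by (rule nn_integral_disjoint_family[symmetric, OF _ _ disj]) measurable
  also have "\<dots> \<le> (\<integral>\<^sup>+x. w x \<partial>lborel)" by (intro nn_integral_mono) (auto simp: indicator_def)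
  finally show ?thesis by (simp add: w_def mult_left_mono)
qed

text \<open>Every argument about one coordinate direction is carried out for a pair \<open>(u, u')\<close> that is
  \<open>(1, \<i>)\<close> or \<open>(\<i>, 1)\<close>.\<close>

definition axes :: "complex \<Rightarrow> complex \<Rightarrow> bool" where
  "axes u u' \<longleftrightarrow> u = 1 \<and> u' = \<i> \<or> u = \<i> \<and> u' = 1"

lemma axes_mem_square:
  "axes u u' \<Longrightarrow> of_real x * u + of_real y * u' \<in> square M \<longleftrightarrow> \<bar>x\<bar> \<le> M \<and> \<bar>y\<bar> \<le> M"
  by (auto simp: axes_def mem_square)

lemma axes_decomp: "axes u u' \<Longrightarrow> of_real (Re (cnj u * z)) * u + of_real (Re (cnj u' * z)) * u' = z"
  by (auto simp: axes_def complex_eq_iff)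

lemma lborel_axes:
  assumes "axes u u'"
  shows "lborel = distr (lborel \<Otimes>\<^sub>M lborel) borel (\<lambda>(y, x). of_real x * u + of_real y * u')"
proof (rule lborel_eqI)
  have [measurable]: "(\<lambda>(y, x). of_real x * u + of_real y * u') \<in> borel_measurable (lborel \<Otimes>\<^sub>M lborel)"
    unfolding split_beta by measurable
  fix l h :: complex assume H: "\<And>b. b \<in> Basis \<Longrightarrow> l \<bullet> b \<le> h \<bullet> b"
  have lh: "Re l \<le> Re h" "Im l \<le> Im h" using H[of 1] H[of \<i>] by (auto simp: Basis_complex_def)
  consider "u = 1" "u' = \<i>" | "u = \<i>" "u' = 1" using assms by (auto simp: axes_def)
  then show "emeasure (distr (lborel \<Otimes>\<^sub>M lborel) borel (\<lambda>(y, x). of_real x * u + of_real y * u')) (box l h) = ennreal (prod ((\<bullet>) (h - l)) Basis)"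
  proof cases
    case 1
    then have "(\<lambda>(y, x). of_real x * u + of_real y * u') -` box l h \<inter> space (lborel \<Otimes>\<^sub>M lborel) = {Im l<..<Im h} \<times> {Re l<..<Re h}"
      by (auto simp: in_box_complex_iff space_pair_measure)
    then show ?thesis using lh
      by (simp add: emeasure_distr lborel.emeasure_pair_measure_Times Basis_complex_def inner_complex_def ennreal_mult mult.commute)
  next
    case 2
    then have "(\<lambda>(y, x). of_real x * u + of_real y * u') -` box l h \<inter> space (lborel \<Otimes>\<^sub>M lborel) = {Re l<..<Re h} \<times> {Im l<..<Im h}"
      by (auto simp: in_box_complex_iff space_pair_measure)
    then show ?thesis using lh
      by (simp add: emeasure_distr lborel.emeasure_pair_measure_Times Basis_complex_def inner_complex_def ennreal_mult)
  qed
qed simp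

lemma nn_integral_axes:
  assumes "axes u u'" and [measurable]: "f \<in> borel_measurable borel"
  shows "(\<integral>\<^sup>+z. f z \<partial>lborel) = (\<integral>\<^sup>+y. \<integral>\<^sup>+x. f (of_real x * u + of_real y * u') \<partial>lborel \<partial>lborel)"
proof -
  have [measurable]: "(\<lambda>(y, x). of_real x * u + of_real y * u') \<in> borel_measurable (lborel \<Otimes>\<^sub>M lborel)"
    unfolding split_beta by measurable
  have "(\<integral>\<^sup>+z. f z \<partial>lborel) = (\<integral>\<^sup>+p. f ((\<lambda>(y, x). of_real x * u + of_real y * u') p) \<partial>(lborel \<Otimes>\<^sub>M lborel))"
    by (subst lborel_axes[OF assms(1)], subst nn_integral_distr) auto
  also have "\<dots> = (\<integral>\<^sup>+y. \<integral>\<^sup>+x. f (of_real x * u + of_real y * u') \<partial>lborel \<partial>lborel)"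
    by (subst lborel.nn_integral_fst[symmetric]) (auto simp: split_beta)
  finally show ?thesis .
qed

lemma has_vector_derivative_along_axis:
  fixes V :: "complex \<Rightarrow> complex"
  assumes "(V has_derivative D) (at (of_real x * u + c))"
  shows "((\<lambda>x. V (of_real x * u + c)) has_vector_derivative D u) (at (x :: real))"
proof -
  have "((\<lambda>x::real. of_real x * u + c) has_derivative (\<lambda>h. of_real h * u)) (at x)"
    by (auto intro!: derivative_eq_intros)
  from has_derivative_compose[OF this assms]
  have "((\<lambda>x. V (of_real x * u + c)) has_derivative (\<lambda>h. D (of_real h * u))) (at x)" .
  moreover have "D (of_real h * u) = h *\<^sub>R D u" for h
    using linear_scale[OF has_derivative_linear[OF assms]] by (simp add: scaleR_conv_of_real)
  ultimately show ?thesis by (simp add: has_vector_derivative_def)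
qed

text \<open>A superlevel set of the one-dimensional maximal function of difference quotients. Both
  ends of the chord stay in the square so that only the derivative inside it enters the
  estimates.\<close>

definition steep_points :: "(complex \<Rightarrow> complex) \<Rightarrow> complex \<Rightarrow> real \<Rightarrow> real \<Rightarrow> complex set" where
  "steep_points V u M t = {z \<in> square M. \<exists>h::real. z + of_real h * u \<in> square M \<and>
     norm (V (z + of_real h * u) - V z) > t * \<bar>h\<bar>}"

text \<open>The interval inequality on each line in direction u is integrated over the transversal
  coordinate.\<close>

lemma maximal_inequality_square:
  assumes ax: "axes u u'" and V: "\<And>z. (V has_derivative D z) (at z)" and c: "continuous_on UNIV (\<lambda>z. D z u)" and t: "t > 0"
  shows "steep_points V u M t \<in> sets borel"
    and "ennreal t * emeasure lborel (steep_points V u M t)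
      \<le> 5 * L1_on (square M) (\<lambda>z. D z u)"
proof -
  have cV: "continuous_on UNIV V" using V by (meson continuous_at_imp_continuous_on has_derivative_continuous)
  \<comment> \<open>\<open>P x' z\<close> is the point with coordinate x' on the line through z in
    direction u. For fixed x' the steepness condition is open in z, so the steep points form the
    intersection of the square with an open set, which gives measurability despite the union over
    all x'.\<close>
  define P where "P x' z = of_real x' * u + of_real (Re (cnj u' * z)) * u'" for x' z
  have op: "open {z. t * \<bar>x' - Re (cnj u * z)\<bar> < norm (V (P x' z) - V z)}" for x'
    unfolding P_def
    by (intro open_Collect_less continuous_intros continuous_on_compose2[OF cV]) auto
  have eq: "steep_points V u M t = square M \<inter> (\<Union>x'\<in>{-M..M}. {z. t * \<bar>x' - Re (cnj u * z)\<bar> < norm (V (P x' z) - V z)})"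
  proof (intro set_eqI iffI)
    fix z assume "z \<in> steep_points V u M t"
    then obtain h where h: "z \<in> square M" "z + of_real h * u \<in> square M" "norm (V (z + of_real h * u) - V z) > t * \<bar>h\<bar>"
      by (auto simp: steep_points_def)
    define x' where "x' = Re (cnj u * z) + h"
    have e: "z + of_real h * u = P x' z"
      unfolding P_def x'_def using axes_decomp[OF ax, of z] by (simp add: algebra_simps)
    then have "x' \<in> {-M..M}" using h(2) unfolding e P_def axes_mem_square[OF ax] by auto
    then show "z \<in> square M \<inter> (\<Union>x'\<in>{-M..M}. {z. t * \<bar>x' - Re (cnj u * z)\<bar> < norm (V (P x' z) - V z)})"
      using h e by (auto simp: x'_def intro!: bexI[of _ x'])
  next
    fix z assume "z \<in> square M \<inter> (\<Union>x'\<in>{-M..M}. {z. t * \<bar>x' - Re (cnj u * z)\<bar> < norm (V (P x' z) - V z)})"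
    then obtain x' where x': "z \<in> square M" "x' \<in> {-M..M}" "t * \<bar>x' - Re (cnj u * z)\<bar> < norm (V (P x' z) - V z)" by auto
    define h where "h = x' - Re (cnj u * z)"
    have e: "z + of_real h * u = P x' z"
      unfolding P_def h_def using axes_decomp[OF ax, of z] by (simp add: algebra_simps)
    have "\<bar>Re (cnj u' * z)\<bar> \<le> M" using x'(1) ax by (auto simp: axes_def mem_square)
    then have "P x' z \<in> square M" unfolding P_def axes_mem_square[OF ax] using x'(2) by auto
    then show "z \<in> steep_points V u M t" using x' e by (auto simp: steep_points_def h_def intro!: exI[of _ h])
  qed
  have "open (\<Union>x'\<in>{-M..M}. {z. t * \<bar>x' - Re (cnj u * z)\<bar> < norm (V (P x' z) - V z)})"
    using op by (intro open_UN ballI)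
  then show meas [measurable]: "steep_points V u M t \<in> sets borel"
    unfolding eq by (rule sets.Int[OF square_borel borel_open])
  have [measurable]: "(\<lambda>z. D z u) \<in> borel_measurable borel" using c by (rule borel_measurable_continuous_onI)
  let ?B = "\<lambda>y. {x. of_real x * u + of_real y * u' \<in> steep_points V u M t}"
  have sec: "?B y \<in> sets borel" for y
  proof -
    have "(\<lambda>x. of_real x * u + of_real y * u') -` steep_points V u M t \<inter> space borel \<in> sets borel"
      by (rule measurable_sets[OF _ meas]) measurable
    then show ?thesis by (simp add: vimage_def)
  qed
  have "ennreal t * emeasure lborel (steep_points V u M t) = ennreal t * (\<integral>\<^sup>+z. indicator (steep_points V u M t) z \<partial>lborel)" by simp
  also have "(\<integral>\<^sup>+z. indicator (steep_points V u M t) z \<partial>lborel)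
      = (\<integral>\<^sup>+y. \<integral>\<^sup>+x. indicator (steep_points V u M t) (of_real x * u + of_real y * u') \<partial>lborel \<partial>lborel)"
    by (rule nn_integral_axes[OF ax]) measurable
  also have "\<dots> = (\<integral>\<^sup>+y. emeasure lborel (?B y) \<partial>lborel)"
  proof (rule nn_integral_cong)
    fix y
    have "(\<lambda>x. indicator (steep_points V u M t) (of_real x * u + of_real y * u') :: ennreal) = indicator (?B y)"
      by (auto simp: indicator_def)
    then show "(\<integral>\<^sup>+x. indicator (steep_points V u M t) (of_real x * u + of_real y * u') \<partial>lborel) = emeasure lborel (?B y)"
      using sec[of y] by simp
  qed
  also have "ennreal t * (\<integral>\<^sup>+y. emeasure lborel (?B y) \<partial>lborel) = (\<integral>\<^sup>+y. ennreal t * emeasure lborel (?B y) \<partial>lborel)"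
  proof (rule nn_integral_cmult[symmetric])
    have "(\<lambda>y. \<integral>\<^sup>+x. indicator (steep_points V u M t) (of_real x * u + of_real y * u') \<partial>lborel) \<in> borel_measurable lborel"
      by measurable
    moreover have "(\<integral>\<^sup>+x. indicator (steep_points V u M t) (of_real x * u + of_real y * u') \<partial>lborel) = emeasure lborel (?B y)" for y
    proof -
      have "(\<lambda>x. indicator (steep_points V u M t) (of_real x * u + of_real y * u') :: ennreal) = indicator (?B y)"
        by (auto simp: indicator_def)
      then show ?thesis using sec[of y] by simp
    qed
    ultimately show "(\<lambda>y. emeasure lborel (?B y)) \<in> borel_measurable lborel" by simp
  qed
  also have "\<dots> \<le> (\<integral>\<^sup>+y. 5 * (\<integral>\<^sup>+x. indicator (square M) (of_real x * u + of_real y * u') * ennreal (norm (D (of_real x * u + of_real y * u') u)) \<partial>lborel) \<partial>lborel)"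
  proof (rule nn_integral_mono)
    fix y :: real
    show "ennreal t * emeasure lborel (?B y) \<le> 5 * (\<integral>\<^sup>+x. indicator (square M) (of_real x * u + of_real y * u') * ennreal (norm (D (of_real x * u + of_real y * u') u)) \<partial>lborel)"
    proof (cases "\<bar>y\<bar> \<le> M")
      case True
      have "?B y \<subseteq> {x \<in> {-M..M}. \<exists>x'\<in>{-M..M}. norm (V (of_real x' * u + of_real y * u') - V (of_real x * u + of_real y * u')) > t * \<bar>x' - x\<bar>}"
      proof
        fix x assume "x \<in> ?B y"
        then obtain h where h: "of_real x * u + of_real y * u' \<in> square M" "of_real x * u + of_real y * u' + of_real h * u \<in> square M"
          "norm (V (of_real x * u + of_real y * u' + of_real h * u) - V (of_real x * u + of_real y * u')) > t * \<bar>h\<bar>"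
          by (auto simp: steep_points_def)
        have e: "of_real x * u + of_real y * u' + of_real h * u = of_real (x + h) * u + of_real y * u'" by (simp add: algebra_simps)
        have "\<bar>x\<bar> \<le> M" "\<bar>x + h\<bar> \<le> M" using h(1,2) unfolding e axes_mem_square[OF ax] by auto
        then show "x \<in> {x \<in> {-M..M}. \<exists>x'\<in>{-M..M}. norm (V (of_real x' * u + of_real y * u') - V (of_real x * u + of_real y * u')) > t * \<bar>x' - x\<bar>}"
          using h(3) unfolding e by (auto intro!: bexI[of _ "x + h"])
      qed
      then have "ennreal t * emeasure lborel (?B y) \<le> 5 * L1_on {-M..M} (\<lambda>x. D (of_real x * u + of_real y * u') u)"
        by (intro maximal_inequality_interval[OF has_vector_derivative_along_axis[OF V] _ t sec] continuous_on_compose2[OF c] continuous_intros) auto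
      also have "(\<lambda>x. indicator {-M..M} x * ennreal (norm (D (of_real x * u + of_real y * u') u)))
          = (\<lambda>x. indicator (square M) (of_real x * u + of_real y * u') * ennreal (norm (D (of_real x * u + of_real y * u') u)))"
        using True by (auto simp: indicator_def axes_mem_square[OF ax] fun_eq_iff abs_le_iff)
      finally show ?thesis .
    next
      case False
      then have "?B y = {}" by (auto simp: steep_points_def axes_mem_square[OF ax])
      then show ?thesis by simp
    qed
  qed
  also have "\<dots> = 5 * (\<integral>\<^sup>+y. (\<integral>\<^sup>+x. indicator (square M) (of_real x * u + of_real y * u') * ennreal (norm (D (of_real x * u + of_real y * u') u)) \<partial>lborel) \<partial>lborel)"
    by (rule nn_integral_cmult) measurable
  also have "(\<integral>\<^sup>+y. (\<integral>\<^sup>+x. indicator (square M) (of_real x * u + of_real y * u') * ennreal (norm (D (of_real x * u + of_real y * u') u)) \<partial>lborel) \<partial>lborel)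
      = L1_on (square M) (\<lambda>z. D z u)"
    by (rule nn_integral_axes[OF ax, symmetric]) measurable
  finally show "ennreal t * emeasure lborel (steep_points V u M t)
      \<le> 5 * L1_on (square M) (\<lambda>z. D z u)" .
qed

subsection \<open>Differentiability on large sets\<close>

definition smooth_approximation ::
  "real \<Rightarrow> (complex \<Rightarrow> complex) \<Rightarrow> (complex \<Rightarrow> complex \<Rightarrow> complex) \<Rightarrow>
   (nat \<Rightarrow> complex \<Rightarrow> complex) \<Rightarrow> (nat \<Rightarrow> complex \<Rightarrow> complex \<Rightarrow> complex) \<Rightarrow> bool" where
  "smooth_approximation M F g H D \<longleftrightarrow>
     (\<forall>k z. (H k has_derivative D k z) (at z)) \<and> (\<forall>k v. continuous_on UNIV (\<lambda>z. D k z v)) \<and>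
     (\<forall>k. \<forall>z\<in>square M. norm (H k z - F z) \<le> (1/4)^k) \<and>
     (\<forall>k. \<forall>v\<in>{1, \<i>}. L1_on (square M) (\<lambda>z. D k z v - g v z) \<le> ennreal ((1/4)^k))"

lemma smooth_approximation_exists:
  assumes F: "continuous_on UNIV F"
    and gm: "\<And>v. v \<in> {1, \<i>} \<Longrightarrow> g v \<in> borel_measurable borel"
    and gi: "\<And>v M. v \<in> {1, \<i>} \<Longrightarrow> integrable lborel (\<lambda>z. indicator (square M) z *\<^sub>R g v z)"
    and w: "\<And>v. v \<in> {1, \<i>} \<Longrightarrow> weak_derivative F v (g v)"
  obtains H D where "smooth_approximation M F g H D"
proof -
  define Q where "Q k H D \<longleftrightarrow> (\<forall>z. (H has_derivative D z) (at z)) \<and> (\<forall>v. continuous_on UNIV (\<lambda>z. D z v)) \<and>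
     (\<forall>z\<in>square M. norm (H z - F z) \<le> (1/4)^k) \<and>
     (\<forall>v\<in>{1, \<i>}. L1_on (square M) (\<lambda>z. D z v - g v z) \<le> ennreal ((1/4)^k))" for k H D
  have "\<exists>H D. Q k H D" for k
  proof -
    have e: "(1/4::real)^k > 0" by simp
    obtain s0 where s0: "s0 \<ge> 1" "\<And>s z. s \<ge> s0 \<Longrightarrow> z \<in> square M \<Longrightarrow> norm (mollify s F z - F z) \<le> (1/4)^k"
      using mollify_uniform[OF F e, of M] by blast
    obtain s1 where s1: "s1 \<ge> 1" "\<And>s. s \<ge> s1 \<Longrightarrow> (L1_on (square M) (\<lambda>z. mollify s (g 1) z - g 1 z)) \<le> ennreal ((1/4)^k)"
      using mollify_L1[OF gm gi e, of 1 M] by auto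
    obtain s2 where s2: "s2 \<ge> 1" "\<And>s. s \<ge> s2 \<Longrightarrow> (L1_on (square M) (\<lambda>z. mollify s (g \<i>) z - g \<i> z)) \<le> ennreal ((1/4)^k)"
      using mollify_L1[OF gm gi e, of \<i> M] by auto
    define s where "s = max s0 (max s1 s2)"
    have s: "s > 0" "s \<ge> s0" "s \<ge> s1" "s \<ge> s2" using s0(1) by (auto simp: s_def)
    obtain D where D: "\<And>z. (mollify s F has_derivative D z) (at z)" "\<And>v. continuous_on UNIV (\<lambda>z. D z v)"
      "\<And>v g z. weak_derivative F v g \<Longrightarrow> D z v = mollify s g z"
      using mollify_has_derivative[OF F s(1)] by metis
    have "D z 1 = mollify s (g 1) z" "D z \<i> = mollify s (g \<i>) z" for z using D(3) w by auto
    then have "\<forall>v\<in>{1, \<i>}. L1_on (square M) (\<lambda>z. D z v - g v z) \<le> ennreal ((1/4)^k)"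
      using s1(2)[OF s(3)] s2(2)[OF s(4)] by simp
    then show ?thesis using D(1,2) s0(2)[OF s(2)] unfolding Q_def by blast
  qed
  then obtain H D where "\<And>k. Q k (H k) (D k)" by metis
  then show ?thesis by (intro that[of H D]) (simp add: smooth_approximation_def Q_def)
qed

text \<open>The approximation errors in the mean are at most \<open>(1/4)^k\<close>, while the
  thresholds here are \<open>(1/2)^k\<close>; the quotient leaves measures of order
  \<open>(1/2)^k\<close>, which are summable.\<close>

definition bad_set ::
  "real \<Rightarrow> (complex \<Rightarrow> complex \<Rightarrow> complex) \<Rightarrow> (nat \<Rightarrow> complex \<Rightarrow> complex) \<Rightarrow>
   (nat \<Rightarrow> complex \<Rightarrow> complex \<Rightarrow> complex) \<Rightarrow> nat \<Rightarrow> complex set" where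
  "bad_set M g H D k = (\<Union>v\<in>{1, \<i>}. steep_points (\<lambda>z. H (Suc k) z - H k z) v M ((1/2)^k) \<union>
     {z \<in> square M. norm (D k z v - g v z) > (1/2)^k})"

definition good_set ::
  "real \<Rightarrow> (complex \<Rightarrow> complex \<Rightarrow> complex) \<Rightarrow> (nat \<Rightarrow> complex \<Rightarrow> complex) \<Rightarrow>
   (nat \<Rightarrow> complex \<Rightarrow> complex \<Rightarrow> complex) \<Rightarrow> nat \<Rightarrow> complex set" where
  "good_set M g H D j = square M - (\<Union>k\<in>{j..}. bad_set M g H D k)"

lemma ennreal_le_of_half_power:
  assumes "ennreal ((1/2)^k) * x \<le> ennreal (C * (1/4)^k)" "C \<ge> 0"
  shows "x \<le> ennreal (C * (1/2)^k)"
proof -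
  have "x = ennreal (2^k) * (ennreal ((1/2)^k) * x)"
    by (simp add: mult.assoc[symmetric] ennreal_mult[symmetric] power_mult_distrib[symmetric])
  also have "\<dots> \<le> ennreal (2^k) * ennreal (C * (1/4)^k)" by (intro mult_left_mono assms) auto
  also have "\<dots> = ennreal (2^k * (C * (1/4)^k))" using assms(2) by (simp add: ennreal_mult[symmetric])
  also have "2^k * (C * (1/4)^k) = C * (1/2)^k" by (simp add: power_mult_distrib[symmetric] mult.left_commute)
  finally show ?thesis .
qed

text \<open>For each of the two directions, consecutive approximations differ by at most
  \<open>2 * (1/4)^k\<close> in the mean, so the maximal inequality contributes
  \<open>5 * 2 * (1/2)^k\<close>; the Markov inequality contributes another \<open>(1/2)^k\<close>.
  Hence 22 = 2 * (10 + 1).\<close>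

lemma bad_set_small:
  assumes SA: "smooth_approximation M F g H D"
    and gm: "\<And>v. v \<in> {1, \<i>} \<Longrightarrow> g v \<in> borel_measurable borel"
  shows "bad_set M g H D k \<in> sets borel" "emeasure lborel (bad_set M g H D k) \<le> ennreal (22 * (1/2)^k)"
proof -
  have H: "\<And>k z. (H k has_derivative D k z) (at z)" and cD: "\<And>k v. continuous_on UNIV (\<lambda>z. D k z v)"
    and L1: "\<And>k v. v \<in> {1, \<i>} \<Longrightarrow> (L1_on (square M) (\<lambda>z. D k z v - g v z)) \<le> ennreal ((1/4)^k)"
    using SA by (auto simp: smooth_approximation_def)
  have [measurable]: "(\<lambda>z. D k z v) \<in> borel_measurable borel" for k v using cD by (rule borel_measurable_continuous_onI)
  define A where "A v = steep_points (\<lambda>z. H (Suc k) z - H k z) v M ((1/2)^k)" for v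
  define B where "B v = {z \<in> square M. norm (D k z v - g v z) > (1/2)^k}" for v
  have dH: "((\<lambda>z. H (Suc k) z - H k z) has_derivative (\<lambda>h. D (Suc k) z h - D k z h)) (at z)" for z
    by (intro has_derivative_diff H)
  have cH: "continuous_on UNIV (\<lambda>z. D (Suc k) z v - D k z v)" for v by (intro continuous_intros cD)
  have t: "(1/2::real)^k > 0" by simp
  have Am: "A v \<in> sets borel" and As: "emeasure lborel (A v) \<le> ennreal (10 * (1/2)^k)" if v: "v \<in> {1, \<i>}" for v
  proof -
    obtain u' where ax: "axes v u'" using v by (auto simp: axes_def)
    have [measurable]: "g v \<in> borel_measurable borel" by (rule gm[OF v])
    note mi = maximal_inequality_square[OF ax dH cH t, of M]
    show "A v \<in> sets borel" using mi(1) by (simp add: A_def)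
    have "ennreal ((1/2)^k) * emeasure lborel (A v) \<le> 5 * L1_on (square M) (\<lambda>z. D (Suc k) z v - D k z v)"
      using mi(2) by (simp add: A_def)
    also have "L1_on (square M) (\<lambda>z. D (Suc k) z v - D k z v)
        \<le> (\<integral>\<^sup>+z. indicator (square M) z * ennreal (norm (D (Suc k) z v - g v z)) + indicator (square M) z * ennreal (norm (D k z v - g v z)) \<partial>lborel)"
    proof (rule nn_integral_mono)
      fix z
      have "norm (D (Suc k) z v - D k z v) \<le> norm (D (Suc k) z v - g v z) + norm (D k z v - g v z)"
        using norm_triangle_ineq4[of "D (Suc k) z v - g v z" "D k z v - g v z"] by simp
      then show "indicator (square M) z * ennreal (norm (D (Suc k) z v - D k z v))
         \<le> indicator (square M) z * ennreal (norm (D (Suc k) z v - g v z)) + indicator (square M) z * ennreal (norm (D k z v - g v z))"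
        by (auto simp: indicator_def ennreal_plus[symmetric] intro: ennreal_leI simp del: ennreal_plus)
    qed
    also have "\<dots> = L1_on (square M) (\<lambda>z. D (Suc k) z v - g v z) + L1_on (square M) (\<lambda>z. D k z v - g v z)"
      by (rule nn_integral_add) measurable
    also have "\<dots> \<le> ennreal ((1/4)^Suc k) + ennreal ((1/4)^k)" by (intro add_mono L1 v)
    also have "\<dots> \<le> ennreal (2 * (1/4)^k)" by (simp add: ennreal_plus[symmetric] ennreal_leI del: ennreal_plus)
    finally have "ennreal ((1/2)^k) * emeasure lborel (A v) \<le> 5 * ennreal (2 * (1/4)^k)" by (simp add: mult_left_mono)
    also have "\<dots> = ennreal (10 * (1/4)^k)" by (simp add: ennreal_mult[symmetric] ennreal_numeral[symmetric] del: ennreal_numeral)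
    finally show "emeasure lborel (A v) \<le> ennreal (10 * (1/2)^k)" by (rule ennreal_le_of_half_power) simp
  qed
  have Bm: "B v \<in> sets borel" and Bs: "emeasure lborel (B v) \<le> ennreal (1 * (1/2)^k)" if v: "v \<in> {1, \<i>}" for v
  proof -
    have [measurable]: "g v \<in> borel_measurable borel" by (rule gm[OF v])
    show [measurable]: "B v \<in> sets borel" unfolding B_def by measurable
    have "ennreal ((1/2)^k) * emeasure lborel (B v) = (\<integral>\<^sup>+z. ennreal ((1/2)^k) * indicator (B v) z \<partial>lborel)"
      by (rule nn_integral_cmult_indicator[symmetric]) measurable
    also have "\<dots> \<le> L1_on (square M) (\<lambda>z. D k z v - g v z)"
      by (rule nn_integral_mono) (auto simp: indicator_def B_def intro!: ennreal_leI)
    also have "\<dots> \<le> ennreal (1 * (1/4)^k)" using L1[OF v] by simp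
    finally show "emeasure lborel (B v) \<le> ennreal (1 * (1/2)^k)" by (rule ennreal_le_of_half_power) simp
  qed
  have e: "bad_set M g H D k = (A 1 \<union> B 1) \<union> (A \<i> \<union> B \<i>)" by (auto simp: bad_set_def A_def B_def)
  show "bad_set M g H D k \<in> sets borel" unfolding e using Am Bm by auto
  have "emeasure lborel (bad_set M g H D k) \<le> (emeasure lborel (A 1) + emeasure lborel (B 1)) + (emeasure lborel (A \<i>) + emeasure lborel (B \<i>))"
    unfolding e using Am Bm
    by (intro order_trans[OF emeasure_subadditive] add_mono emeasure_subadditive) auto
  also have "\<dots> \<le> (ennreal (10 * (1/2)^k) + ennreal (1 * (1/2)^k)) + (ennreal (10 * (1/2)^k) + ennreal (1 * (1/2)^k))"
    by (intro add_mono As Bs) auto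
  also have "\<dots> = ennreal (22 * (1/2)^k)" by (simp add: ennreal_plus[symmetric] del: ennreal_plus)
  finally show "emeasure lborel (bad_set M g H D k) \<le> ennreal (22 * (1/2)^k)" .
qed

text \<open>Borel-Cantelli: almost every point lies in only finitely many bad sets.\<close>

lemma good_sets:
  assumes SA: "smooth_approximation M F g H D"
    and gm: "\<And>v. v \<in> {1, \<i>} \<Longrightarrow> g v \<in> borel_measurable borel"
  shows "good_set M g H D j \<in> sets borel" and "incseq (good_set M g H D)"
    and "AE z in lborel. z \<in> square M \<longrightarrow> (\<exists>j. z \<in> good_set M g H D j)"
proof -
  note bs = bad_set_small[OF SA gm]
  show "good_set M g H D j \<in> sets borel" unfolding good_set_def using bs(1) by (intro sets.Diff sets.countable_UN') auto
  show "incseq (good_set M g H D)" by (force simp: incseq_def good_set_def)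
  have "AE z in lborel. eventually (\<lambda>k. z \<in> space lborel - bad_set M g H D k) sequentially"
  proof (rule borel_cantelli_AE1)
    show "bad_set M g H D k \<in> sets lborel" for k using bs(1) by simp
    show fin: "emeasure lborel (bad_set M g H D k) < \<infinity>" for k
      using le_less_trans[OF bs(2) ennreal_less_top] by simp
    show "summable (\<lambda>k. measure lborel (bad_set M g H D k))"
    proof (rule summable_comparison_test')
      show "summable (\<lambda>k. 22 * (1/2::real)^k)" by (intro summable_mult summable_geometric) simp
      show "norm (measure lborel (bad_set M g H D k)) \<le> 22 * (1/2)^k" if "k \<ge> 0" for k
        using bs(2)[of k] fin[of k] by (simp add: emeasure_eq_ennreal_measure[OF less_imp_neq])
    qed
  qed
  then show "AE z in lborel. z \<in> square M \<longrightarrow> (\<exists>j. z \<in> good_set M g H D j)"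
    by eventually_elim (auto simp: eventually_sequentially good_set_def)
qed

text \<open>On the square, \<open>F - H k\<close> is the sum of the differences
  \<open>H (Suc i) - H i\<close> over i from k on. Seen from z each has slope at most
  \<open>(1/2)^i\<close> along both axes, and the geometric series sums to
  \<open>2 * (1/2)^k\<close>. Only z has to be good, so the other end may be the corner of a path
  between two good points.\<close>

lemma good_set_slope:
  assumes SA: "smooth_approximation M F g H D"
    and z: "z \<in> good_set M g H D j" and k: "k \<ge> j" and v: "v \<in> {1, \<i>}"
    and zh: "z + of_real h * v \<in> square M"
  shows "norm ((F (z + of_real h * v) - H k (z + of_real h * v)) - (F z - H k z)) \<le> 2 * (1/2)^k * \<bar>h\<bar>"
proof -
  define w where "w = z + of_real h * v"
  have zM: "z \<in> square M" using z by (simp add: good_set_def)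
  have step: "norm ((H (Suc i) w - H i w) - (H (Suc i) z - H i z)) \<le> (1/2)^i * \<bar>h\<bar>" if "i \<ge> j" for i
  proof -
    have "z \<notin> steep_points (\<lambda>z. H (Suc i) z - H i z) v M ((1/2)^i)"
      using z that v by (auto simp: good_set_def bad_set_def)
    then show ?thesis using zM zh unfolding steep_points_def w_def by (auto simp: not_less)
  qed
  have tele: "norm ((H (k + n) w - H k w) - (H (k + n) z - H k z)) \<le> (2 * (1/2)^k - 2 * (1/2)^(k + n)) * \<bar>h\<bar>" for n
  proof (induction n)
    case (Suc n)
    have "norm ((H (k + Suc n) w - H k w) - (H (k + Suc n) z - H k z))
        \<le> norm ((H (Suc (k + n)) w - H (k + n) w) - (H (Suc (k + n)) z - H (k + n) z))
         + norm ((H (k + n) w - H k w) - (H (k + n) z - H k z))"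
      using norm_triangle_ineq[of "(H (Suc (k + n)) w - H (k + n) w) - (H (Suc (k + n)) z - H (k + n) z)"
          "(H (k + n) w - H k w) - (H (k + n) z - H k z)"] by (simp add: algebra_simps)
    also have "\<dots> \<le> (1/2)^(k + n) * \<bar>h\<bar> + (2 * (1/2)^k - 2 * (1/2)^(k + n)) * \<bar>h\<bar>"
      using k by (intro add_mono step Suc) auto
    also have "\<dots> = (2 * (1/2)^k - 2 * (1/2)^(k + Suc n)) * \<bar>h\<bar>" by (simp add: algebra_simps)
    finally show ?case .
  qed simp
  have conv: "(\<lambda>n. H (k + n) x) \<longlonglongrightarrow> F x" if "x \<in> square M" for x
  proof -
    have "(\<lambda>n. H n x - F x) \<longlonglongrightarrow> 0"
    proof (rule Lim_null_comparison)
      show "\<forall>\<^sub>F n in sequentially. norm (H n x - F x) \<le> (1/4)^n"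
        using SA that by (auto simp: smooth_approximation_def)
      show "(\<lambda>n. (1/4::real)^n) \<longlonglongrightarrow> 0" by (intro LIMSEQ_power_zero) simp
    qed
    then have "(\<lambda>n. H n x) \<longlonglongrightarrow> F x" by (simp add: LIM_zero_iff)
    then show ?thesis using LIMSEQ_ignore_initial_segment[of "\<lambda>n. H n x" "F x" k] by (simp add: add.commute)
  qed
  have "norm ((F w - H k w) - (F z - H k z)) \<le> 2 * (1/2)^k * \<bar>h\<bar>"
  proof (rule tendsto_upperbound)
    show "(\<lambda>n. norm ((H (k + n) w - H k w) - (H (k + n) z - H k z))) \<longlonglongrightarrow> norm ((F w - H k w) - (F z - H k z))"
      using zh by (intro tendsto_intros conv zM) (simp add: w_def)
    have "(2 * (1/2)^k - 2 * (1/2)^(k + n)) * \<bar>h\<bar> \<le> 2 * (1/2)^k * \<bar>h\<bar>" for n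
      by (intro mult_right_mono) auto
    then show "\<forall>\<^sub>F n in sequentially. norm ((H (k + n) w - H k w) - (H (k + n) z - H k z)) \<le> 2 * (1/2)^k * \<bar>h\<bar>"
      using tele by (intro always_eventually allI order_trans[OF tele])
  qed simp
  then show ?thesis by (simp add: w_def)
qed

text \<open>For two points of a good set, go horizontally from the first and vertically from the second.\<close>

lemma good_set_has_derivative:
  assumes SA: "smooth_approximation M F g H D" and z0: "z0 \<in> good_set M g H D j"
  shows "(F has_derivative (\<lambda>h. of_real (Re h) * g 1 z0 + of_real (Im h) * g \<i> z0)) (at z0 within good_set M g H D j)"
  unfolding has_derivative_within_alt
proof (intro conjI allI impI)
  show "bounded_linear (\<lambda>h. of_real (Re h) * g 1 z0 + of_real (Im h) * g \<i> z0)"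
    by (intro bounded_linear_add bounded_linear_compose[OF bounded_linear_mult_left]
        bounded_linear_compose[OF bounded_linear_of_real] bounded_linear_Re bounded_linear_Im)
  fix e :: real assume e: "e > 0"
  have H: "\<And>k z. (H k has_derivative D k z) (at z)" using SA by (auto simp: smooth_approximation_def)
  \<comment> \<open>The approximation errors add up to \<open>6 * (1/2)^k\<close>: two units for
    each leg of the path and two for replacing the derivative of \<open>H k\<close> at
    \<open>z0\<close> by g. The other half of e is left for the differentiability of
    \<open>H k\<close>.\<close>
  obtain k0 where "(1/2::real)^k0 < e / 12" using real_arch_pow_inv[of "e / 12" "1/2"] e by auto
  define k where "k = max j k0"
  have k: "k \<ge> j" "6 * (1/2)^k \<le> e / 2"
  proof -
    have "(1/2::real)^k \<le> (1/2)^k0" by (rule power_decreasing) (auto simp: k_def)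
    then show "6 * (1/2)^k \<le> e / 2" using \<open>(1/2::real)^k0 < e / 12\<close> by linarith
  qed (simp add: k_def)
  obtain d where d: "d > 0" "\<And>y. norm (y - z0) < d \<Longrightarrow> norm (H k y - H k z0 - D k z0 (y - z0)) \<le> e / 2 * norm (y - z0)"
    using conjunct2[OF H[of k z0, unfolded has_derivative_within_alt], rule_format, OF half_gt_zero[OF e]]
    by (metis UNIV_I)
  have "norm (F z - F z0 - (of_real (Re (z - z0)) * g 1 z0 + of_real (Im (z - z0)) * g \<i> z0)) \<le> e * norm (z - z0)"
    if z: "z \<in> good_set M g H D j" "norm (z - z0) < d" for z
  proof -
    define h w where "h = z - z0" and "w = Complex (Re z) (Im z0)"
    define G where "G x = F x - H k x" for x
    have w1: "w = z0 + of_real (Re h) * 1" and w2: "w = z + of_real (- Im h) * \<i>"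
      by (auto simp: w_def h_def complex_eq_iff)
    have wM: "w \<in> square M" using z(1) z0 by (auto simp: good_set_def mem_square w_def)
    have 1: "norm (G w - G z0) \<le> 2 * (1/2)^k * \<bar>Re h\<bar>"
      using good_set_slope[OF SA z0 k(1), of 1 "Re h"] wM unfolding w1 G_def by simp
    have 2: "norm (G w - G z) \<le> 2 * (1/2)^k * \<bar>Im h\<bar>"
      using good_set_slope[OF SA z(1) k(1), of \<i> "- Im h"] wM unfolding w2 G_def by simp
    have slope: "2 * (1/2)^k * \<bar>Re h\<bar> \<le> 2 * (1/2)^k * norm h" "2 * (1/2)^k * \<bar>Im h\<bar> \<le> 2 * (1/2)^k * norm h"
      by (intro mult_left_mono abs_Re_le_cmod abs_Im_le_cmod; simp)+
    have "norm (G z - G z0) \<le> norm (G w - G z0) + norm (G w - G z)"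
      using norm_triangle_ineq4[of "G w - G z0" "G w - G z"] by simp
    then have 3: "norm (G z - G z0) \<le> 4 * (1/2)^k * norm h" using 1 2 slope by linarith
    have g1: "norm (D k z0 1 - g 1 z0) \<le> (1/2)^k" "norm (D k z0 \<i> - g \<i> z0) \<le> (1/2)^k"
      using z0 k(1) by (auto simp: good_set_def bad_set_def not_less)
    have "h = Re h *\<^sub>R 1 + Im h *\<^sub>R \<i>" by (simp add: complex_eq_iff)
    then have "D k z0 h = D k z0 (Re h *\<^sub>R 1 + Im h *\<^sub>R \<i>)" by (rule arg_cong)
    also have "\<dots> = Re h *\<^sub>R D k z0 1 + Im h *\<^sub>R D k z0 \<i>"
      using has_derivative_linear[OF H[of k z0]] by (simp only: linear_add linear_scale)
    also have "\<dots> = of_real (Re h) * D k z0 1 + of_real (Im h) * D k z0 \<i>" by (simp only: scaleR_conv_of_real)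
    finally have "D k z0 h - (of_real (Re h) * g 1 z0 + of_real (Im h) * g \<i> z0)
        = of_real (Re h) * (D k z0 1 - g 1 z0) + of_real (Im h) * (D k z0 \<i> - g \<i> z0)" by (simp add: algebra_simps)
    then have "norm (D k z0 h - (of_real (Re h) * g 1 z0 + of_real (Im h) * g \<i> z0))
        \<le> \<bar>Re h\<bar> * norm (D k z0 1 - g 1 z0) + \<bar>Im h\<bar> * norm (D k z0 \<i> - g \<i> z0)"
      by (metis norm_triangle_ineq norm_mult norm_of_real)
    also have "\<dots> \<le> norm h * (1/2)^k + norm h * (1/2)^k"
      by (intro add_mono mult_mono abs_Re_le_cmod abs_Im_le_cmod g1) auto
    finally have 4: "norm (D k z0 h - (of_real (Re h) * g 1 z0 + of_real (Im h) * g \<i> z0)) \<le> 2 * (1/2)^k * norm h" by (simp add: mult_ac)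
    have 5: "norm (H k z - H k z0 - D k z0 h) \<le> e / 2 * norm h" using d(2)[OF z(2)] by (simp add: h_def)
    have "F z - F z0 - (of_real (Re h) * g 1 z0 + of_real (Im h) * g \<i> z0)
       = (G z - G z0) + ((H k z - H k z0 - D k z0 h) + (D k z0 h - (of_real (Re h) * g 1 z0 + of_real (Im h) * g \<i> z0)))"
      by (simp add: G_def)
    then have "norm (F z - F z0 - (of_real (Re h) * g 1 z0 + of_real (Im h) * g \<i> z0))
       \<le> norm (G z - G z0) + (norm (H k z - H k z0 - D k z0 h) + norm (D k z0 h - (of_real (Re h) * g 1 z0 + of_real (Im h) * g \<i> z0)))"
      by (metis norm_triangle_ineq order_trans add_left_mono)
    also have "\<dots> \<le> 4 * (1/2)^k * norm h + (e / 2 * norm h + 2 * (1/2)^k * norm h)"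
      by (intro add_mono 3 4 5)
    also have "\<dots> = (6 * (1/2)^k + e / 2) * norm h" by (simp add: algebra_simps)
    also have "\<dots> \<le> e * norm h" using k(2) by (intro mult_right_mono) auto
    finally show ?thesis by (simp add: h_def)
  qed
  then show "\<exists>d>0. \<forall>z\<in>good_set M g H D j. norm (z - z0) < d \<longrightarrow>
      norm (F z - F z0 - (of_real (Re (z - z0)) * g 1 z0 + of_real (Im (z - z0)) * g \<i> z0)) \<le> e * norm (z - z0)"
    using d(1) by blast
qed

subsection \<open>The area inequality\<close>

text \<open>The change of variables theorem speaks of determinants over \<open>real^2\<close>; this
  map and its inverse carry it over to the complex plane.\<close>

definition vec_of_complex :: "complex \<Rightarrow> real^2" where
  "vec_of_complex z = (\<chi> i. if i = 1 then Re z else Im z)"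

definition complex_of_vec :: "real^2 \<Rightarrow> complex" where
  "complex_of_vec v = Complex (v $ 1) (v $ 2)"

lemma vec_of_complex_inverse [simp]: "complex_of_vec (vec_of_complex z) = z" "vec_of_complex (complex_of_vec v) = v"
  by (auto simp: complex_of_vec_def vec_of_complex_def vec_eq_iff exhaust_2 complex_eq_iff) (metis exhaust_2)

lemma bounded_linear_vec_of_complex: "bounded_linear vec_of_complex"
proof -
  have "linear vec_of_complex" by (rule linearI) (auto simp: vec_of_complex_def vec_eq_iff)
  then show ?thesis by (rule linear_conv_bounded_linear[THEN iffD1])
qed

lemma bounded_linear_complex_of_vec: "bounded_linear complex_of_vec"
proof -
  have "linear complex_of_vec" by (rule linearI) (auto simp: complex_of_vec_def complex_eq_iff)
  then show ?thesis by (rule linear_conv_bounded_linear[THEN iffD1])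
qed

lemma complex_of_vec_measurable [measurable]: "complex_of_vec \<in> borel_measurable borel"
  using bounded_linear_complex_of_vec by (intro borel_measurable_continuous_onI linear_continuous_on)

lemma lborel_complex_of_vec: "lborel = distr lborel borel complex_of_vec"
proof (rule lborel_eqI)
  fix l h :: complex assume H: "\<And>b. b \<in> Basis \<Longrightarrow> l \<bullet> b \<le> h \<bullet> b"
  have lh: "Re l \<le> Re h" "Im l \<le> Im h" using H[of 1] H[of \<i>] by (auto simp: Basis_complex_def)
  have e: "complex_of_vec -` box l h = box (vec_of_complex l) (vec_of_complex h)"
    by (auto simp: in_box_complex_iff mem_box_cart complex_of_vec_def vec_of_complex_def forall_2)
  have "emeasure lborel (box (vec_of_complex l) (vec_of_complex h)) = ennreal (\<Prod>b\<in>Basis. (vec_of_complex h - vec_of_complex l) \<bullet> b)"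
    using lh by (intro emeasure_lborel_box) (auto simp: Basis_vec_def inner_axis vec_of_complex_def)
  also have "(\<Prod>b\<in>Basis. (vec_of_complex h - vec_of_complex l) \<bullet> b) = (Re h - Re l) * (Im h - Im l)"
  proof -
    have b: "(Basis :: (real^2) set) = {axis 1 1, axis 2 1}" by (auto simp: Basis_vec_def exhaust_2) (metis exhaust_2)
    show ?thesis unfolding b by (subst prod.insert) (auto simp: inner_axis axis_eq_axis vec_of_complex_def)
  qed
  finally show "emeasure (distr lborel borel complex_of_vec) (box l h) = ennreal (prod ((\<bullet>) (h - l)) Basis)"
    by (simp add: emeasure_distr e Basis_complex_def)
qed simp

text \<open>Change of variables for injective maps differentiable relative to a measurable set; no
  neighbourhood of S is involved. The Borel set T stands in for the image, whose measurability is
  obtained only in the sense of Lebesgue.\<close>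

lemma area_inequality:
  fixes F a b :: "complex \<Rightarrow> complex"
  assumes S: "S \<in> sets borel" and inj: "inj_on F S"
    and am: "a \<in> borel_measurable borel" and bm: "b \<in> borel_measurable borel"
    and der: "\<And>z. z \<in> S \<Longrightarrow> (F has_derivative (\<lambda>h. of_real (Re h) * a z + of_real (Im h) * b z)) (at z within S)"
    and T: "T \<in> sets borel" "F ` S \<subseteq> T"
  shows "(\<integral>\<^sup>+z. indicator S z * ennreal \<bar>Re (a z) * Im (b z) - Im (a z) * Re (b z)\<bar> \<partial>lborel) \<le> emeasure lborel T"
proof (cases "emeasure lborel T = \<infinity>")
  case False
  note [measurable] = S am bm T(1)
  define S' where "S' = complex_of_vec -` S"
  define T' where "T' = complex_of_vec -` T"
  define f where "f x = vec_of_complex (F (complex_of_vec x))" for x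
  define f' where "f' x h = vec_of_complex (of_real (h $ 1) * a (complex_of_vec x) + of_real (h $ 2) * b (complex_of_vec x))" for x and h :: "real^2"
  define J where "J z = \<bar>Re (a z) * Im (b z) - Im (a z) * Re (b z)\<bar>" for z
  have S'm [measurable]: "S' \<in> sets borel" using measurable_sets[OF complex_of_vec_measurable S] by (simp add: S'_def)
  have T'm [measurable]: "T' \<in> sets borel" using measurable_sets[OF complex_of_vec_measurable T(1)] by (simp add: T'_def)
  have cS': "complex_of_vec ` S' \<subseteq> S" by (auto simp: S'_def)
  have det: "\<bar>det (matrix (f' x))\<bar> = J (complex_of_vec x)" for x
    by (simp add: det_2 matrix_def f'_def J_def vec_of_complex_def axis_def mult.commute)
  have df: "(f has_derivative f' x) (at x within S')" if "x \<in> S'" for x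
  proof -
    have "(complex_of_vec has_derivative complex_of_vec) (at x within S')"
      by (rule bounded_linear_imp_has_derivative[OF bounded_linear_complex_of_vec])
    moreover have "(F has_derivative (\<lambda>h. of_real (Re h) * a (complex_of_vec x) + of_real (Im h) * b (complex_of_vec x)))
        (at (complex_of_vec x) within complex_of_vec ` S')"
      using der[of "complex_of_vec x"] that cS' by (auto intro: has_derivative_subset)
    ultimately have "((\<lambda>x. F (complex_of_vec x)) has_derivative
       (\<lambda>h. of_real (Re (complex_of_vec h)) * a (complex_of_vec x) + of_real (Im (complex_of_vec h)) * b (complex_of_vec x))) (at x within S')"
      by (rule has_derivative_in_compose)
    from bounded_linear.has_derivative[OF bounded_linear_vec_of_complex this]
    show ?thesis unfolding f_def[abs_def] f'_def[abs_def] by (simp add: complex_of_vec_def)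
  qed
  have injf: "inj_on f S'"
  proof (rule inj_onI)
    fix x y assume xy: "x \<in> S'" "y \<in> S'" "f x = f y"
    then have "F (complex_of_vec x) = F (complex_of_vec y)" by (metis f_def vec_of_complex_inverse(1))
    then have "complex_of_vec x = complex_of_vec y" using inj xy by (auto simp: S'_def dest: inj_onD)
    then show "x = y" by (metis vec_of_complex_inverse(2))
  qed
  have ET: "emeasure lborel T = emeasure lborel T'"
    by (subst lborel_complex_of_vec) (simp add: emeasure_distr T'_def)
  have S'l: "S' \<in> sets lebesgue" using S'm by (intro sets_completionI_sets) simp
  have T'l: "T' \<in> lmeasurable"
    using False ET T'm by (intro fmeasurableI) (auto simp: less_top)
  have sub: "f ` S' \<subseteq> T'" using T(2) by (auto simp: f_def S'_def T'_def)
  have "f ` S' \<in> sets lebesgue"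
    by (rule differentiable_image_in_sets_lebesgue[OF S'l]) (use df in \<open>auto simp: differentiable_on_def differentiable_def\<close>)
  then have fS: "f ` S' \<in> lmeasurable" by (rule fmeasurableI2[OF T'l sub])
  then have "((\<lambda>x. \<bar>det (matrix (f' x))\<bar>) has_integral (measure lebesgue (f ` S'))) S'"
    using has_measure_differentiable_image[OF S'l df injf] by blast
  then have hi: "((\<lambda>x. J (complex_of_vec x)) has_integral (measure lebesgue (f ` S'))) S'" by (simp add: det)
  have hi': "((\<lambda>x. indicator S' x * J (complex_of_vec x)) has_integral (measure lebesgue (f ` S'))) UNIV"
  proof -
    have "(\<lambda>x. indicator S' x * J (complex_of_vec x)) = (\<lambda>x. if x \<in> S' then J (complex_of_vec x) else 0)"
      by (auto simp: indicator_def)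
    then show ?thesis using hi by (simp only: has_integral_restrict_UNIV)
  qed
  have [measurable]: "J \<in> borel_measurable borel" unfolding J_def[abs_def] by measurable
  have "(\<integral>\<^sup>+z. indicator S z * ennreal (J z) \<partial>lborel) = (\<integral>\<^sup>+x. indicator S (complex_of_vec x) * ennreal (J (complex_of_vec x)) \<partial>lborel)"
    by (subst lborel_complex_of_vec, subst nn_integral_distr) measurable
  also have "\<dots> = (\<integral>\<^sup>+x. ennreal (indicator S' x * J (complex_of_vec x)) \<partial>lborel)"
    by (intro nn_integral_cong) (auto simp: indicator_def S'_def)
  also have "\<dots> = ennreal (measure lebesgue (f ` S'))"
    by (rule nn_integral_has_integral_lborel[OF _ _ hi']) (measurable, simp add: J_def)
  also have "\<dots> \<le> ennreal (measure lebesgue T')"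
    by (intro ennreal_leI measure_mono_fmeasurable sub T'l) (use fS in auto)
  also have "\<dots> = emeasure lborel T"
    using False T'm by (simp add: ET emeasure_eq_ennreal_measure)
  finally show ?thesis by (simp add: J_def)
qed simp

subsection \<open>The length-area inequality\<close>

text \<open>The argument of \<open>smoothstep\<close> runs from 0 to 1 as the distance from a grows
  from t to \<open>2 * t\<close>. The squared norm makes differentiability at a automatic.\<close>

definition cutoff :: "complex \<Rightarrow> real \<Rightarrow> complex \<Rightarrow> real" where
  "cutoff a t w = smoothstep (\<lambda>n. if n \<ge> 1 then 1 else 0) (((norm (w - a))\<^sup>2 - t\<^sup>2) / (3 * t\<^sup>2))"

text \<open>The scalar that multiplies \<open>w - a\<close> in the gradient of the cutoff.\<close>

definition cutoff_coeff :: "complex \<Rightarrow> real \<Rightarrow> complex \<Rightarrow> real" where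
  "cutoff_coeff a t w = smoothstep' (\<lambda>n. if n \<ge> 1 then 1 else 0) (((norm (w - a))\<^sup>2 - t\<^sup>2) / (3 * t\<^sup>2)) * (2 / (3 * t\<^sup>2))"

lemma cutoff_values:
  assumes "t > 0"
  shows "norm (w - a) \<le> t \<Longrightarrow> cutoff a t w = 0" "norm (w - a) \<ge> 2 * t \<Longrightarrow> cutoff a t w = 1"
proof -
  assume "norm (w - a) \<le> t"
  then have "(norm (w - a))\<^sup>2 \<le> t\<^sup>2" by (intro power_mono) auto
  then have y: "((norm (w - a))\<^sup>2 - t\<^sup>2) / (3 * t\<^sup>2) \<le> 0" by (simp add: divide_nonpos_nonneg)
  define y where "y = ((norm (w - a))\<^sup>2 - t\<^sup>2) / (3 * t\<^sup>2)"
  have "y < 0 \<or> y = 0" using y unfolding y_def[symmetric] by linarith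
  then show "cutoff a t w = 0" unfolding cutoff_def y_def[symmetric] by (auto simp: smoothstep_def)
next
  assume "norm (w - a) \<ge> 2 * t"
  then have "(norm (w - a))\<^sup>2 \<ge> (2 * t)\<^sup>2" using assms by (intro power_mono) auto
  then have y: "((norm (w - a))\<^sup>2 - t\<^sup>2) / (3 * t\<^sup>2) \<ge> 1" using assms by (simp add: power_mult_distrib)
  then show "cutoff a t w = 1" unfolding cutoff_def by (simp add: smoothstep_def)
qed

lemma cutoff_has_derivative:
  "(cutoff a t has_derivative (\<lambda>h. cutoff_coeff a t w * ((w - a) \<bullet> h))) (at w)"
proof -
  have "((\<lambda>w. (w - a) \<bullet> (w - a) - t\<^sup>2) has_derivative (\<lambda>h. 2 * ((w - a) \<bullet> h))) (at w)"
    by (auto intro!: derivative_eq_intros simp: inner_commute)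
  from has_derivative_mult_right[OF this, of "1 / (3 * t\<^sup>2)"]
  have "((\<lambda>w. ((w - a) \<bullet> (w - a) - t\<^sup>2) / (3 * t\<^sup>2)) has_derivative (\<lambda>h. (2 / (3 * t\<^sup>2)) * ((w - a) \<bullet> h))) (at w)"
    by simp
  from has_derivative_compose[OF this smoothstep_deriv[unfolded has_field_derivative_def]]
  show ?thesis
    by (simp add: cutoff_def[abs_def] cutoff_coeff_def power2_norm_eq_inner mult.assoc)
qed

lemma continuous_cutoff_coeff: "continuous_on UNIV (cutoff_coeff a t)"
proof -
  have "continuous_on UNIV (\<lambda>w. ((norm (w - a))\<^sup>2 - t\<^sup>2) / (3 * t\<^sup>2))"
    unfolding divide_inverse by (intro continuous_intros)
  from continuous_on_compose2[OF smoothstep'_cont this]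
  show ?thesis unfolding cutoff_coeff_def by (intro continuous_on_mult continuous_on_const) auto
qed

lemma cutoff_coeff_bound:
  assumes t: "t > 0"
  shows "\<bar>cutoff_coeff a t w * ((w - a) \<bullet> h)\<bar> \<le> 8 / t * indicator {w. t < norm (w - a) \<and> norm (w - a) < 2 * t} w * norm h"
proof (cases "t < norm (w - a) \<and> norm (w - a) < 2 * t")
  case True
  define c where "c = smoothstep' (\<lambda>n. if n \<ge> 1 then 1 else 0) (((norm (w - a))\<^sup>2 - t\<^sup>2) / (3 * t\<^sup>2))"
  have c: "\<bar>c\<bar> \<le> 6" unfolding c_def
    using smoothstep'_bound[of "\<lambda>n. if n \<ge> 1 then 1 else 0" 1] by simp
  have "\<bar>cutoff_coeff a t w * ((w - a) \<bullet> h)\<bar> = \<bar>c\<bar> * (2 / (3 * t\<^sup>2)) * \<bar>(w - a) \<bullet> h\<bar>"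
    by (simp add: cutoff_coeff_def c_def abs_mult)
  \<comment> \<open>The slope of the interpolation is at most 6 and the norm of \<open>w - a\<close>
    is below \<open>2 * t\<close> in the ring; the product of the constants is
    \<open>8 / t\<close>.\<close>
  also have "\<dots> \<le> 6 * (2 / (3 * t\<^sup>2)) * (2 * t * norm h)"
  proof (intro mult_mono)
    have "\<bar>(w - a) \<bullet> h\<bar> \<le> norm (w - a) * norm h" by (rule Cauchy_Schwarz_ineq2)
    also have "\<dots> \<le> 2 * t * norm h" using True by (intro mult_right_mono) auto
    finally show "\<bar>(w - a) \<bullet> h\<bar> \<le> 2 * t * norm h" .
  qed (use c in auto)
  also have "\<dots> = 8 / t * norm h" using t by (simp add: power2_eq_square)
  finally show ?thesis using True by simp
next
  case False
  define y where "y = ((norm (w - a))\<^sup>2 - t\<^sup>2) / (3 * t\<^sup>2)"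
  have "y \<le> 0 \<or> y \<ge> 1"
  proof (cases "norm (w - a) \<le> t")
    case True
    then have "(norm (w - a))\<^sup>2 \<le> t\<^sup>2" by (intro power_mono) auto
    then show ?thesis by (simp add: y_def divide_nonpos_nonneg)
  next
    case False
    then have "(norm (w - a))\<^sup>2 \<ge> (2 * t)\<^sup>2" using assms \<open>\<not> (t < norm (w - a) \<and> norm (w - a) < 2 * t)\<close> by (intro power_mono) auto
    then show ?thesis using t by (simp add: y_def power_mult_distrib)
  qed
  then have "y < 0 \<or> y = 0 \<or> y \<ge> 1" by linarith
  then have "smoothstep' (\<lambda>n. if n \<ge> 1 then 1 else 0) y = 0" by (auto simp: smoothstep'_def)
  then show ?thesis using False by (simp add: cutoff_coeff_def y_def)
qed

text \<open>The fundamental theorem of calculus for the cutoff of H along a segment. The gradient of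
  the cutoff lives in the ring, so only the part of the segment that H maps into the ring
  counts.\<close>

lemma cutoff_oscillation:
  fixes H :: "complex \<Rightarrow> complex"
  assumes H: "\<And>z. (H has_derivative D z) (at z)" and cD: "continuous_on UNIV (\<lambda>z. D z u)" and t: "t > 0"
    and x: "x1 \<in> {-s..s}" "x2 \<in> {-s..s}"
  shows "ennreal \<bar>cutoff a t (H (of_real x1 * u + c)) - cutoff a t (H (of_real x2 * u + c))\<bar>
     \<le> (\<integral>\<^sup>+x. indicator {-s..s} x * ennreal (8 / t * indicator {w. t < norm (w - a) \<and> norm (w - a) < 2 * t} (H (of_real x * u + c)) * norm (D (of_real x * u + c) u)) \<partial>lborel)"
  using x
proof (induction x1 x2 rule: linorder_wlog)
  case (le x1 x2)
  have cH: "continuous_on UNIV H" using H by (meson continuous_at_imp_continuous_on has_derivative_continuous)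
  define \<gamma> where "\<gamma> x = of_real x * u + c" for x :: real
  have c\<gamma>: "continuous_on S \<gamma>" for S unfolding \<gamma>_def[abs_def] by (intro continuous_intros)
  define v where "v x = complex_of_real (cutoff a t (H (\<gamma> x)))" for x
  define v' where "v' x = complex_of_real (cutoff_coeff a t (H (\<gamma> x)) * ((H (\<gamma> x) - a) \<bullet> D (\<gamma> x) u))" for x
  have dv: "(v has_vector_derivative v' x) (at x)" for x
  proof -
    have "((\<lambda>x. H (\<gamma> x)) has_derivative (\<lambda>h. h *\<^sub>R D (\<gamma> x) u)) (at x)"
      using has_vector_derivative_along_axis[OF H, of u c x] unfolding \<gamma>_def has_vector_derivative_def .
    from has_derivative_of_real[OF has_derivative_compose[OF this cutoff_has_derivative], where 'a = complex]
    have "(v has_derivative (\<lambda>h. complex_of_real (cutoff_coeff a t (H (\<gamma> x)) * (h * ((H (\<gamma> x) - a) \<bullet> D (\<gamma> x) u))))) (at x)"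
      unfolding v_def[abs_def] by (simp only: inner_scaleR_right)
    moreover have "(\<lambda>h. complex_of_real (cutoff_coeff a t (H (\<gamma> x)) * (h * ((H (\<gamma> x) - a) \<bullet> D (\<gamma> x) u)))) = (\<lambda>h. h *\<^sub>R v' x)"
      by (auto simp: v'_def scaleR_conv_of_real)
    ultimately show ?thesis by (simp add: has_vector_derivative_def)
  qed
  have cv': "continuous_on UNIV v'"
  proof -
    have 1: "continuous_on UNIV (\<lambda>x. H (\<gamma> x))" by (rule continuous_on_compose2[OF cH c\<gamma>]) simp
    have 2: "continuous_on UNIV (\<lambda>x. D (\<gamma> x) u)" by (rule continuous_on_compose2[OF cD c\<gamma>]) simp
    have 3: "continuous_on UNIV (\<lambda>x. cutoff_coeff a t (H (\<gamma> x)))" by (rule continuous_on_compose2[OF continuous_cutoff_coeff 1]) simp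
    show ?thesis unfolding v'_def[abs_def]
      by (intro continuous_on_of_real continuous_on_mult continuous_on_inner continuous_on_diff continuous_on_const 1 2 3)
  qed
  have "ennreal (norm (v x2 - v x1)) \<le> L1_on {x1..x2} v'"
    by (rule norm_diff_le_nn_integral[OF le(1) dv continuous_on_subset[OF cv']]) auto
  also have "\<dots> \<le> (\<integral>\<^sup>+x. indicator {-s..s} x * ennreal (8 / t * indicator {w. t < norm (w - a) \<and> norm (w - a) < 2 * t} (H (\<gamma> x)) * norm (D (\<gamma> x) u)) \<partial>lborel)"
  proof (intro nn_integral_mono mult_mono)
    fix x
    show "ennreal (norm (v' x)) \<le> ennreal (8 / t * indicator {w. t < norm (w - a) \<and> norm (w - a) < 2 * t} (H (\<gamma> x)) * norm (D (\<gamma> x) u))"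
      unfolding v'_def norm_of_real by (intro ennreal_leI cutoff_coeff_bound t)
    show "(indicator {x1..x2} x :: ennreal) \<le> indicator {-s..s} x" using le by (auto simp: indicator_def)
  qed auto
  also have "norm (v x2 - v x1) = \<bar>cutoff a t (H (\<gamma> x1)) - cutoff a t (H (\<gamma> x2))\<bar>"
    unfolding v_def of_real_diff[symmetric] norm_of_real by (rule abs_minus_commute)
  finally show ?case by (simp add: \<gamma>_def)
next
  case (sym x1 x2)
  then show ?case by (simp add: abs_minus_commute)
qed

text \<open>Every boundary point of the square is joined to the corner \<open>c0\<close> by at most
  two sides, so f differs there from \<open>f c0\<close> by at most the sum of the four side bounds;
  going from p to q through \<open>c0\<close> doubles this.\<close>

lemma box_loop_oscillation:
  fixes f :: "complex \<Rightarrow> real"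
  assumes hor: "\<And>y x1 x2. y \<in> {s, -s} \<Longrightarrow> x1 \<in> {-s..s} \<Longrightarrow> x2 \<in> {-s..s} \<Longrightarrow>
      ennreal \<bar>f (of_real x1 * 1 + (z0 + of_real y * \<i>)) - f (of_real x2 * 1 + (z0 + of_real y * \<i>))\<bar> \<le> Lh y"
    and ver: "\<And>y x1 x2. y \<in> {s, -s} \<Longrightarrow> x1 \<in> {-s..s} \<Longrightarrow> x2 \<in> {-s..s} \<Longrightarrow>
      ennreal \<bar>f (of_real x1 * \<i> + (z0 + of_real y * 1)) - f (of_real x2 * \<i> + (z0 + of_real y * 1))\<bar> \<le> Lv y"
    and p: "max \<bar>Re (p - z0)\<bar> \<bar>Im (p - z0)\<bar> = s" and q: "max \<bar>Re (q - z0)\<bar> \<bar>Im (q - z0)\<bar> = s"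
  shows "ennreal \<bar>f p - f q\<bar> \<le> 2 * ((Lh s + Lh (-s)) + (Lv s + Lv (-s)))"
proof -
  have s: "s \<ge> 0" using p by linarith
  define c0 where "c0 = z0 + Complex s s"
  have tri: "ennreal \<bar>x - z\<bar> \<le> A + B" if "ennreal \<bar>x - y\<bar> \<le> A" "ennreal \<bar>y - z\<bar> \<le> B" for x y z :: real and A B
  proof -
    have "ennreal \<bar>x - z\<bar> \<le> ennreal (\<bar>x - y\<bar> + \<bar>y - z\<bar>)" by (intro ennreal_leI) simp
    also have "\<dots> \<le> A + B" using that by (simp add: ennreal_plus add_mono)
    finally show ?thesis .
  qed
  let ?S = "(Lh s + Lh (-s)) + (Lv s + Lv (-s))"
  have corner: "ennreal \<bar>f w - f c0\<bar> \<le> ?S" if w: "max \<bar>Re (w - z0)\<bar> \<bar>Im (w - z0)\<bar> = s" for w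
  proof -
    define x y where "x = Re (w - z0)" and "y = Im (w - z0)"
    have xy: "x \<in> {-s..s}" "y \<in> {-s..s}" "y = s \<or> y = -s \<or> x = s \<or> x = -s"
      using w unfolding x_def[symmetric] y_def[symmetric] by (auto simp: max_def abs_if split: if_splits)
    have wh: "w = of_real x * 1 + (z0 + of_real y * \<i>)" and wv: "w = of_real y * \<i> + (z0 + of_real x * 1)"
      by (auto simp: x_def y_def complex_eq_iff)
    have c1: "of_real s * 1 + (z0 + of_real s * \<i>) = c0" and c2: "of_real s * \<i> + (z0 + of_real s * 1) = c0"
      by (auto simp: c0_def complex_eq_iff)
    have c3: "of_real s * 1 + (z0 + of_real (-s) * \<i>) = of_real (-s) * \<i> + (z0 + of_real s * 1)"
      and c4: "of_real s * \<i> + (z0 + of_real (-s) * 1) = of_real (-s) * 1 + (z0 + of_real s * \<i>)"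
      by (auto simp: complex_eq_iff)
    have ss: "s \<in> {-s..s}" "-s \<in> {-s..s}" using s by auto
    have "ennreal \<bar>f w - f c0\<bar> \<le> Lh s" if "y = s"
      using hor[of s x s] xy ss that c1 wh by simp
    moreover have "ennreal \<bar>f w - f c0\<bar> \<le> Lv s" if "x = s"
      using ver[of s y s] xy ss that c2 wv by simp
    moreover have "ennreal \<bar>f w - f c0\<bar> \<le> Lh (-s) + Lv s" if "y = -s"
    proof (rule tri)
      show "ennreal \<bar>f w - f (of_real s * 1 + (z0 + of_real (-s) * \<i>))\<bar> \<le> Lh (-s)"
        using hor[of "-s" x s] xy ss that wh by simp
      show "ennreal \<bar>f (of_real s * 1 + (z0 + of_real (-s) * \<i>)) - f c0\<bar> \<le> Lv s"
        unfolding c3 using ver[of s "-s" s] ss c2 by simp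
    qed
    moreover have "ennreal \<bar>f w - f c0\<bar> \<le> Lv (-s) + Lh s" if "x = -s"
    proof (rule tri)
      show "ennreal \<bar>f w - f (of_real s * \<i> + (z0 + of_real (-s) * 1))\<bar> \<le> Lv (-s)"
        using ver[of "-s" y s] xy ss that wv by simp
      show "ennreal \<bar>f (of_real s * \<i> + (z0 + of_real (-s) * 1)) - f c0\<bar> \<le> Lh s"
        unfolding c4 using hor[of s "-s" s] ss c1 by simp
    qed
    moreover have "Lh s \<le> ?S" "Lv s \<le> ?S" "Lh (-s) + Lv s \<le> ?S" "Lv (-s) + Lh s \<le> ?S"
      by (simp_all add: add.commute add.left_commute add_increasing add_increasing2)
    ultimately show ?thesis using xy(3) by (metis order_trans)
  qed
  have "ennreal \<bar>f c0 - f q\<bar> \<le> ?S" using corner[OF q] by (simp only: abs_minus_commute)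
  from tri[OF corner[OF p] this] show ?thesis by (simp only: mult_2)
qed

text \<open>Fubini, after each side is lengthened to the full width of the largest square so that
  the domain of integration becomes a rectangle inside it. The sign \<open>\<sigma>\<close> selects
  one of the two parallel sides.\<close>

lemma nn_integral_half_strip:
  assumes ax: "axes u u'" and [measurable]: "G \<in> borel_measurable borel" and s: "0 \<le> s0" and \<sigma>: "\<sigma> \<in> {1, -1 :: real}"
  shows "(\<integral>\<^sup>+y. indicator {s0<..<s1} y * (\<integral>\<^sup>+x. indicator {-s1..s1} x * G (of_real x * u + (z0 + of_real (\<sigma> * y) * u')) \<partial>lborel) \<partial>lborel)
     \<le> (\<integral>\<^sup>+z. indicator (square s1) (z - z0) * G z \<partial>lborel)"
proof -
  define L where "L y = (\<integral>\<^sup>+x. indicator {-s1..s1} x * G (of_real x * u + (z0 + of_real y * u')) \<partial>lborel)" for y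
  have [measurable]: "L \<in> borel_measurable borel" unfolding L_def[abs_def] by measurable
  have "(\<integral>\<^sup>+y. indicator {s0<..<s1} y * L (\<sigma> * y) \<partial>lborel) = (\<integral>\<^sup>+y. indicator {s0<..<s1} (\<sigma> * y) * L y \<partial>lborel)"
  proof (cases "\<sigma> = 1")
    case False
    then have "\<sigma> = -1" using \<sigma> by auto
    have "(\<integral>\<^sup>+y. indicator {s0<..<s1} (- y) * L y \<partial>lborel) = (\<integral>\<^sup>+y. indicator {s0<..<s1} (- y) * L y \<partial>(distr lborel borel uminus))"
      by (simp only: lborel_distr_uminus)
    also have "\<dots> = (\<integral>\<^sup>+y. indicator {s0<..<s1} y * L (- y) \<partial>lborel)"
      by (subst nn_integral_distr) auto
    finally show ?thesis using \<open>\<sigma> = -1\<close> by simp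
  qed simp
  also have "\<dots> \<le> (\<integral>\<^sup>+y. indicator {-s1..s1} y * L y \<partial>lborel)"
    by (intro nn_integral_mono mult_right_mono) (use s \<sigma> in \<open>auto simp: indicator_def\<close>)
  also have "\<dots> = (\<integral>\<^sup>+y. \<integral>\<^sup>+x. indicator (square s1) (of_real x * u + of_real y * u') * G (z0 + (of_real x * u + of_real y * u')) \<partial>lborel \<partial>lborel)"
  proof (rule nn_integral_cong)
    fix y
    have "indicator {-s1..s1} y * L y = (\<integral>\<^sup>+x. indicator {-s1..s1} y * (indicator {-s1..s1} x * G (of_real x * u + (z0 + of_real y * u'))) \<partial>lborel)"
      unfolding L_def by (rule nn_integral_cmult[symmetric]) measurable
    also have "\<dots> = (\<integral>\<^sup>+x. indicator (square s1) (of_real x * u + of_real y * u') * G (z0 + (of_real x * u + of_real y * u')) \<partial>lborel)"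
      by (intro nn_integral_cong) (auto simp: indicator_def axes_mem_square[OF ax] abs_le_iff add_ac)
    finally show "indicator {-s1..s1} y * L y = (\<integral>\<^sup>+x. indicator (square s1) (of_real x * u + of_real y * u') * G (z0 + (of_real x * u + of_real y * u')) \<partial>lborel)" .
  qed
  also have "\<dots> = (\<integral>\<^sup>+z. indicator (square s1) z * G (z0 + z) \<partial>lborel)"
    by (rule nn_integral_axes[OF ax, symmetric]) measurable
  also have "\<dots> = (\<integral>\<^sup>+z. indicator (square s1) ((z + z0) - z0) * G (z + z0) \<partial>lborel)" by (simp add: add.commute)
  also have "\<dots> = (\<integral>\<^sup>+z. indicator (square s1) (z - z0) * G z \<partial>lborel)"
    by (rule nn_integral_lborel_shift[of "\<lambda>z. indicator (square s1) (z - z0) * G z"]) measurable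
  finally show ?thesis by (simp add: L_def)
qed

text \<open>On the boundary of each square the cutoff of H takes both values 0 and 1, so twice the
  sum of the four side integrals is at least 1. Integrate this over the size of the square; each
  direction belongs to two parallel sides, whence the factor 4.\<close>

lemma length_area_smooth:
  fixes H :: "complex \<Rightarrow> complex"
  assumes H: "\<And>z. (H has_derivative D z) (at z)" and cD: "\<And>v. continuous_on UNIV (\<lambda>z. D z v)" and t: "t > 0"
    and s: "0 \<le> s0" "s0 < s1"
    and cross: "\<And>s. s \<in> {s0<..<s1} \<Longrightarrow> \<exists>p q. max \<bar>Re (p - z0)\<bar> \<bar>Im (p - z0)\<bar> = s \<and> max \<bar>Re (q - z0)\<bar> \<bar>Im (q - z0)\<bar> = s \<and>
       norm (H p - a) \<le> t \<and> 2 * t \<le> norm (H q - a)"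
  defines "G \<equiv> \<lambda>v z. ennreal (8 / t * indicator {w. t < norm (w - a) \<and> norm (w - a) < 2 * t} (H z) * norm (D z v))"
  shows "ennreal (s1 - s0) \<le> 4 * ((\<integral>\<^sup>+z. indicator (square s1) (z - z0) * G 1 z \<partial>lborel) + (\<integral>\<^sup>+z. indicator (square s1) (z - z0) * G \<i> z \<partial>lborel))"
proof -
  have "continuous_on UNIV H" using H by (meson continuous_at_imp_continuous_on has_derivative_continuous)
  then have [measurable]: "H \<in> borel_measurable borel" by (rule borel_measurable_continuous_onI)
  have [measurable]: "(\<lambda>z. D z v) \<in> borel_measurable borel" for v using cD by (rule borel_measurable_continuous_onI)
  have Gm [measurable]: "G v \<in> borel_measurable borel" for v unfolding G_def by measurable
  define L where "L u u' y = (\<integral>\<^sup>+x. indicator {-s1..s1} x * G u (of_real x * u + (z0 + of_real y * u')) \<partial>lborel)" for u u' y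
  have [measurable]: "L u u' \<in> borel_measurable borel" for u u' unfolding L_def[abs_def] by measurable
  have osc: "ennreal \<bar>cutoff a t (H (of_real x1 * u + (z0 + of_real y * u'))) - cutoff a t (H (of_real x2 * u + (z0 + of_real y * u')))\<bar> \<le> L u u' y"
    if "x1 \<in> {-s..s}" "x2 \<in> {-s..s}" "s < s1" for x1 x2 y s :: real and u u'
    unfolding L_def G_def by (rule cutoff_oscillation[OF H cD t]) (use that in auto)
  have one: "1 \<le> 2 * ((L 1 \<i> y + L 1 \<i> (-y)) + (L \<i> 1 y + L \<i> 1 (-y)))" if y: "y \<in> {s0<..<s1}" for y
  proof -
    obtain p q where pq: "max \<bar>Re (p - z0)\<bar> \<bar>Im (p - z0)\<bar> = y" "max \<bar>Re (q - z0)\<bar> \<bar>Im (q - z0)\<bar> = y"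
       "norm (H p - a) \<le> t" "2 * t \<le> norm (H q - a)" using cross[OF y] by blast
    have "ennreal \<bar>cutoff a t (H p) - cutoff a t (H q)\<bar> \<le> 2 * ((L 1 \<i> y + L 1 \<i> (-y)) + (L \<i> 1 y + L \<i> 1 (-y)))"
      using y by (intro box_loop_oscillation[where f = "\<lambda>z. cutoff a t (H z)", OF osc osc pq(1,2)]) auto
    then show ?thesis using cutoff_values[OF t] pq(3,4) by simp
  qed
  have half: "(\<integral>\<^sup>+y. indicator {s0<..<s1} y * L u u' y \<partial>lborel) \<le> (\<integral>\<^sup>+z. indicator (square s1) (z - z0) * G u z \<partial>lborel)"
    "(\<integral>\<^sup>+y. indicator {s0<..<s1} y * L u u' (- y) \<partial>lborel) \<le> (\<integral>\<^sup>+z. indicator (square s1) (z - z0) * G u z \<partial>lborel)"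
    if "axes u u'" for u u'
    using nn_integral_half_strip[OF that Gm s(1), of 1 s1 u z0] nn_integral_half_strip[OF that Gm s(1), of "-1" s1 u z0]
    by (simp_all add: L_def)
  have ax: "axes 1 \<i>" "axes \<i> 1" by (auto simp: axes_def)
  have "ennreal (s1 - s0) = (\<integral>\<^sup>+y. indicator {s0<..<s1} y \<partial>lborel)" using s by simp
  also have "\<dots> \<le> (\<integral>\<^sup>+y. 2 * ((indicator {s0<..<s1} y * L 1 \<i> y + indicator {s0<..<s1} y * L 1 \<i> (-y))
      + (indicator {s0<..<s1} y * L \<i> 1 y + indicator {s0<..<s1} y * L \<i> 1 (-y))) \<partial>lborel)"
    by (intro nn_integral_mono) (use one in \<open>auto simp: indicator_def\<close>)
  also have "\<dots> = 2 * (((\<integral>\<^sup>+y. indicator {s0<..<s1} y * L 1 \<i> y \<partial>lborel) + (\<integral>\<^sup>+y. indicator {s0<..<s1} y * L 1 \<i> (-y) \<partial>lborel))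
      + ((\<integral>\<^sup>+y. indicator {s0<..<s1} y * L \<i> 1 y \<partial>lborel) + (\<integral>\<^sup>+y. indicator {s0<..<s1} y * L \<i> 1 (-y) \<partial>lborel)))"
    by (simp add: nn_integral_cmult nn_integral_add)
  also have "\<dots> \<le> 2 * (((\<integral>\<^sup>+z. indicator (square s1) (z - z0) * G 1 z \<partial>lborel) + (\<integral>\<^sup>+z. indicator (square s1) (z - z0) * G 1 z \<partial>lborel))
      + ((\<integral>\<^sup>+z. indicator (square s1) (z - z0) * G \<i> z \<partial>lborel) + (\<integral>\<^sup>+z. indicator (square s1) (z - z0) * G \<i> z \<partial>lborel)))"
    by (intro mult_left_mono add_mono half ax) simp_all
  also have "\<dots> = 4 * ((\<integral>\<^sup>+z. indicator (square s1) (z - z0) * G 1 z \<partial>lborel) + (\<integral>\<^sup>+z. indicator (square s1) (z - z0) * G \<i> z \<partial>lborel))"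
    by (simp add: mult_2[symmetric] distrib_left mult.assoc[symmetric])
  finally show ?thesis .
qed

text \<open>The smooth estimate is applied to \<open>H k\<close> with k large in terms of the
  permitted error e. The gaps between r and t and between \<open>2 * t\<close> and R let the
  crossings survive the uniform error, and E belongs to a wider ring so as to contain every point
  that \<open>H k\<close> maps between the radii t and \<open>2 * t\<close>.\<close>

lemma length_area:
  assumes SA: "smooth_approximation M F g H D"
    and gm: "\<And>v. v \<in> {1, \<i>} \<Longrightarrow> g v \<in> borel_measurable borel"
    and cF: "continuous_on UNIV F"
    and M: "\<And>z. z - z0 \<in> square s1 \<Longrightarrow> z \<in> square M"
    and s: "0 \<le> s0" "s0 < s1" and t: "0 \<le> r" "r < t" "2 * t < R"
    and cross: "\<And>s. s \<in> {s0<..<s1} \<Longrightarrow> \<exists>p q. max \<bar>Re (p - z0)\<bar> \<bar>Im (p - z0)\<bar> = s \<and> max \<bar>Re (q - z0)\<bar> \<bar>Im (q - z0)\<bar> = s \<and>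
       norm (F p - a) \<le> r \<and> R \<le> norm (F q - a)"
  defines "E \<equiv> {z. z - z0 \<in> square s1 \<and> t / 2 < norm (F z - a) \<and> norm (F z - a) < 5 * t / 2}"
  shows "ennreal (t * (s1 - s0)) \<le> 32 * (L1_on E (g 1) + L1_on E (g \<i>))"
proof (rule ennreal_le_epsilon)
  fix e :: real assume e: "e > 0"
  have t0: "t > 0" using t by simp
  \<comment> \<open>The four entries keep the crossings at the inner and at the outer circle, make
    the wider ring wide enough, and hold the total error in the mean,
    \<open>32 * 2 * (1/4)^k\<close>, below e.\<close>
  define \<delta> where "\<delta> = min (min (t - r) (R - 2 * t)) (min (t / 2) (e / 64))"
  have "\<delta> > 0" using t t0 e by (simp add: \<delta>_def)
  then obtain k where k: "(1/4::real)^k < \<delta>" using real_arch_pow_inv[of \<delta> "1/4"] by auto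
  then have k': "(1/4::real)^k < t - r" "(1/4::real)^k < R - 2 * t" "(1/4::real)^k < t / 2" "64 * (1/4::real)^k < e"
    unfolding \<delta>_def by auto
  have H: "\<And>z. (H k has_derivative D k z) (at z)" and cD: "\<And>v. continuous_on UNIV (\<lambda>z. D k z v)"
    and close: "\<And>z. z \<in> square M \<Longrightarrow> norm (H k z - F z) \<le> (1/4)^k"
    and L1: "\<And>v. v \<in> {1, \<i>} \<Longrightarrow> (L1_on (square M) (\<lambda>z. D k z v - g v z)) \<le> ennreal ((1/4)^k)"
    using SA by (auto simp: smooth_approximation_def)
  have near: "\<bar>norm (H k z - a) - norm (F z - a)\<bar> \<le> (1/4)^k" if "z \<in> square M" for z
    using norm_triangle_ineq3[of "H k z - a" "F z - a"] close[OF that] by simp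
  have [measurable]: "F \<in> borel_measurable borel" using cF by (rule borel_measurable_continuous_onI)
  have [measurable]: "E \<in> sets borel" unfolding E_def by measurable
  have [measurable]: "(\<lambda>z. D k z v) \<in> borel_measurable borel" for v using cD by (rule borel_measurable_continuous_onI)
  have [measurable]: "g 1 \<in> borel_measurable borel" "g \<i> \<in> borel_measurable borel" using gm by auto
  define G where "G v z = ennreal (8 / t * indicator {w. t < norm (w - a) \<and> norm (w - a) < 2 * t} (H k z) * norm (D k z v))" for v z
  have "ennreal (s1 - s0) \<le> 4 * ((\<integral>\<^sup>+z. indicator (square s1) (z - z0) * G 1 z \<partial>lborel) + (\<integral>\<^sup>+z. indicator (square s1) (z - z0) * G \<i> z \<partial>lborel))"
    unfolding G_def
  proof (rule length_area_smooth[OF H cD t0 s])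
    fix y assume y: "y \<in> {s0<..<s1}"
    obtain p q where pq: "max \<bar>Re (p - z0)\<bar> \<bar>Im (p - z0)\<bar> = y" "max \<bar>Re (q - z0)\<bar> \<bar>Im (q - z0)\<bar> = y"
       "norm (F p - a) \<le> r" "R \<le> norm (F q - a)" using cross[OF y] by blast
    have "w - z0 \<in> square s1" if "max \<bar>Re (w - z0)\<bar> \<bar>Im (w - z0)\<bar> = y" for w
      using that y by (simp only: mem_square greaterThanLessThan_iff) linarith
    then have "p - z0 \<in> square s1" "q - z0 \<in> square s1" using pq(1,2) by blast+
    then have "norm (H k p - a) \<le> t" "2 * t \<le> norm (H k q - a)"
      using near[OF M, of p] near[OF M, of q] pq(3,4) k' by linarith+
    then show "\<exists>p q. max \<bar>Re (p - z0)\<bar> \<bar>Im (p - z0)\<bar> = y \<and> max \<bar>Re (q - z0)\<bar> \<bar>Im (q - z0)\<bar> = y \<and>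
       norm (H k p - a) \<le> t \<and> 2 * t \<le> norm (H k q - a)" using pq by blast
  qed
  also have "\<dots> \<le> 4 * (ennreal (8 / t) * (L1_on E (g 1) + ennreal ((1/4)^k))
      + ennreal (8 / t) * (L1_on E (g \<i>) + ennreal ((1/4)^k)))"
  proof (intro mult_left_mono add_mono)
    have "(\<integral>\<^sup>+z. indicator (square s1) (z - z0) * G v z \<partial>lborel) \<le> ennreal (8 / t) * (L1_on E (g v) + ennreal ((1/4)^k))"
      if v: "v \<in> {1, \<i>}" for v
    proof -
      have [measurable]: "g v \<in> borel_measurable borel" using gm v by auto
      have "(\<integral>\<^sup>+z. indicator (square s1) (z - z0) * G v z \<partial>lborel)
        \<le> (\<integral>\<^sup>+z. ennreal (8 / t) * (indicator E z * ennreal (norm (g v z)) + indicator (square M) z * ennreal (norm (D k z v - g v z))) \<partial>lborel)"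
      proof (rule nn_integral_mono)
        fix z
        show "indicator (square s1) (z - z0) * G v z \<le> ennreal (8 / t) * (indicator E z * ennreal (norm (g v z)) + indicator (square M) z * ennreal (norm (D k z v - g v z)))"
        proof (cases "z - z0 \<in> square s1 \<and> t < norm (H k z - a) \<and> norm (H k z - a) < 2 * t")
          case True
          then have zM: "z \<in> square M" using M by blast
          have zE: "z \<in> E" using True near[OF zM] k' unfolding E_def by auto
          have "G v z = ennreal (8 / t) * ennreal (norm (D k z v))"
            using True t0 by (simp add: G_def ennreal_mult[symmetric])
          also have "\<dots> \<le> ennreal (8 / t) * ennreal (norm (g v z) + norm (D k z v - g v z))"
            using norm_triangle_ineq[of "g v z" "D k z v - g v z"] by (intro mult_left_mono ennreal_leI) auto
          finally show ?thesis using True zM zE by simp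
        qed (auto simp: G_def indicator_def)
      qed
      also have "\<dots> = ennreal (8 / t) * (L1_on E (g v) + L1_on (square M) (\<lambda>z. D k z v - g v z))"
        by (subst nn_integral_cmult; measurable?; subst nn_integral_add; measurable?)
      also have "\<dots> \<le> ennreal (8 / t) * (L1_on E (g v) + ennreal ((1/4)^k))"
        by (intro mult_left_mono add_left_mono L1 v) simp
      finally show ?thesis .
    qed
    then show "(\<integral>\<^sup>+z. indicator (square s1) (z - z0) * G 1 z \<partial>lborel) \<le> ennreal (8 / t) * (L1_on E (g 1) + ennreal ((1/4)^k))"
      "(\<integral>\<^sup>+z. indicator (square s1) (z - z0) * G \<i> z \<partial>lborel) \<le> ennreal (8 / t) * (L1_on E (g \<i>) + ennreal ((1/4)^k))"
      by auto
  qed simp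
  finally have "ennreal t * ennreal (s1 - s0) \<le> ennreal t * (4 * (ennreal (8 / t) * (L1_on E (g 1) + ennreal ((1/4)^k))
      + ennreal (8 / t) * (L1_on E (g \<i>) + ennreal ((1/4)^k))))"
    by (rule mult_left_mono) simp
  also have "\<dots> = (ennreal t * ennreal (8 / t)) * 4 * ((L1_on E (g 1) + L1_on E (g \<i>)) + (ennreal ((1/4)^k) + ennreal ((1/4)^k)))"
    by (simp add: distrib_left mult_ac add_ac)
  also have "ennreal t * ennreal (8 / t) * 4 = 32"
    using t0 by (simp add: ennreal_mult[symmetric])
  also have "ennreal ((1/4)^k) + ennreal ((1/4)^k) = ennreal (2 * (1/4)^k)" by (simp add: ennreal_plus[symmetric] del: ennreal_plus)
  also have "32 * ((L1_on E (g 1) + L1_on E (g \<i>)) + ennreal (2 * (1/4)^k))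
     \<le> 32 * (L1_on E (g 1) + L1_on E (g \<i>)) + ennreal e"
  proof -
    have "32 * ennreal (2 * (1/4)^k) = ennreal (64 * (1/4)^k)"
      by (simp add: ennreal_mult[symmetric] ennreal_numeral[symmetric] del: ennreal_numeral)
    also have "\<dots> \<le> ennreal e" using k'(4) by (intro ennreal_leI) simp
    finally show ?thesis by (simp add: distrib_left add_left_mono)
  qed
  finally show "ennreal (t * (s1 - s0)) \<le> 32 * (L1_on E (g 1) + L1_on E (g \<i>)) + ennreal e"
    using t0 s by (simp add: ennreal_mult)
qed

subsection \<open>From the analytic definition to the three point condition\<close>

text \<open>Local integrability refers to the Lebesgue measure, while slicing by Fubini is done with
  Borel functions. Measurability of h itself follows because h is the pointwise limit of its
  truncations to growing squares.\<close>

lemma borel_representative: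
  fixes h :: "complex \<Rightarrow> complex"
  assumes "locally_integrable_on UNIV h"
  obtains h' where "h' \<in> borel_measurable borel" "AE z in lebesgue. h z = h' z"
    "\<And>M. integrable lborel (\<lambda>z. indicator (square M) z *\<^sub>R h' z)"
proof -
  have int: "integrable lebesgue (\<lambda>z. indicator (square M) z *\<^sub>R h z)" for M
    using assms unfolding locally_integrable_on_def set_integrable_def by simp
  have hm: "h \<in> borel_measurable lebesgue"
  proof (rule borel_measurable_LIMSEQ_metric)
    show "(\<lambda>z. indicator (square (real n)) z *\<^sub>R h z) \<in> borel_measurable lebesgue" for n
      using int by (rule borel_measurable_integrable)
    fix z :: complex
    obtain n where n: "norm z \<le> real n" using real_arch_simple by blast
    have "\<forall>\<^sub>F m in sequentially. indicator (square (real m)) z *\<^sub>R h z = h z"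
      using eventually_ge_at_top[of n]
    proof eventually_elim
      case (elim m)
      then have "z \<in> square (real m)"
        using n abs_Re_le_cmod[of z] abs_Im_le_cmod[of z] by (auto simp: mem_square)
      then show ?case by simp
    qed
    then show "(\<lambda>n. indicator (square (real n)) z *\<^sub>R h z) \<longlonglongrightarrow> h z" by (rule tendsto_eventually)
  qed
  obtain p where p: "p \<in> borel_measurable lborel" "AE z in lborel. Re (h z) = p z"
    using completion_ex_borel_measurable_real[of "\<lambda>z. Re (h z)" lborel] hm by auto
  obtain q where q: "q \<in> borel_measurable lborel" "AE z in lborel. Im (h z) = q z"
    using completion_ex_borel_measurable_real[of "\<lambda>z. Im (h z)" lborel] hm by auto
  define h' where "h' z = Complex (p z) (q z)" for z
  have m: "h' \<in> borel_measurable borel" using p(1) q(1) unfolding h'_def[abs_def] Complex_eq by simp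
  have "AE z in lborel. h z = h' z" using p(2) q(2) by eventually_elim (simp add: h'_def complex_eq_iff)
  then have ae: "AE z in lebesgue. h z = h' z" by (rule AE_completion)
  moreover have "integrable lborel (\<lambda>z. indicator (square M) z *\<^sub>R h' z)" for M
  proof -
    have "integrable lebesgue (\<lambda>z. indicator (square M) z *\<^sub>R h' z)"
    proof (rule integrable_cong_AE_imp[OF int])
      show "(\<lambda>z. indicator (square M) z *\<^sub>R h' z) \<in> borel_measurable lebesgue"
        using m by (intro measurable_completion) simp
      show "AE z in lebesgue. indicator (square M) z *\<^sub>R h z = indicator (square M) z *\<^sub>R h' z"
        using ae by eventually_elim simp
    qed
    then show ?thesis using m by (subst (asm) integrable_completion) simp_all
  qed
  ultimately show ?thesis using that m by blast
qed

text \<open>The form in which K is used: the squared operator norm is at most K times the Jacobian.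
  Where both derivatives vanish both sides are 0; elsewhere the value \<infinity> in the definition
  rules out \<open>norm p \<le> norm q\<close>.\<close>

lemma dilatation_bound:
  assumes "dilatation p q \<le> ereal K" "K \<ge> 1"
  shows "(norm p + norm q)\<^sup>2 \<le> K * ((norm p)\<^sup>2 - (norm q)\<^sup>2)"
proof (cases "p = 0 \<and> q = 0")
  case False
  then have lt: "norm q < norm p" and le: "(norm p + norm q) / (norm p - norm q) \<le> K"
    using assms(1) by (auto simp: dilatation_def split: if_splits)
  then have "norm p + norm q \<le> K * (norm p - norm q)" by (simp add: divide_le_eq)
  then have "(norm p + norm q) * (norm p + norm q) \<le> (K * (norm p - norm q)) * (norm p + norm q)"
    by (rule mult_right_mono) simp
  then show ?thesis by (simp add: power2_eq_square algebra_simps)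
qed simp

lemma test_function_integrable:
  assumes \<phi>: "test_function UNIV \<phi>" and h: "h \<in> borel_measurable borel"
    "\<And>M. integrable lborel (\<lambda>z. indicator (square M) z *\<^sub>R h z)"
  shows "integrable lborel (\<lambda>z. h z * \<phi> z)"
proof -
  define K where "K = closure {z. \<phi> z \<noteq> 0}"
  note t = test_functionD[OF \<phi>, folded K_def]
  obtain B where B: "\<And>z. z \<in> K \<Longrightarrow> norm z \<le> B" using compact_imp_bounded[OF t(4)] by (auto simp: bounded_iff)
  have "bounded (\<phi> ` K)" by (intro compact_imp_bounded compact_continuous_image continuous_on_subset[OF t(3)] t(4)) auto
  then obtain C where C: "\<And>z. z \<in> K \<Longrightarrow> norm (\<phi> z) \<le> C" by (auto simp: bounded_iff)
  have [measurable]: "\<phi> \<in> borel_measurable borel" "h \<in> borel_measurable borel"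
    using t(3) h(1) by (auto intro: borel_measurable_continuous_onI)
  show ?thesis
  proof (rule Bochner_Integration.integrable_bound)
    show "integrable lborel (\<lambda>z. C * norm (indicator (square B) z *\<^sub>R h z))"
      by (intro integrable_mult_right integrable_norm h(2))
    show "(\<lambda>z. h z * \<phi> z) \<in> borel_measurable lborel" by measurable
    show "AE z in lborel. norm (h z * \<phi> z) \<le> norm (C * norm (indicator (square B) z *\<^sub>R h z))"
    proof (rule AE_I2)
      fix z
      show "norm (h z * \<phi> z) \<le> norm (C * norm (indicator (square B) z *\<^sub>R h z))"
      proof (cases "z \<in> K")
        case True
        then have "z \<in> square B" using B[OF True] abs_Re_le_cmod[of z] abs_Im_le_cmod[of z] by (auto simp: mem_square)
        moreover have "0 \<le> C" using C[OF True] norm_ge_zero order_trans by blast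
        ultimately show ?thesis using C[OF True] by (simp add: norm_mult abs_mult mult.commute[of C] mult_left_mono)
      qed (simp add: t(5))
    qed
  qed
qed

text \<open>Passage from Wirtinger derivatives P and Q to directional derivatives. In the directions
  1 and \<i> these have norm at most |P| + |Q|, and their Jacobian is |P|^2 - |Q|^2, so the
  dilatation bound becomes an inequality between squared derivatives and the Jacobian.\<close>

lemma quasiconformal_data:
  assumes "quasiconformal_on K UNIV F"
  obtains g where "continuous_on UNIV F" "inj F"
    "\<And>v. g v \<in> borel_measurable borel"
    "\<And>v M. integrable lborel (\<lambda>z. indicator (square M) z *\<^sub>R g v z)"
    "\<And>v. v \<in> {1, \<i>} \<Longrightarrow> weak_derivative F v (g v)"
    "\<And>v. v \<in> {1, \<i>} \<Longrightarrow> AE z in lborel. (norm (g v z))\<^sup>2 \<le> K * (Re (g 1 z) * Im (g \<i> z) - Im (g 1 z) * Re (g \<i> z))"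
proof -
  have K: "K \<ge> 1" and emb: "homeomorphic_embedding UNIV F" using assms by (auto simp: quasiconformal_on_def)
  obtain A B where A: "locally_integrable_on UNIV A" "distributional_derivative wirtinger UNIV F A"
    and B: "locally_integrable_on UNIV B" "distributional_derivative wirtinger_bar UNIV F B"
    and ess: "esssup (lebesgue_on UNIV) (\<lambda>z. dilatation (A z) (B z)) \<le> ereal K"
    using assms unfolding quasiconformal_on_def by blast
  have cF: "continuous_on UNIV F" using emb by (auto simp: homeomorphic_embedding_def homeomorphism_def)
  have inj: "inj F" using emb unfolding homeomorphic_embedding_def homeomorphism_def by (metis UNIV_I injI)
  obtain P where P: "P \<in> borel_measurable borel" "AE z in lebesgue. A z = P z"
    "\<And>M. integrable lborel (\<lambda>z. indicator (square M) z *\<^sub>R P z)" using borel_representative[OF A(1)] by blast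
  obtain Q where Q: "Q \<in> borel_measurable borel" "AE z in lebesgue. B z = Q z"
    "\<And>M. integrable lborel (\<lambda>z. indicator (square M) z *\<^sub>R Q z)" using borel_representative[OF B(1)] by blast
  note [measurable] = P(1) Q(1)
  define g where "g v z = P z * v + Q z * cnj v" for v z  \<comment> \<open>the derivative in direction \<open>v\<close>\<close>
  have gm: "g v \<in> borel_measurable borel" for v unfolding g_def[abs_def] by measurable
  have gi: "integrable lborel (\<lambda>z. indicator (square M) z *\<^sub>R g v z)" for v M
  proof -
    have "(\<lambda>z. indicator (square M) z *\<^sub>R g v z) = (\<lambda>z. (indicator (square M) z *\<^sub>R P z) * v + (indicator (square M) z *\<^sub>R Q z) * cnj v)"
      by (auto simp: g_def scaleR_add_right)
    then show ?thesis
      by (simp only:) (intro Bochner_Integration.integrable_add integrable_mult_left P(3) Q(3))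
  qed
  have weak: "weak_derivative F v (g v)" if v: "v \<in> {1, \<i>}" for v
    unfolding weak_derivative_def
  proof (intro allI impI)
    fix \<phi> assume \<phi>: "test_function UNIV \<phi>"
    define S where "S = closure {z. \<phi> z \<noteq> 0}"
    note t = test_functionD[OF \<phi>, folded S_def]
    have ci: "integrable lborel (\<lambda>z. F z * h z)" if "continuous_on UNIV h" "\<And>z. z \<notin> S \<Longrightarrow> h z = 0" for h
      by (rule continuous_compact_support_integrable[OF _ _ t(4)]) (auto intro!: continuous_on_mult cF that simp: that(2))
    have w1: "continuous_on UNIV (wirtinger \<phi>)" "z \<notin> S \<Longrightarrow> wirtinger \<phi> z = 0"
      and w2: "continuous_on UNIV (wirtinger_bar \<phi>)" "z \<notin> S \<Longrightarrow> wirtinger_bar \<phi> z = 0" for z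
      unfolding wirtinger_def[abs_def] wirtinger_bar_def[abs_def] by (auto intro!: continuous_intros t(2) simp: t(6))
    have i1: "integrable lborel (\<lambda>z. F z * wirtinger \<phi> z)" and i2: "integrable lborel (\<lambda>z. F z * wirtinger_bar \<phi> z)"
      using ci[OF w1] ci[OF w2] by auto
    have j1: "integrable lborel (\<lambda>z. P z * \<phi> z)" and j2: "integrable lborel (\<lambda>z. Q z * \<phi> z)"
      by (rule test_function_integrable[OF \<phi> P(1) P(3)], rule test_function_integrable[OF \<phi> Q(1) Q(3)])
    \<comment> \<open>Replaces the given derivative X by its Borel version R and Lebesgue measure by
      \<open>lborel\<close>, once for both operators.\<close>
    have conv: "(\<integral>z. F z * D z \<partial>lborel) = - (\<integral>z. R z * \<phi> z \<partial>lborel)"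
      if d: "(LINT z:UNIV|lebesgue. F z * D z) = - (LINT z:UNIV|lebesgue. X z * \<phi> z)"
        and i: "integrable lborel (\<lambda>z. F z * D z)" and j: "integrable lborel (\<lambda>z. R z * \<phi> z)"
        and ae: "AE z in lebesgue. X z = R z" and lm: "locally_integrable_on UNIV X" for D X R
    proof -
      have "(LINT z:UNIV|lebesgue. F z * D z) = (\<integral>z. F z * D z \<partial>lborel)"
        using i by (simp add: set_lebesgue_integral_def integral_completion)
      moreover have "(LINT z:UNIV|lebesgue. X z * \<phi> z) = (\<integral>z. R z * \<phi> z \<partial>lebesgue)"
      proof -
        have RM: "(\<lambda>z. R z * \<phi> z) \<in> borel_measurable lebesgue"
          using borel_measurable_integrable[OF j] by (intro measurable_completion)
        have ae': "AE z in lebesgue. R z * \<phi> z = X z * \<phi> z" using ae by eventually_elim simp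
        have "(\<lambda>z. X z * \<phi> z) \<in> borel_measurable lebesgue"
          using RM ae' by (rule borel_measurable_AE)
        then have "(\<integral>z. X z * \<phi> z \<partial>lebesgue) = (\<integral>z. R z * \<phi> z \<partial>lebesgue)"
          using RM ae' by (intro integral_cong_AE) (auto elim: eventually_mono)
        then show ?thesis by (simp add: set_lebesgue_integral_def)
      qed
      moreover have "(\<integral>z. R z * \<phi> z \<partial>lebesgue) = (\<integral>z. R z * \<phi> z \<partial>lborel)"
        using borel_measurable_integrable[OF j] by (rule integral_completion)
      ultimately show ?thesis using d by simp
    qed
    have c1: "(\<integral>z. F z * wirtinger \<phi> z \<partial>lborel) = - (\<integral>z. P z * \<phi> z \<partial>lborel)"
      using A(2) \<phi> by (intro conv[OF _ i1 j1 P(2) A(1)]) (simp add: distributional_derivative_def)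
    have c2: "(\<integral>z. F z * wirtinger_bar \<phi> z \<partial>lborel) = - (\<integral>z. Q z * \<phi> z \<partial>lborel)"
      using B(2) \<phi> by (intro conv[OF _ i2 j2 Q(2) B(1)]) (simp add: distributional_derivative_def)
    have e1: "F z * frechet_derivative \<phi> (at z) v = v * (F z * wirtinger \<phi> z) + cnj v * (F z * wirtinger_bar \<phi> z)" for z
      using v by (auto simp: wirtinger_def wirtinger_bar_def field_simps)
    have e2: "g v z * \<phi> z = v * (P z * \<phi> z) + cnj v * (Q z * \<phi> z)" for z
      by (simp add: g_def algebra_simps)
    show "(\<integral>z. F z * frechet_derivative \<phi> (at z) v \<partial>lborel) = - (\<integral>z. g v z * \<phi> z \<partial>lborel)"
      unfolding e1 e2 using i1 i2 j1 j2 c1 c2 by (simp add: algebra_simps)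
  qed
  have ess': "esssup lebesgue (\<lambda>z. dilatation (A z) (B z)) \<le> ereal K"
    using ess by (simp add: lebesgue_on_UNIV_eq)
  have "AE z in lebesgue. dilatation (A z) (B z) \<le> ereal K"
    using esssup_AE[of "\<lambda>z. dilatation (A z) (B z)" lebesgue] by eventually_elim (rule order_trans[OF _ ess'])
  then have "AE z in lebesgue. dilatation (P z) (Q z) \<le> ereal K" using P(2) Q(2) by eventually_elim simp
  then have dil: "AE z in lborel. dilatation (P z) (Q z) \<le> ereal K" by (simp only: AE_completion_iff)
  have "AE z in lborel. (norm (g v z))\<^sup>2 \<le> K * (Re (g 1 z) * Im (g \<i> z) - Im (g 1 z) * Re (g \<i> z))" if v: "v \<in> {1, \<i>}" for v
    using dil
  proof eventually_elim
    case (elim z)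
    have "norm (g v z) \<le> norm (P z) + norm (Q z)"
      using v norm_triangle_ineq[of "P z * v" "Q z * cnj v"] by (auto simp: g_def norm_mult)
    then have "(norm (g v z))\<^sup>2 \<le> (norm (P z) + norm (Q z))\<^sup>2" by (rule power_mono) simp
    also have "\<dots> \<le> K * ((norm (P z))\<^sup>2 - (norm (Q z))\<^sup>2)" by (rule dilatation_bound[OF elim K])
    also have "(norm (P z))\<^sup>2 - (norm (Q z))\<^sup>2 = Re (g 1 z) * Im (g \<i> z) - Im (g 1 z) * Re (g \<i> z)"
      unfolding cmod_power2 by (simp add: g_def power2_eq_square algebra_simps)
    finally show ?case .
  qed
  then show ?thesis using that[of g] cF inj gm gi weak by blast
qed

text \<open>On each good set F is differentiable relative to the set, so the area inequality
  applies. The good sets increase to almost all of the square, and monotone convergence passes to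
  E.\<close>

lemma jacobian_integral_le:
  assumes SA: "smooth_approximation M F g H D" and gm: "\<And>v. g v \<in> borel_measurable borel"
    and inj: "inj F" and E: "E \<in> sets borel" "E \<subseteq> square M" and T: "T \<in> sets borel" "F ` E \<subseteq> T"
  shows "(\<integral>\<^sup>+z. indicator E z * ennreal \<bar>Re (g 1 z) * Im (g \<i> z) - Im (g 1 z) * Re (g \<i> z)\<bar> \<partial>lborel) \<le> emeasure lborel T"
proof -
  define J where "J z = ennreal \<bar>Re (g 1 z) * Im (g \<i> z) - Im (g 1 z) * Re (g \<i> z)\<bar>" for z
  note [measurable] = gm E(1)
  have [measurable]: "J \<in> borel_measurable borel" unfolding J_def[abs_def] by measurable
  define S where "S = good_set M g H D"
  note gs = good_sets[OF SA gm, folded S_def]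
  have [measurable]: "S j \<in> sets borel" for j using gs(1) .
  have "AE z in lborel. indicator E z * J z \<le> (SUP j. indicator (E \<inter> S j) z * J z)"
    using gs(3)
  proof eventually_elim
    case (elim z)
    show ?case
    proof (cases "z \<in> E")
      case True
      then obtain j where "z \<in> S j" using elim E(2) by blast
      then have "indicator E z * J z = indicator (E \<inter> S j) z * J z" using True by simp
      also have "\<dots> \<le> (SUP j. indicator (E \<inter> S j) z * J z)" by (rule SUP_upper) simp
      finally show ?thesis .
    qed simp
  qed
  then have "(\<integral>\<^sup>+z. indicator E z * J z \<partial>lborel) \<le> (\<integral>\<^sup>+z. (SUP j. indicator (E \<inter> S j) z * J z) \<partial>lborel)"
    by (rule nn_integral_mono_AE)
  also have "\<dots> = (SUP j. \<integral>\<^sup>+z. indicator (E \<inter> S j) z * J z \<partial>lborel)"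
  proof (rule nn_integral_monotone_convergence_SUP)
    show "incseq (\<lambda>j z. indicator (E \<inter> S j) z * J z)"
      using gs(2) by (auto simp: incseq_def le_fun_def indicator_def)
  qed measurable
  also have "\<dots> \<le> emeasure lborel T"
  proof (rule SUP_least)
    fix j
    show "(\<integral>\<^sup>+z. indicator (E \<inter> S j) z * J z \<partial>lborel) \<le> emeasure lborel T"
      unfolding J_def
    proof (rule area_inequality[OF _ _ gm gm _ T(1)])
      show "inj_on F (E \<inter> S j)" using inj by (auto intro: inj_on_subset)
      show "F ` (E \<inter> S j) \<subseteq> T" using T(2) by blast
      show "(F has_derivative (\<lambda>h. of_real (Re h) * g 1 z + of_real (Im h) * g \<i> z)) (at z within E \<inter> S j)" if "z \<in> E \<inter> S j" for z
        using good_set_has_derivative[OF SA, of z j] that unfolding S_def by (auto intro: has_derivative_subset)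
    qed measurable
  qed
  finally show ?thesis by (simp add: J_def)
qed

lemma emeasure_ball_le:
  fixes a :: complex
  assumes "\<rho> \<ge> 0"
  shows "emeasure lborel (ball a \<rho>) \<le> ennreal (4 * \<rho>\<^sup>2)"
proof -
  have "ball a \<rho> \<subseteq> cbox (a - Complex \<rho> \<rho>) (a + Complex \<rho> \<rho>)"
  proof
    fix z assume "z \<in> ball a \<rho>"
    then have "norm (z - a) \<le> \<rho>" by (simp add: dist_norm norm_minus_commute)
    then have "\<bar>Re (z - a)\<bar> \<le> \<rho>" "\<bar>Im (z - a)\<bar> \<le> \<rho>"
      using abs_Re_le_cmod[of "z - a"] abs_Im_le_cmod[of "z - a"] by linarith+
    then show "z \<in> cbox (a - Complex \<rho> \<rho>) (a + Complex \<rho> \<rho>)" by (auto simp: in_cbox_complex_iff abs_le_iff)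
  qed
  then have "emeasure lborel (ball a \<rho>) \<le> emeasure lborel (cbox (a - Complex \<rho> \<rho>) (a + Complex \<rho> \<rho>))"
    by (rule emeasure_mono) simp
  also have "\<dots> = ennreal (4 * \<rho>\<^sup>2)"
    using assms by (subst emeasure_lborel_cbox) (auto simp: Basis_complex_def power2_eq_square)
  finally show ?thesis .
qed

section \<open>Images of squares under an embedding of the plane\<close>

definition open_square :: "complex \<Rightarrow> real \<Rightarrow> complex set" where
  "open_square z0 s = {z. \<bar>Re (z - z0)\<bar> < s \<and> \<bar>Im (z - z0)\<bar> < s}"

text \<open>Invariance of domain makes the image of the open square open, and the image of the
  closed square is compact. A frontier point therefore comes from the closed square but not from the
  open one.\<close>

lemma frontier_image_square:
  fixes F :: "complex \<Rightarrow> complex"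
  assumes F: "continuous_on UNIV F" "inj F" and w: "w \<in> frontier (F ` open_square z0 s)"
  shows "\<exists>z. max \<bar>Re (z - z0)\<bar> \<bar>Im (z - z0)\<bar> = s \<and> F z = w"
proof -
  have op: "open (open_square z0 s)"
    unfolding open_square_def by (intro open_Collect_conj open_Collect_less continuous_intros)
  have oF: "open (F ` open_square z0 s)"
    using F by (intro invariance_of_domain op) (auto intro: continuous_on_subset inj_on_subset)
  define C where "C = (\<lambda>z. z + z0) ` square s"
  have "compact C" unfolding C_def by (intro compact_continuous_image continuous_intros) simp
  then have "compact (F ` C)" by (intro compact_continuous_image continuous_on_subset[OF F(1)]) auto
  moreover have "open_square z0 s \<subseteq> C"
    by (force simp: C_def open_square_def mem_square intro: image_eqI[of _ _ "z - z0" for z])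
  ultimately have "closure (F ` open_square z0 s) \<subseteq> F ` C"
    by (intro closure_minimal image_mono compact_imp_closed) auto
  then have "w \<in> F ` C" "w \<notin> F ` open_square z0 s"
    using w oF by (auto simp: frontier_def interior_open)
  then obtain z where z: "z \<in> C" "F z = w" "z \<notin> open_square z0 s" by blast
  then have "max \<bar>Re (z - z0)\<bar> \<bar>Im (z - z0)\<bar> = s"
    by (auto simp: C_def mem_square open_square_def max_def)
  then show ?thesis using z(2) by blast
qed

text \<open>The image V of the open square contains \<open>F z0\<close> but not \<open>F z2\<close>,
  so the segment between them meets the frontier of V, no farther out than \<open>F z2\<close>. The
  ray from \<open>F z1\<close> away from \<open>F z0\<close> starts in V and leaves it because V is
  bounded, so it meets the frontier at least as far out as \<open>F z1\<close>.\<close>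

lemma image_square_crossing:
  fixes F :: "complex \<Rightarrow> complex"
  assumes F: "continuous_on UNIV F" "inj F" and s: "s > 0"
    and z1: "z1 \<in> open_square z0 s" and z2: "z2 \<notin> open_square z0 s" and ne: "z1 \<noteq> z0"
  shows "\<exists>p q. max \<bar>Re (p - z0)\<bar> \<bar>Im (p - z0)\<bar> = s \<and> max \<bar>Re (q - z0)\<bar> \<bar>Im (q - z0)\<bar> = s \<and>
     norm (F p - F z0) \<le> norm (F z2 - F z0) \<and> norm (F z1 - F z0) \<le> norm (F q - F z0)"
proof -
  let ?V = "F ` open_square z0 s"
  have a: "F z0 \<in> ?V" using s by (auto simp: open_square_def)
  have "closed_segment (F z0) (F z2) \<inter> frontier ?V \<noteq> {}"
  proof (rule connected_Int_frontier)
    show "closed_segment (F z0) (F z2) \<inter> ?V \<noteq> {}" using a by auto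
    have "F z2 \<notin> ?V" using z2 F(2) by (auto dest: injD)
    then show "closed_segment (F z0) (F z2) - ?V \<noteq> {}" by auto
  qed auto
  then obtain p where p: "max \<bar>Re (p - z0)\<bar> \<bar>Im (p - z0)\<bar> = s" "F p \<in> closed_segment (F z0) (F z2)"
    using frontier_image_square[OF F] by blast
  have p': "norm (F p - F z0) \<le> norm (F z2 - F z0)" using segment_bound1[OF p(2)] by (simp add: norm_minus_commute)
  define ray where "ray = (\<lambda>\<tau>. F z0 + of_real \<tau> * (F z1 - F z0)) ` {1..}"
  have R: "norm (F z1 - F z0) > 0" using ne F(2) by (auto dest: injD)
  have "ray \<inter> frontier ?V \<noteq> {}"
  proof (rule connected_Int_frontier)
    show "connected ray" unfolding ray_def by (intro connected_continuous_image continuous_intros) simp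
    have "F z1 \<in> ray" unfolding ray_def by (rule image_eqI[of _ _ 1]) auto
    then show "ray \<inter> ?V \<noteq> {}" using z1 by blast
    have "bounded ?V"
    proof (rule bounded_subset)
      show "bounded (F ` ((\<lambda>z. z + z0) ` square s))"
        by (intro compact_imp_bounded compact_continuous_image continuous_intros continuous_on_subset[OF F(1)]) auto
      show "?V \<subseteq> F ` ((\<lambda>z. z + z0) ` square s)"
        by (intro image_mono) (force simp: open_square_def mem_square intro: image_eqI[of _ _ "z - z0" for z])
    qed
    then obtain B where B: "\<And>w. w \<in> ?V \<Longrightarrow> norm (w - F z0) \<le> B"
      using bounded_minus_comp[of "\<lambda>w. w" ?V "\<lambda>w. F z0"] by (auto simp: bounded_iff)
    define \<tau> where "\<tau> = max 1 ((B + 1) / norm (F z1 - F z0))"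
    define w where "w = F z0 + of_real \<tau> * (F z1 - F z0)"
    have "w \<in> ray" by (auto simp: ray_def w_def \<tau>_def)
    moreover have "norm (w - F z0) > B"
    proof -
      have "B + 1 = (B + 1) / norm (F z1 - F z0) * norm (F z1 - F z0)" using R by simp
      also have "\<dots> \<le> \<tau> * norm (F z1 - F z0)" by (intro mult_right_mono) (auto simp: \<tau>_def)
      also have "\<dots> = norm (w - F z0)" by (simp add: w_def norm_mult \<tau>_def)
      finally show ?thesis by simp
    qed
    ultimately show "ray - ?V \<noteq> {}" using B by force
  qed
  then obtain q where q: "max \<bar>Re (q - z0)\<bar> \<bar>Im (q - z0)\<bar> = s" "F q \<in> ray"
    using frontier_image_square[OF F] by blast
  then obtain \<tau> where \<tau>: "\<tau> \<ge> 1" "F q = F z0 + of_real \<tau> * (F z1 - F z0)" by (auto simp: ray_def)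
  have "1 * norm (F z1 - F z0) \<le> \<tau> * norm (F z1 - F z0)" using \<tau>(1) by (intro mult_right_mono) auto
  then have "norm (F z1 - F z0) \<le> norm (F q - F z0)" using \<tau> by (simp add: norm_mult)
  then show ?thesis using p(1) p' q(1) by blast
qed

text \<open>The inequality of arithmetic and geometric means, applied pointwise in place of
  Cauchy-Schwarz; the parameter \<open>\<alpha>\<close> is chosen in the application.\<close>

lemma nn_integral_le_square:
  fixes h :: "complex \<Rightarrow> complex"
  assumes [measurable]: "h \<in> borel_measurable borel" "E \<in> sets borel" and \<alpha>: "\<alpha> > 0"
  shows "L1_on E h
    \<le> ennreal (\<alpha> / 2) * emeasure lborel E + ennreal (1 / (2 * \<alpha>)) * (\<integral>\<^sup>+z. indicator E z * ennreal ((norm (h z))\<^sup>2) \<partial>lborel)"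
proof -
  have amgm: "x \<le> \<alpha> / 2 + 1 / (2 * \<alpha>) * x\<^sup>2" for x :: real
  proof -
    have "0 \<le> (x - \<alpha>)\<^sup>2 / (2 * \<alpha>)" using \<alpha> by simp
    also have "\<dots> = \<alpha> / 2 + 1 / (2 * \<alpha>) * x\<^sup>2 - x" using \<alpha> by (simp add: power2_eq_square field_simps)
    finally show ?thesis by simp
  qed
  have "L1_on E h
      \<le> (\<integral>\<^sup>+z. ennreal (\<alpha> / 2) * indicator E z + ennreal (1 / (2 * \<alpha>)) * (indicator E z * ennreal ((norm (h z))\<^sup>2)) \<partial>lborel)"
  proof (rule nn_integral_mono)
    fix z
    have "ennreal (norm (h z)) \<le> ennreal (\<alpha> / 2 + 1 / (2 * \<alpha>) * (norm (h z))\<^sup>2)" by (rule ennreal_leI[OF amgm])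
    also have "\<dots> = ennreal (\<alpha> / 2) + ennreal (1 / (2 * \<alpha>)) * ennreal ((norm (h z))\<^sup>2)"
      using \<alpha> by (subst ennreal_plus) (auto simp: ennreal_mult[symmetric])
    finally show "indicator E z * ennreal (norm (h z)) \<le> ennreal (\<alpha> / 2) * indicator E z + ennreal (1 / (2 * \<alpha>)) * (indicator E z * ennreal ((norm (h z))\<^sup>2))"
      by (auto simp: indicator_def)
  qed
  also have "\<dots> = ennreal (\<alpha> / 2) * emeasure lborel E + ennreal (1 / (2 * \<alpha>)) * (\<integral>\<^sup>+z. indicator E z * ennreal ((norm (h z))\<^sup>2) \<partial>lborel)"
    by (simp add: nn_integral_add nn_integral_cmult nn_integral_cmult_indicator)
  finally show ?thesis .
qed

text \<open>The exponent is a number of rings larger than area permits. Their radii grow by the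
  factor 8 from \<open>norm (F z2 - F z0)\<close>; each ring uses up area at least
  \<open>s\<^sup>2 / (409600 * K)\<close> of a square of area \<open>4 * s\<^sup>2\<close>, and
  1638400 = 4 * 409600. The leading 2 leaves room for the outer circle of the last ring.\<close>

definition distortion :: "real \<Rightarrow> real" where
  "distortion K = 2 * 8 ^ nat \<lceil>1638400 * K + 1\<rceil>"

text \<open>Each of many disjoint rings around \<open>F z0\<close> separates \<open>{F z0, F z2}\<close> from \<open>F z1\<close>, so its preimage
  takes up a fixed fraction of the area of the square of side \<open>2 s\<close> around \<open>z0\<close>.\<close>

lemma quasiconformal_square_distortion:
  assumes qc: "quasiconformal_on K UNIV F" and s: "s > 0"
    and z1: "\<bar>Re (z1 - z0)\<bar> \<le> s / 2" "\<bar>Im (z1 - z0)\<bar> \<le> s / 2"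
    and z2: "max \<bar>Re (z2 - z0)\<bar> \<bar>Im (z2 - z0)\<bar> \<ge> s"
  shows "norm (F z1 - F z0) \<le> distortion K * norm (F z2 - F z0)"
proof (rule ccontr)
  assume neg: "\<not> norm (F z1 - F z0) \<le> distortion K * norm (F z2 - F z0)"
  have K: "K \<ge> 1" using qc by (simp add: quasiconformal_on_def)
  obtain g where cF: "continuous_on UNIV F" and inj: "inj F"
    and gm: "\<And>v. g v \<in> borel_measurable borel"
    and gi: "\<And>v M. integrable lborel (\<lambda>z. indicator (square M) z *\<^sub>R g v z)"
    and weak: "\<And>v. v \<in> {1, \<i>} \<Longrightarrow> weak_derivative F v (g v)"
    and dil: "\<And>v. v \<in> {1, \<i>} \<Longrightarrow> AE z in lborel. (norm (g v z))\<^sup>2 \<le> K * (Re (g 1 z) * Im (g \<i> z) - Im (g 1 z) * Re (g \<i> z))"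
    using quasiconformal_data[OF qc] by blast
  define J where "J z = \<bar>Re (g 1 z) * Im (g \<i> z) - Im (g 1 z) * Re (g \<i> z)\<bar>" for z
  \<comment> \<open>Large enough for the square of half side s around \<open>z0\<close> to lie in
    the square around 0 on which the approximations are controlled.\<close>
  define M where "M = s + norm z0"
  have M: "z \<in> square M" if "z - z0 \<in> square s" for z
    using that abs_Re_le_cmod[of z0] abs_Im_le_cmod[of z0] unfolding mem_square M_def minus_complex.simps by linarith
  obtain H D where SA: "smooth_approximation M F g H D"
    using smooth_approximation_exists[OF cF gm gi weak] by blast
  define r R where "r = norm (F z2 - F z0)" and "R = norm (F z1 - F z0)"
  define N where "N = nat \<lceil>1638400 * K + 1\<rceil>"
  have "z2 \<noteq> z0" using z2 s by auto
  then have r: "r > 0" using inj by (auto simp: r_def dest: injD)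
  have R: "2 * 8 ^ N * r < R" using neg by (simp add: distortion_def N_def r_def R_def)
  have "2 * 8 ^ N * r > 0" using r by simp
  then have "R > 0" using R by linarith
  then have "z1 \<noteq> z0" by (auto simp: R_def)
  have cross: "\<exists>p q. max \<bar>Re (p - z0)\<bar> \<bar>Im (p - z0)\<bar> = y \<and> max \<bar>Re (q - z0)\<bar> \<bar>Im (q - z0)\<bar> = y \<and>
     norm (F p - F z0) \<le> r \<and> R \<le> norm (F q - F z0)" if y: "y \<in> {s / 2<..<s}" for y
    unfolding r_def R_def
  proof (rule image_square_crossing[OF cF inj _ _ _ \<open>z1 \<noteq> z0\<close>])
    show "y > 0" using y s by auto
    show "z1 \<in> open_square z0 y" using z1 y by (auto simp: open_square_def)
    show "z2 \<notin> open_square z0 y" using z2 y unfolding open_square_def by auto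
  qed
  have [measurable]: "F \<in> borel_measurable borel" using cF by (rule borel_measurable_continuous_onI)
  note [measurable] = gm
  have [measurable]: "J \<in> borel_measurable borel" unfolding J_def[abs_def] by measurable
  \<comment> \<open>Ring j lies between the radii \<open>t j / 2\<close> and
    \<open>5 * t j / 2\<close>; the factor 8 exceeds 5, so different rings are disjoint.\<close>
  define t where "t j = 8 ^ j * r" for j :: nat
  define E where "E j = {z. z - z0 \<in> square s \<and> t j / 2 < norm (F z - F z0) \<and> norm (F z - F z0) < 5 * t j / 2}" for j
  have Em [measurable]: "E j \<in> sets borel" for j unfolding E_def by measurable
  have tp: "t j > 0" for j using r by (simp add: t_def)
  define Q where "Q = cbox (z0 - Complex s s) (z0 + Complex s s)"
  have Q: "emeasure lborel Q = ennreal (4 * s\<^sup>2)"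
    unfolding Q_def using s by (subst emeasure_lborel_cbox) (auto simp: Basis_complex_def power2_eq_square)
  have EQ: "E j \<subseteq> Q" for j by (auto simp: E_def Q_def mem_square in_cbox_complex_iff abs_le_iff)
  have Efin: "emeasure lborel (E j) = ennreal (measure lborel (E j))" for j
  proof (rule emeasure_eq_ennreal_measure)
    have "emeasure lborel (E j) \<le> emeasure lborel Q" by (rule emeasure_mono[OF EQ]) (simp add: Q_def)
    then show "emeasure lborel (E j) \<noteq> top" unfolding Q by (auto simp: top_unique)
  qed
  have single: "s\<^sup>2 \<le> 409600 * K * measure lborel (E j)" if j: "j \<in> {1..N}" for j
  proof -
    define e where "e = measure lborel (E j)"
    have rt: "r < t j" using r j one_less_power[of "8::real" j] by (simp add: t_def)
    have tR: "2 * t j < R"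
    proof -
      have "(8::real) ^ j \<le> 8 ^ N" using j by (intro power_increasing) auto
      then have "2 * t j \<le> 2 * 8 ^ N * r" using r by (simp add: t_def mult_right_mono)
      then show ?thesis using R by simp
    qed
    have la: "ennreal (t j * (s - s / 2)) \<le> 32 * (L1_on (E j) (g 1) + L1_on (E j) (g \<i>))"
      unfolding E_def
      by (rule length_area[OF SA gm cF M _ _ _ rt tR cross]) (use s r in auto)
    \<comment> \<open>With \<open>\<alpha> = t j * \<beta>\<close> the radius cancels from the
      estimate, and this \<open>\<beta>\<close> makes the term \<open>32 * 25 * K / \<beta>\<close>
      equal to \<open>s / 4\<close>, half of the left side \<open>s - s / 2\<close>.\<close>
    define \<beta> where "\<beta> = 3200 * K / s"
    have \<beta>: "\<beta> > 0" using K s by (simp add: \<beta>_def)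
    define \<alpha> where "\<alpha> = t j * \<beta>"
    have \<alpha>: "\<alpha> > 0" using \<beta> tp by (simp add: \<alpha>_def)
    have gv: "L1_on (E j) (g v) \<le> ennreal (\<alpha> / 2 * e + 25 * K * (t j)\<^sup>2 / (2 * \<alpha>))"
      if v: "v \<in> {1, \<i>}" for v
    proof -
      have "(\<integral>\<^sup>+z. indicator (E j) z * ennreal ((norm (g v z))\<^sup>2) \<partial>lborel) \<le> (\<integral>\<^sup>+z. ennreal K * (indicator (E j) z * ennreal (J z)) \<partial>lborel)"
      proof (rule nn_integral_mono_AE)
        show "AE z in lborel. indicator (E j) z * ennreal ((norm (g v z))\<^sup>2) \<le> ennreal K * (indicator (E j) z * ennreal (J z))"
          using dil[OF v]
        proof eventually_elim
          case (elim z)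
          also have "K * (Re (g 1 z) * Im (g \<i> z) - Im (g 1 z) * Re (g \<i> z)) \<le> K * J z"
            unfolding J_def using K by (intro mult_left_mono) auto
          finally have "ennreal ((norm (g v z))\<^sup>2) \<le> ennreal K * ennreal (J z)"
            using K by (simp add: ennreal_mult[symmetric] J_def ennreal_leI)
          then show ?case by (auto simp: indicator_def)
        qed
      qed
      also have "\<dots> = ennreal K * (\<integral>\<^sup>+z. indicator (E j) z * ennreal (J z) \<partial>lborel)" by (rule nn_integral_cmult) measurable
      also have "\<dots> \<le> ennreal K * emeasure lborel (ball (F z0) (5 * t j / 2))"
        unfolding J_def
        by (intro mult_left_mono jacobian_integral_le[OF SA gm inj Em])
          (use M in \<open>auto simp: E_def dist_norm norm_minus_commute\<close>)
      also have "\<dots> \<le> ennreal K * ennreal (4 * (5 * t j / 2)\<^sup>2)"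
        using tp[of j] by (intro mult_left_mono emeasure_ball_le) auto
      also have "\<dots> = ennreal (25 * K * (t j)\<^sup>2)" using K by (simp add: ennreal_mult[symmetric] power2_eq_square)
      finally have sq: "(\<integral>\<^sup>+z. indicator (E j) z * ennreal ((norm (g v z))\<^sup>2) \<partial>lborel) \<le> ennreal (25 * K * (t j)\<^sup>2)" .
      have "L1_on (E j) (g v)
        \<le> ennreal (\<alpha> / 2) * emeasure lborel (E j) + ennreal (1 / (2 * \<alpha>)) * (\<integral>\<^sup>+z. indicator (E j) z * ennreal ((norm (g v z))\<^sup>2) \<partial>lborel)"
        by (rule nn_integral_le_square[OF gm Em \<alpha>])
      also have "\<dots> \<le> ennreal (\<alpha> / 2) * ennreal e + ennreal (1 / (2 * \<alpha>)) * ennreal (25 * K * (t j)\<^sup>2)"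
        unfolding e_def Efin by (intro add_mono mult_left_mono sq) auto
      also have "\<dots> = ennreal (\<alpha> / 2 * e + 25 * K * (t j)\<^sup>2 / (2 * \<alpha>))"
        using \<alpha> K by (simp add: ennreal_mult[symmetric] ennreal_plus[symmetric] e_def del: ennreal_plus)
      finally show ?thesis .
    qed
    have "ennreal (t j * (s - s / 2)) \<le> 32 * (ennreal (\<alpha> / 2 * e + 25 * K * (t j)\<^sup>2 / (2 * \<alpha>)) + ennreal (\<alpha> / 2 * e + 25 * K * (t j)\<^sup>2 / (2 * \<alpha>)))"
      by (rule order_trans[OF la]) (intro mult_left_mono add_mono gv; simp)
    also have "\<dots> = ennreal (32 * (\<alpha> * e + 25 * K * (t j)\<^sup>2 / \<alpha>))"
    proof -
      have nn: "\<alpha> / 2 * e + 25 * K * (t j)\<^sup>2 / (2 * \<alpha>) \<ge> 0" using \<alpha> K by (simp add: e_def)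
      have "32 * (ennreal (\<alpha> / 2 * e + 25 * K * (t j)\<^sup>2 / (2 * \<alpha>)) + ennreal (\<alpha> / 2 * e + 25 * K * (t j)\<^sup>2 / (2 * \<alpha>)))
         = ennreal (32 * ((\<alpha> / 2 * e + 25 * K * (t j)\<^sup>2 / (2 * \<alpha>)) + (\<alpha> / 2 * e + 25 * K * (t j)\<^sup>2 / (2 * \<alpha>))))"
        using nn by (simp only: ennreal_plus[symmetric] ennreal_mult ennreal_numeral add_nonneg_nonneg zero_le_numeral)
      then show ?thesis by (simp add: algebra_simps)
    qed
    finally have "t j * (s - s / 2) \<le> 32 * (\<alpha> * e + 25 * K * (t j)\<^sup>2 / \<alpha>)"
      using \<alpha> K by (subst (asm) ennreal_le_iff) (auto simp: e_def)
    also have "\<dots> = t j * (32 * (\<beta> * e + 25 * K / \<beta>))"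
      using tp[of j] \<beta> by (simp add: \<alpha>_def power2_eq_square field_simps)
    finally have "s - s / 2 \<le> 32 * (\<beta> * e + 25 * K / \<beta>)" using tp[of j] by (simp only: mult_le_cancel_left_pos)
    also have "\<dots> = 102400 * K * e / s + s / 4" using K s by (simp add: \<beta>_def field_simps)
    finally have "s / 4 \<le> 102400 * K * e / s" by simp
    then have "s / 4 * s \<le> 102400 * K * e" using s by (simp add: le_divide_eq)
    then show ?thesis by (simp add: e_def power2_eq_square)
  qed
  have disj: "disjoint_family_on E {1..N}"
  proof -
    have "E i \<inter> E j = {}" if "i < j" for i j
    proof -
      have "(8::real) ^ Suc i \<le> 8 ^ j" using that by (intro power_increasing) auto
      then have "8 * t i \<le> t j" using r by (simp add: t_def mult_right_mono)
      then show ?thesis using tp[of i] by (auto simp: E_def)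
    qed
    then show ?thesis unfolding disjoint_family_on_def by (metis Int_commute linorder_neqE_nat)
  qed
  have "real N * s\<^sup>2 = (\<Sum>j\<in>{1..N}. s\<^sup>2)" by simp
  also have "\<dots> \<le> (\<Sum>j\<in>{1..N}. 409600 * K * measure lborel (E j))" by (rule sum_mono[OF single])
  also have "\<dots> = 409600 * K * measure lborel (\<Union>j\<in>{1..N}. E j)"
    using disj Efin by (subst measure_finite_Union) (auto simp: sum_distrib_left)
  also have "\<dots> \<le> 409600 * K * (4 * s\<^sup>2)"
  proof (rule mult_left_mono)
    have "measure lborel (\<Union>j\<in>{1..N}. E j) \<le> measure lborel Q"
      using EQ by (intro measure_mono_fmeasurable) (auto simp: Q_def)
    also have "\<dots> = 4 * s\<^sup>2" using Q by (simp add: measure_def)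
    finally show "measure lborel (\<Union>j\<in>{1..N}. E j) \<le> 4 * s\<^sup>2" .
  qed (use K in simp)
  finally have "real N * s\<^sup>2 \<le> (1638400 * K) * s\<^sup>2" by simp
  then have "real N \<le> 1638400 * K" using s by (simp add: mult_le_cancel_right)
  moreover have "real N \<ge> 1638400 * K + 1" unfolding N_def by linarith
  ultimately show False by simp
qed

text \<open>The distortion bound compares two points only if one is at least twice as far from the
  centre as the other. If m is in the first half of the interval from n to k, the centre is n;
  otherwise it is k, and the triangle inequality accounts for the 1 added to
  \<open>distortion K\<close>.\<close>

lemma quasiconformal_extension_implies_three_point:
  "quantitatively_implies integer_bijections
     (\<lambda>K f. has_quasiconformal_extension K f)
     (\<lambda>lam f. three_point_condition lam (\<lambda>n. f (of_int n)))"
  unfolding quantitatively_implies_def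
proof
  fix K
  have L: "distortion K \<ge> 0" by (simp add: distortion_def)
  have "three_point_condition (distortion K + 1) (\<lambda>n. f (of_int n))" if ext: "has_quasiconformal_extension K f" for f
    unfolding three_point_condition_def
  proof (intro conjI allI impI)
    obtain F where "quasiconformal_on K UNIV F" "\<forall>n\<in>\<int>. F n = f n"
      using ext unfolding has_quasiconformal_extension_def by blast
    then have F: "quasiconformal_on K UNIV F" "\<And>n. F (of_int n) = f (of_int n)" by simp_all
    fix n m k :: int assume nmk: "n < m \<and> m < k"
    have key: "norm (f (of_int y) - f (of_int x)) \<le> distortion K * norm (f (of_int z) - f (of_int x))"
      if "2 * \<bar>y - x\<bar> \<le> \<bar>z - x\<bar>" "z \<noteq> x" for x y z :: int
    proof -
      have "real_of_int (2 * \<bar>y - x\<bar>) \<le> real_of_int \<bar>z - x\<bar>" using that(1) by (simp only: of_int_le_iff)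
      then have "2 * \<bar>real_of_int y - real_of_int x\<bar> \<le> \<bar>real_of_int z - real_of_int x\<bar>" by simp
      then have "norm (F (of_int y) - F (of_int x)) \<le> distortion K * norm (F (of_int z) - F (of_int x))"
        using that(2) by (intro quasiconformal_square_distortion[OF F(1), of "\<bar>real_of_int z - real_of_int x\<bar>"]) auto
      then show ?thesis by (simp add: F(2))
    qed
    have "norm (f (of_int n) - f (of_int m)) \<le> (distortion K + 1) * norm (f (of_int n) - f (of_int k))"
    proof (cases "2 * (m - n) \<le> k - n")
      case True
      then have "norm (f (of_int m) - f (of_int n)) \<le> distortion K * norm (f (of_int k) - f (of_int n))"
        using nmk by (intro key) auto
      also have "\<dots> \<le> (distortion K + 1) * norm (f (of_int k) - f (of_int n))" by (intro mult_right_mono) auto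
      finally show ?thesis by (simp only: norm_minus_commute)
    next
      case False
      then have "norm (f (of_int m) - f (of_int k)) \<le> distortion K * norm (f (of_int n) - f (of_int k))"
        using nmk by (intro key) auto
      moreover have "norm (f (of_int n) - f (of_int m)) \<le> norm (f (of_int n) - f (of_int k)) + norm (f (of_int m) - f (of_int k))"
        using norm_triangle_ineq4[of "f (of_int n) - f (of_int k)" "f (of_int m) - f (of_int k)"] by simp
      ultimately show ?thesis by (simp add: algebra_simps)
    qed
    \<comment> \<open>A vanishing denominator makes the quotient 0 by the convention for
      division.\<close>
    then show "norm ((f (of_int n) - f (of_int m)) / (f (of_int n) - f (of_int k))) \<le> distortion K + 1"
      using L by (cases "f (of_int n) = f (of_int k)") (simp_all add: norm_divide divide_le_eq)
  qed (use L in simp)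
  then show "\<exists>lam. \<forall>f\<in>integer_bijections. has_quasiconformal_extension K f \<longrightarrow> three_point_condition lam (\<lambda>n. f (of_int n))"
    by blast
qed

theorem theorem2:
  shows "quantitatively_equivalent integer_bijections
            (\<lambda>\<eta> f. quasisymmetric_on \<eta> \<int> f)
            (\<lambda>lam f. three_point_condition lam (\<lambda>n. f (of_int n))) \<and>
         quantitatively_equivalent integer_bijections
            (\<lambda>lam f. three_point_condition lam (\<lambda>n. f (of_int n)))
            (\<lambda>K f. has_quasiconformal_extension K f) \<and>
         quantitatively_equivalent integer_bijections
            (\<lambda>\<eta> f. quasisymmetric_on \<eta> \<int> f)
            (\<lambda>K f. has_quasiconformal_extension K f)"
proof -
  \<comment> \<open>Quasisymmetry and extendability are compared through the three point condition,
    whose constant is again chosen before f.\<close>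
  have trans: "quantitatively_implies C P R"
    if "quantitatively_implies C P Q" "quantitatively_implies C Q R"
    for C :: "(complex \<Rightarrow> complex) set" and P :: "'a \<Rightarrow> _ \<Rightarrow> bool" and Q :: "'b \<Rightarrow> _ \<Rightarrow> bool" and R :: "'c \<Rightarrow> _ \<Rightarrow> bool"
    using that unfolding quantitatively_implies_def by meson
  show ?thesis
    unfolding quantitatively_equivalent_def
    by (intro conjI quasisymmetric_implies_three_point three_point_implies_quasisymmetric
        three_point_implies_quasiconformal_extension quasiconformal_extension_implies_three_point
        trans[OF quasisymmetric_implies_three_point three_point_implies_quasiconformal_extension]
        trans[OF quasiconformal_extension_implies_three_point three_point_implies_quasisymmetric])
qed

end
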